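(* In situation (a) or (b) below, there is an infinite Galois extension $F/K(B)$ whose local decomposition degrees are uniformly bounded, but such that $F\not\subset K(B)^{(d)}$ for any integer $d\geq 1$, and that is branched at only finitely many points: (a) $K$ is an algebraically closed field of characteristic $p>0$ and $B$ is a (smooth projective geometrically integral) curve of genus $\geq 1$ over $K$; (b) $K$ is an algebraically closed field of characteristic $0$ and $B=\mathbb P^1$.
   Context: For an integer $d\geq 1$, $K(B)^{(d)}$ is the compositum (in a fixed algebraic closure) of all finite extensions of $K(B)$ of degree $\leq d$. The field $K$ is given with the trivial localization set $\mathcal M=\{0\}$; since $K$ is algebraically closed, the only local field over $K$ is $K$ itself. For $t_0\in B(K)$, the local decomposition degree of $F/K(B)$ at $t_0$ is the order of the decomposition group of $F/K(B)$ at $t_0$. These degrees are uniformly bounded if there is a constant $\delta$, independent of $t_0$, such that all of them are finite and $\leq\delta$. *)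

theory Defs
  imports
    "HOL-Analysis.Cartesian_Space"
    "HOL-Computational_Algebra.Polynomial"
    "HOL-Library.Poly_Mapping"
    "HOL-Library.FuncSet"
begin

section \<open>Projective varieties over an algebraically closed field\<close>

text \<open>Polynomials in variables indexed by the finite type \<open>'n\<close> are elements of the
  monoid algebra of the exponent vectors. The projective space with homogeneous
  coordinates indexed by \<open>'n\<close> has dimension \<open>CARD('n) - 1\<close>; its points are the lines
  through the origin.\<close>

type_synonym ('n, 'k) mpoly = "('n \<Rightarrow>\<^sub>0 nat) \<Rightarrow>\<^sub>0 'k"

text \<open>The value at \<open>x\<close> of the polynomial obtained from \<open>f\<close> by applying \<open>\<iota>\<close> to its
  coefficients.\<close>

definition eval_at ::
  "('k::zero \<Rightarrow> 'a::comm_semiring_1) \<Rightarrow> ('n::finite, 'k) mpoly \<Rightarrow> 'a ^ 'n \<Rightarrow> 'a" where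
  "eval_at \<iota> f x =
     (\<Sum>m\<in>Poly_Mapping.keys f.
        \<iota> (Poly_Mapping.lookup f m) * (\<Prod>i\<in>UNIV. (x $ i) ^ Poly_Mapping.lookup m i))"

definition homogeneous :: "nat \<Rightarrow> ('n::finite, 'k::zero) mpoly \<Rightarrow> bool" where
  "homogeneous d f \<longleftrightarrow>
     (\<forall>m\<in>Poly_Mapping.keys f. (\<Sum>i\<in>UNIV. Poly_Mapping.lookup m i) = d)"

definition partial_deriv ::
  "'n \<Rightarrow> ('n::finite, 'k::comm_semiring_1) mpoly \<Rightarrow> ('n, 'k) mpoly" where
  "partial_deriv i f =
     (\<Sum>m\<in>Poly_Mapping.keys f.
        Poly_Mapping.single (m - Poly_Mapping.single i 1)
          (of_nat (Poly_Mapping.lookup m i) * Poly_Mapping.lookup f m))"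

definition proj_space :: "('k::field ^ 'n::finite) set set" where
  "proj_space = {vec.span {v} | v. v \<noteq> 0}"

text \<open>For homogeneous \<open>f\<close>, vanishing on the whole line \<open>t\<close> is the same as vanishing at
  one nonzero vector of \<open>t\<close>.\<close>

definition zariski_closed :: "('k::field ^ 'n::finite) set set \<Rightarrow> bool" where
  "zariski_closed Z \<longleftrightarrow>
     (\<exists>T. (\<forall>f\<in>T. \<exists>d. homogeneous d f) \<and>
          Z = {t \<in> proj_space. \<forall>f\<in>T. \<forall>x\<in>t. eval_at id f x = 0})"

definition zariski_irreducible :: "('k::field ^ 'n::finite) set set \<Rightarrow> bool" where
  "zariski_irreducible X \<longleftrightarrow>
     zariski_closed X \<and> X \<noteq> {} \<and>
     (\<forall>Y Z. zariski_closed Y \<longrightarrow> zariski_closed Z \<longrightarrow> X \<subseteq> Y \<union> Z \<longrightarrow> X \<subseteq> Y \<or> X \<subseteq> Z)"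

definition has_irreducible_chain :: "('k::field ^ 'n::finite) set set \<Rightarrow> nat \<Rightarrow> bool" where
  "has_irreducible_chain X d \<longleftrightarrow>
     (\<exists>Z. (\<forall>i\<le>d. zariski_irreducible (Z i) \<and> Z i \<subseteq> X) \<and> (\<forall>i<d. Z i \<subset> Z (Suc i)))"

definition zariski_dim_eq :: "('k::field ^ 'n::finite) set set \<Rightarrow> nat \<Rightarrow> bool" where
  "zariski_dim_eq X d \<longleftrightarrow> has_irreducible_chain X d \<and> \<not> has_irreducible_chain X (Suc d)"

definition vanishing_ideal :: "('k::field ^ 'n::finite) set set \<Rightarrow> ('n, 'k) mpoly set" where
  "vanishing_ideal X = {f. \<forall>t\<in>X. \<forall>x\<in>t. eval_at id f x = 0}"

text \<open>The kernel at \<open>x\<close> of the Jacobian matrix of the homogeneous equations of \<open>X\<close>. The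
  Jacobian criterion for smoothness in dimension 1 asks for rank \<open>CARD('n) - 2\<close>, that is,
  for a 2-dimensional kernel, at any nonzero representative of each point.\<close>

definition jacobian_kernel ::
  "('k::field ^ 'n::finite) set set \<Rightarrow> 'k ^ 'n \<Rightarrow> ('k ^ 'n) set" where
  "jacobian_kernel X x =
     {v. \<forall>f\<in>vanishing_ideal X. (\<exists>d. homogeneous d f) \<longrightarrow>
           (\<Sum>i\<in>UNIV. eval_at id (partial_deriv i f) x * v $ i) = 0}"

text \<open>Over an algebraically closed field the geometrically integral closed subschemes of
  projective space are the irreducible closed sets of points, with their reduced structure.\<close>

definition smooth_projective_curve ::
  "('k::alg_closed_field ^ 'n::finite) set set \<Rightarrow> bool" where
  "smooth_projective_curve B \<longleftrightarrow>
     zariski_irreducible B \<and> zariski_dim_eq B 1 \<and>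
     (\<forall>t\<in>B. \<forall>x\<in>t. x \<noteq> 0 \<longrightarrow> vec.dim (jacobian_kernel B x) = 2)"


section \<open>Function field, local rings and genus\<close>

definition field_embedding :: "('k::field \<Rightarrow> 'a::field) \<Rightarrow> bool" where
  "field_embedding \<iota> \<longleftrightarrow>
     \<iota> 1 = 1 \<and> (\<forall>x y. \<iota> (x + y) = \<iota> x + \<iota> y) \<and> (\<forall>x y. \<iota> (x * y) = \<iota> x * \<iota> y)"

text \<open>Let \<open>\<iota>\<close> embed \<open>K\<close> into a field \<open>\<Omega>\<close>. The function field \<open>K(B)\<close> consists of the
  fractions \<open>f/g\<close> of homogeneous polynomials of equal degree modulo the ideal of \<open>B\<close>, with
  \<open>g\<close> outside the ideal. To give a \<open>K\<close>-embedding of \<open>K(B)\<close> into \<open>\<Omega>\<close> is to give, up to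
  scaling, homogeneous coordinates \<open>\<xi>\<close> in \<open>\<Omega>\<close> of a generic point of \<open>B\<close>; the embedding
  sends \<open>f/g\<close> to \<open>f(\<xi>)/g(\<xi>)\<close>. Below, \<open>K(B)\<close> and its subrings are identified with their
  images under this embedding.\<close>

definition generic_point ::
  "('k::field \<Rightarrow> 'a::field) \<Rightarrow> ('k ^ 'n::finite) set set \<Rightarrow> 'a ^ 'n \<Rightarrow> bool" where
  "generic_point \<iota> B \<xi> \<longleftrightarrow>
     (\<forall>d f. homogeneous d f \<longrightarrow> (eval_at \<iota> f \<xi> = 0 \<longleftrightarrow> f \<in> vanishing_ideal B))"

definition function_field :: "('k::field \<Rightarrow> 'a::field) \<Rightarrow> 'a ^ 'n::finite \<Rightarrow> 'a set" where
  "function_field \<iota> \<xi> =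
     {eval_at \<iota> f \<xi> / eval_at \<iota> g \<xi> | f g.
        (\<exists>d. homogeneous d f \<and> homogeneous d g) \<and> eval_at \<iota> g \<xi> \<noteq> 0}"

text \<open>The local ring of \<open>B\<close> at a point \<open>t\<close> of \<open>B\<close>; a \<open>g\<close> with \<open>g(t) \<noteq> 0\<close> is
  automatically outside the ideal of \<open>B\<close>.\<close>

definition local_ring ::
  "('k::field \<Rightarrow> 'a::field) \<Rightarrow> 'a ^ 'n::finite \<Rightarrow> ('k ^ 'n) set \<Rightarrow> 'a set" where
  "local_ring \<iota> \<xi> t =
     {eval_at \<iota> f \<xi> / eval_at \<iota> g \<xi> | f g.
        (\<exists>d. homogeneous d f \<and> homogeneous d g) \<and> (\<exists>x\<in>t. eval_at id g x \<noteq> 0)}"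

text \<open>The genus of \<open>B\<close> is \<open>dim H\<^sup>1(B, O\<^sub>B)\<close> over \<open>K\<close>. As in Serre's "Groupes
  algebriques et corps de classes", the flasque resolution of the structure sheaf by the
  constant sheaf \<open>K(B)\<close> and the principal parts identifies \<open>H\<^sup>1(B, O\<^sub>B)\<close> with
  \<open>R / (R(0) + K(B))\<close>, where \<open>R\<close> are the repartitions (families of functions indexed by the
  points, almost all regular at their index) and \<open>R(0)\<close> those regular everywhere. The
  definition says that the classes of \<open>e 0, \<dots>, e (g - 1)\<close> form a \<open>K\<close>-basis of it.\<close>

definition repartitions ::
  "('k::field \<Rightarrow> 'a::field) \<Rightarrow> ('k ^ 'n::finite) set set \<Rightarrow> 'a ^ 'n
     \<Rightarrow> (('k ^ 'n) set \<Rightarrow> 'a) set" where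
  "repartitions \<iota> B \<xi> =
     {r. (\<forall>t\<in>B. r t \<in> function_field \<iota> \<xi>) \<and> finite {t \<in> B. r t \<notin> local_ring \<iota> \<xi> t}}"

definition genus_eq ::
  "('k::field \<Rightarrow> 'a::field) \<Rightarrow> ('k ^ 'n::finite) set set \<Rightarrow> 'a ^ 'n \<Rightarrow> nat \<Rightarrow> bool" where
  "genus_eq \<iota> B \<xi> g \<longleftrightarrow>
     (\<exists>e. (\<forall>i<g. e i \<in> repartitions \<iota> B \<xi>) \<and>
          (\<forall>r\<in>repartitions \<iota> B \<xi>.
             \<exists>!c. c \<in> extensional {..<g} \<and>
                  (\<exists>s\<in>function_field \<iota> \<xi>. \<forall>t\<in>B.
                     r t - (\<Sum>i<g. \<iota> (c i) * e i t) - s \<in> local_ring \<iota> \<xi> t)))"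


section \<open>Field extensions inside an ambient field\<close>

definition is_subfield :: "'a::field set \<Rightarrow> bool" where
  "is_subfield L \<longleftrightarrow>
     1 \<in> L \<and> (\<forall>x\<in>L. \<forall>y\<in>L. x - y \<in> L \<and> x * y \<in> L) \<and> (\<forall>x\<in>L. inverse x \<in> L)"

definition is_extension :: "'a::field set \<Rightarrow> 'a set \<Rightarrow> bool" where
  "is_extension L E \<longleftrightarrow> is_subfield L \<and> is_subfield E \<and> L \<subseteq> E"

definition spans_over :: "'a::field set \<Rightarrow> 'a set \<Rightarrow> 'a set \<Rightarrow> bool" where
  "spans_over L S E \<longleftrightarrow>
     finite S \<and> S \<subseteq> E \<and> (\<forall>x\<in>E. \<exists>c. (\<forall>s\<in>S. c s \<in> L) \<and> x = (\<Sum>s\<in>S. c s * s))"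

definition finite_extension :: "'a::field set \<Rightarrow> 'a set \<Rightarrow> bool" where
  "finite_extension L E \<longleftrightarrow> is_extension L E \<and> (\<exists>S. spans_over L S E)"

definition ext_degree :: "'a::field set \<Rightarrow> 'a set \<Rightarrow> nat" where
  "ext_degree L E = (LEAST d. \<exists>S. spans_over L S E \<and> card S = d)"

definition generated_subfield :: "'a::field set \<Rightarrow> 'a set" where
  "generated_subfield S = \<Inter>{M. is_subfield M \<and> S \<subseteq> M}"

text \<open>The compositum \<open>L\<^sup>(\<^sup>d\<^sup>)\<close>; here and below the ambient type \<open>'a\<close> plays the role of
  the fixed algebraic closure.\<close>

definition bounded_degree_compositum :: "'a::field set \<Rightarrow> nat \<Rightarrow> 'a set" where
  "bounded_degree_compositum L d =
     generated_subfield (\<Union>{E. finite_extension L E \<and> ext_degree L E \<le> d})"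

definition poly_over :: "'a::field set \<Rightarrow> 'a poly \<Rightarrow> bool" where
  "poly_over L p \<longleftrightarrow> (\<forall>i. coeff p i \<in> L)"

definition algebraic_over :: "'a::field set \<Rightarrow> 'a \<Rightarrow> bool" where
  "algebraic_over L x \<longleftrightarrow> (\<exists>p. p \<noteq> 0 \<and> poly_over L p \<and> poly p x = 0)"

definition is_min_poly :: "'a::field set \<Rightarrow> 'a \<Rightarrow> 'a poly \<Rightarrow> bool" where
  "is_min_poly L x p \<longleftrightarrow>
     poly_over L p \<and> lead_coeff p = 1 \<and> poly p x = 0 \<and>
     (\<forall>q. q \<noteq> 0 \<longrightarrow> poly_over L q \<longrightarrow> poly q x = 0 \<longrightarrow> degree p \<le> degree q)"

text \<open>Algebraic, normal and separable; as the ambient field is algebraically closed,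
  normality and separability can be read off the roots of minimal polynomials there.\<close>

definition galois_extension :: "'a::alg_closed_field set \<Rightarrow> 'a set \<Rightarrow> bool" where
  "galois_extension L F \<longleftrightarrow>
     is_extension L F \<and> (\<forall>x\<in>F. algebraic_over L x) \<and>
     (\<forall>x\<in>F. \<forall>p. is_min_poly L x p \<longrightarrow> {y. poly p y = 0} \<subseteq> F \<and> rsquarefree p)"

definition galois_group :: "'a::field set \<Rightarrow> 'a set \<Rightarrow> ('a \<Rightarrow> 'a) set" where
  "galois_group L F =
     {\<sigma> \<in> extensional F. bij_betw \<sigma> F F \<and>
        (\<forall>x\<in>F. \<forall>y\<in>F. \<sigma> (x + y) = \<sigma> x + \<sigma> y \<and> \<sigma> (x * y) = \<sigma> x * \<sigma> y) \<and>
        (\<forall>x\<in>L. \<sigma> x = x)}"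


section \<open>Decomposition and ramification\<close>

definition valuation_ring :: "'a::field set \<Rightarrow> 'a set \<Rightarrow> bool" where
  "valuation_ring F V \<longleftrightarrow>
     V \<subseteq> F \<and> 1 \<in> V \<and> (\<forall>x\<in>V. \<forall>y\<in>V. x - y \<in> V \<and> x * y \<in> V) \<and>
     (\<forall>x\<in>F. x \<in> V \<or> inverse x \<in> V)"

text \<open>The places of \<open>F\<close> above the point of the base curve whose local ring in the field \<open>L\<close>
  is \<open>A\<close>.\<close>

definition places_above :: "'a::field set \<Rightarrow> 'a set \<Rightarrow> 'a set \<Rightarrow> 'a set set" where
  "places_above L F A = {V. valuation_ring F V \<and> V \<inter> L = A}"

definition maximal_ideal_of :: "'a::field set \<Rightarrow> 'a set" where
  "maximal_ideal_of V = {x \<in> V. x = 0 \<or> inverse x \<notin> V}"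

definition decomposition_group ::
  "'a::field set \<Rightarrow> 'a set \<Rightarrow> 'a set \<Rightarrow> ('a \<Rightarrow> 'a) set" where
  "decomposition_group L F V = {\<sigma> \<in> galois_group L F. \<sigma> ` V = V}"

definition inertia_group :: "'a::field set \<Rightarrow> 'a set \<Rightarrow> 'a set \<Rightarrow> ('a \<Rightarrow> 'a) set" where
  "inertia_group L F V =
     {\<sigma> \<in> decomposition_group L F V. \<forall>x\<in>V. \<sigma> x - x \<in> maximal_ideal_of V}"

text \<open>The places of \<open>F\<close> above one point are conjugate, so their decomposition groups have
  the same order: the local decomposition degree at that point.\<close>

definition local_degrees_uniformly_bounded ::
  "('k::field \<Rightarrow> 'a::field) \<Rightarrow> ('k ^ 'n::finite) set set \<Rightarrow> 'a ^ 'n \<Rightarrow> 'a set \<Rightarrow> bool" where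
  "local_degrees_uniformly_bounded \<iota> B \<xi> F \<longleftrightarrow>
     (\<exists>\<delta>::nat. \<forall>t\<in>B. \<forall>V\<in>places_above (function_field \<iota> \<xi>) F (local_ring \<iota> \<xi> t).
        finite (decomposition_group (function_field \<iota> \<xi>) F V) \<and>
        card (decomposition_group (function_field \<iota> \<xi>) F V) \<le> \<delta>)"

definition branch_points ::
  "('k::field \<Rightarrow> 'a::field) \<Rightarrow> ('k ^ 'n::finite) set set \<Rightarrow> 'a ^ 'n \<Rightarrow> 'a set
     \<Rightarrow> ('k ^ 'n) set set" where
  "branch_points \<iota> B \<xi> F =
     {t \<in> B. \<exists>V\<in>places_above (function_field \<iota> \<xi>) F (local_ring \<iota> \<xi> t).
        \<exists>\<sigma>\<in>inertia_group (function_field \<iota> \<xi>) F V. \<exists>x\<in>F. \<sigma> x \<noteq> x}"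

end

theory Submission
  imports Defs
begin

text \<open>Let \<open>k\<close> be the image of \<open>K\<close> and \<open>L = K(B)\<close>. Only the dimension of \<open>B\<close> matters: \<open>L\<close> is finite
  over \<open>k(x)\<close> for some \<open>x\<close> outside \<open>k\<close>. View \<open>x\<close> as the abscissa of a point \<open>(x, s)\<close> of a fixed
  elliptic curve over \<open>k\<close> that has an endomorphism \<open>\<phi>\<close> of degree 2 with cyclic iterated kernels, and
  let \<open>F\<close> be generated over \<open>L\<close> by the coordinates of all points that some power of \<open>\<phi>\<close> maps to
  \<open>(x, s)\<close>. Over \<open>L(s)\<close> this is an unramified tower of quadratic extensions, and \<open>s\<close> has degree at
  most 2 over \<open>L\<close>; since the residue fields are algebraically closed, decomposition groups have order
  at most 2 and ramification occurs only above the branch points of the abscissa map. An automorphism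
  of \<open>F/L\<close> that translates a point of some level by the generator of the kernel of \<open>\<phi>\<close> has orbits of
  size \<open>2\<^sup>n\<close> \<open>n - 1\<close> levels above, whereas the \<open>d!\<close>-th power of every automorphism is trivial
  on \<open>L\<^sup>(\<^sup>d\<^sup>)\<close>.\<close>


section \<open>Subrings and subfields\<close>

text \<open>Every quadratic extension is written as \<open>u * (u - 1) = c\<close> with conjugation
  \<open>u \<mapsto> 1 - u\<close>, so that characteristic 2 needs no separate argument. In
  characteristic 0 a curve with an endomorphism of degree 2 has complex multiplication by an element
  of norm 2 in Z[i], Z[sqrt(-2)] or Z[(1 + sqrt(-7))/2]. In the first two rings the square of such
  an element is 2 up to a unit, so its kernel is not cyclic; only the third gives cyclic iterated
  kernels. This is the origin of \<open>4 * \<kappa>\<^sup>2 + 3 * \<kappa> + 1\<close>, whose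
  discriminant is -7. Cyclicity makes every lift to the next level double the order of a
  translation. The steps above \<open>s\<close> are unramified because the generator of the kernel
  acts by \<open>(r, q) \<mapsto> (1 - r, 1 - q)\<close>, whose only possible fixed point (1/2, 1/2)
  would be a singular point of the curve. One tool, the extension of homomorphisms from subrings to
  valuation rings, supplies the automorphisms over \<open>L\<close>, the points of closed sets, and
  the chains of closed sets that bound the transcendence degree of the function field.\<close>

definition is_subring :: "'a::comm_ring_1 set \<Rightarrow> bool" where
  "is_subring A \<longleftrightarrow> 1 \<in> A \<and> (\<forall>x\<in>A. \<forall>y\<in>A. x - y \<in> A \<and> x * y \<in> A)"

lemma is_subfield_imp_subring: "is_subfield A \<Longrightarrow> is_subring A"
  by (simp add: is_subfield_def is_subring_def)

lemma is_subfield_iff: "is_subfield A \<longleftrightarrow> is_subring A \<and> (\<forall>x\<in>A. inverse x \<in> A)"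
  by (auto simp: is_subfield_def is_subring_def)

context
  fixes A :: "'a::comm_ring_1 set"
  assumes A: "is_subring A"
begin

lemma subring_1: "1 \<in> A"
  using A by (simp add: is_subring_def)

lemma subring_diff: "x \<in> A \<Longrightarrow> y \<in> A \<Longrightarrow> x - y \<in> A"
  using A by (simp add: is_subring_def)

lemma subring_mult: "x \<in> A \<Longrightarrow> y \<in> A \<Longrightarrow> x * y \<in> A"
  using A by (simp add: is_subring_def)

lemma subring_0: "0 \<in> A"
  using subring_diff[OF subring_1 subring_1] by simp

lemma subring_uminus: "x \<in> A \<Longrightarrow> - x \<in> A"
  using subring_diff[OF subring_0, of x] by simp

lemma subring_add: "x \<in> A \<Longrightarrow> y \<in> A \<Longrightarrow> x + y \<in> A"
  using subring_diff[OF _ subring_uminus, of x y] by simp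

lemma subring_power: "x \<in> A \<Longrightarrow> x ^ n \<in> A"
  by (induction n) (auto intro: subring_1 subring_mult)

lemma subring_sum: "(\<And>i. i \<in> I \<Longrightarrow> f i \<in> A) \<Longrightarrow> sum f I \<in> A"
  by (induction I rule: infinite_finite_induct) (auto intro: subring_0 subring_add)

lemma subring_prod: "(\<And>i. i \<in> I \<Longrightarrow> f i \<in> A) \<Longrightarrow> prod f I \<in> A"
  by (induction I rule: infinite_finite_induct) (auto intro: subring_1 subring_mult)

lemma subring_of_nat: "of_nat n \<in> A"
  by (induction n) (auto intro: subring_0 subring_1 subring_add)

lemma subring_numeral: "numeral n \<in> A"
  using subring_of_nat[of "numeral n"] by simp

lemmas subring_intros = subring_0 subring_1 subring_diff subring_mult subring_uminus subring_add
  subring_power subring_sum subring_prod subring_numeral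

end

lemma subfield_inverse: "is_subfield A \<Longrightarrow> x \<in> A \<Longrightarrow> inverse x \<in> A"
  by (simp add: is_subfield_def)

lemma subfield_divide: "is_subfield A \<Longrightarrow> x \<in> A \<Longrightarrow> y \<in> A \<Longrightarrow> x / y \<in> A"
  by (simp add: divide_inverse is_subfield_def)

lemmas subfield_intros = subring_intros[OF is_subfield_imp_subring] subfield_inverse subfield_divide

lemma generated_subfield_is_subfield: "is_subfield (generated_subfield S)"
  by (auto simp: is_subfield_def generated_subfield_def)

lemma generated_subfield_superset: "S \<subseteq> generated_subfield S"
  by (auto simp: generated_subfield_def)

lemma generated_subfield_least: "is_subfield M \<Longrightarrow> S \<subseteq> M \<Longrightarrow> generated_subfield S \<subseteq> M"
  by (auto simp: generated_subfield_def)

section \<open>Polynomials with coefficients in a subring, and division without inverses\<close>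

lemma poly_eq_sum_atMost:
  fixes p :: "'a::field poly"
  assumes "degree p \<le> n"
  shows "poly p x = (\<Sum>i\<le>n. coeff p i * x ^ i)"
  unfolding poly_altdef using assms
  by (intro sum.mono_neutral_left) (auto simp: coeff_eq_0)

context
  fixes A :: "'a::field set"
  assumes A: "is_subring A"
begin

lemma poly_over_0: "poly_over A 0"
  using subring_0[OF A] by (simp add: poly_over_def)

lemma poly_over_pCons: "poly_over A (pCons a p) \<longleftrightarrow> a \<in> A \<and> poly_over A p"
  by (auto simp: poly_over_def coeff_pCons split: nat.splits)

lemma poly_over_diff: "poly_over A p \<Longrightarrow> poly_over A q \<Longrightarrow> poly_over A (p - q)"
  by (auto simp: poly_over_def intro!: subring_diff[OF A])

lemma poly_over_add: "poly_over A p \<Longrightarrow> poly_over A q \<Longrightarrow> poly_over A (p + q)"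
  by (auto simp: poly_over_def intro!: subring_add[OF A])

lemma poly_over_smult: "a \<in> A \<Longrightarrow> poly_over A p \<Longrightarrow> poly_over A (smult a p)"
  by (auto simp: poly_over_def intro!: subring_mult[OF A])

lemma poly_over_monom: "a \<in> A \<Longrightarrow> poly_over A (monom a n)"
  by (auto simp: poly_over_def intro!: subring_0[OF A])

lemma poly_over_mult: "poly_over A p \<Longrightarrow> poly_over A q \<Longrightarrow> poly_over A (p * q)"
  by (auto simp: poly_over_def coeff_mult intro!: subring_sum[OF A] subring_mult[OF A])

lemma poly_over_1: "poly_over A 1"
  by (auto simp: poly_over_def coeff_1 intro!: subring_intros[OF A])

lemma poly_in_subring: "poly_over A p \<Longrightarrow> x \<in> A \<Longrightarrow> poly p x \<in> A"
  unfolding poly_altdef by (auto simp: poly_over_def intro!: subring_intros[OF A])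

end

lemma poly_over_mono: "poly_over A p \<Longrightarrow> A \<subseteq> B \<Longrightarrow> poly_over B p"
  by (auto simp: poly_over_def)

lemma algebraic_over_mono: "algebraic_over A x \<Longrightarrow> A \<subseteq> B \<Longrightarrow> algebraic_over B x"
  unfolding algebraic_over_def using poly_over_mono by blast

definition adjoin_ring :: "'a::field set \<Rightarrow> 'a \<Rightarrow> 'a set" where
  "adjoin_ring A z = {poly p z | p. poly_over A p}"

lemma adjoin_ring_superset:
  assumes "is_subring A"
  shows "insert z A \<subseteq> adjoin_ring A z"
proof -
  have "poly_over A [:0, 1:]" "\<And>a. a \<in> A \<Longrightarrow> poly_over A [:a:]"
    using subring_intros[OF assms] by (simp_all add: poly_over_pCons[OF assms] poly_over_0[OF assms])
  moreover have "z = poly [:0, 1:] z" "\<And>a. a = poly [:a:] z"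
    by simp_all
  ultimately show ?thesis
    unfolding adjoin_ring_def by blast
qed

lemma adjoin_ring_is_subring:
  assumes A: "is_subring A"
  shows "is_subring (adjoin_ring A z)"
  unfolding is_subring_def
proof (intro conjI ballI)
  show "1 \<in> adjoin_ring A z"
    using adjoin_ring_superset[OF A] subring_1[OF A] by blast
  fix a b assume "a \<in> adjoin_ring A z" "b \<in> adjoin_ring A z"
  then obtain p q where pq: "poly_over A p" "poly_over A q" "a = poly p z" "b = poly q z"
    by (auto simp: adjoin_ring_def)
  have "a - b = poly (p - q) z" "a * b = poly (p * q) z"
    by (simp_all add: pq)
  then show "a - b \<in> adjoin_ring A z" "a * b \<in> adjoin_ring A z"
    unfolding adjoin_ring_def using poly_over_diff[OF A pq(1,2)] poly_over_mult[OF A pq(1,2)] by blast+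
qed

text \<open>The leading coefficient of \<open>q\<close> need not be invertible in \<open>A\<close>.
  Each step multiplies by it before cancelling, and \<open>c\<close> collects these factors, so
  quotient and remainder keep their coefficients in \<open>A\<close>.\<close>

lemma pseudo_division:
  fixes p q :: "'a::field poly"
  assumes A: "is_subring A" and q: "q \<noteq> 0" "poly_over A q" and p: "poly_over A p"
  shows "\<exists>c\<in>A. \<exists>s t. c \<noteq> 0 \<and> poly_over A s \<and> poly_over A t \<and> smult c p = q * s + t \<and>
           (t = 0 \<or> degree t < degree q)"
  using p
proof (induction "degree p" arbitrary: p rule: less_induct)
  case less
  show ?case
  proof (cases "p = 0 \<or> degree p < degree q")
    case True
    then show ?thesis
      using less.prems subring_1[OF A] poly_over_0[OF A]
      by (intro bexI[of _ 1] exI[of _ 0] exI[of _ p]) auto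
  next
    case False
    define l where "l = lead_coeff q"
    define h where "h = monom (lead_coeff p) (degree p - degree q)"
    define p' where "p' = smult l p - q * h"
    have l: "l \<in> A" "l \<noteq> 0"
      using q by (auto simp: l_def poly_over_def)
    have h: "poly_over A h"
      using less.prems by (auto simp: h_def poly_over_def intro!: subring_0[OF A])
    have p': "poly_over A p'"
      unfolding p'_def using less.prems q l h
      by (intro poly_over_diff poly_over_smult poly_over_mult A) auto
    have dh: "degree h = degree p - degree q" "lead_coeff h = lead_coeff p" "h \<noteq> 0"
      using False by (auto simp: h_def degree_monom_eq)
    then have deg: "degree (q * h) = degree p"
      using False q by (auto simp: degree_mult_eq)
    have lc: "coeff (q * h) (degree p) = coeff (smult l p) (degree p)"
      using lead_coeff_mult[of q h] unfolding deg dh(2) by (simp add: l_def)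
    have "p' = 0 \<or> degree p' < degree p"
    \<comment> \<open>In degree 0 cancelling the leading term cannot lower the degree; it makes
      \<open>p'\<close> vanish instead.\<close>
    proof (cases "degree p = 0")
      case True
      then have "degree p' = 0"
        using deg by (metis degree_diff_le degree_smult_le le_zero_eq p'_def)
      then have "p' = [:coeff p' 0:]"
        by (metis degree_0_id)
      moreover have "coeff p' 0 = 0"
        using lc True by (simp add: p'_def)
      ultimately show ?thesis
        by simp
    next
      case False
      have "degree p' \<le> degree p"
        unfolding p'_def using deg by (intro degree_diff_le) auto
      moreover have "coeff p' (degree p) = 0"
        using lc by (simp add: p'_def)
      ultimately show ?thesis
        by (metis le_neq_implies_less leading_coeff_0_iff)
    qed
    then have "\<exists>c\<in>A. \<exists>s t. c \<noteq> 0 \<and> poly_over A s \<and> poly_over A t \<and> smult c p' = q * s + t \<and>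
           (t = 0 \<or> degree t < degree q)"
    proof
      assume "p' = 0"
      then show ?thesis
        using subring_1[OF A] poly_over_0[OF A]
        by (intro bexI[of _ 1] exI[of _ 0] exI[of _ 0]) auto
    next
      assume "degree p' < degree p"
      then show ?thesis
        using less.hyps p' by blast
    qed
    then obtain c s t where *: "c \<in> A" "c \<noteq> 0" "poly_over A s" "poly_over A t"
      "smult c p' = q * s + t" "t = 0 \<or> degree t < degree q"
      by blast
    have "smult (c * l) p = q * (s + smult c h) + t"
      using *(5) by (simp add: p'_def smult_diff_right algebra_simps)
    moreover have "c * l \<in> A" "c * l \<noteq> 0" "poly_over A (s + smult c h)"
      using * l h by (auto intro!: subring_mult[OF A] poly_over_add[OF A] poly_over_smult[OF A])
    ultimately show ?thesis
      using * by blast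
  qed
qed

text \<open>\<open>I\<close> stands for an ideal, of which the argument asks stability under the
  combinations that occur in a pseudo-division by \<open>q\<close>. The remainder lies in
  \<open>I\<close> and is too short to be nonzero. Divisibility is meant in the full polynomial
  ring.\<close>

lemma minimal_annihilator_dvd:
  assumes A: "is_subring A" and q: "q \<noteq> 0" "poly_over A q"
    and p: "poly_over A p" "p \<in> I"
    and I: "\<And>c s p. c \<in> A \<Longrightarrow> poly_over A s \<Longrightarrow> poly_over A p \<Longrightarrow> p \<in> I \<Longrightarrow> smult c p - q * s \<in> I"
    and min: "\<And>t. t \<noteq> 0 \<Longrightarrow> poly_over A t \<Longrightarrow> t \<in> I \<Longrightarrow> degree q \<le> degree t"
  shows "q dvd (p :: 'a::field poly)"
proof -
  obtain c s t where *: "c \<in> A" "c \<noteq> 0" "poly_over A s" "poly_over A t"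
      "smult c p = q * s + t" "t = 0 \<or> degree t < degree q"
    using pseudo_division[OF A q p(1)] by blast
  have "t = smult c p - q * s"
    using *(5) by simp
  then have "t \<in> I"
    using I * p by blast
  then have "t = 0"
    using min * by fastforce
  then have "q dvd smult c p"
    using * by simp
  then show ?thesis
    using *(2) by (simp add: dvd_smult_iff)
qed


text \<open>\<open>k\<close> is a set and not a type, so its algebraic closedness is expressed by
  roots. Splitting off one root at a time drives the later inductions on the degree.\<close>

lemma closed_subfield_factor:
  fixes k :: "'a::field set"
  assumes k: "is_subfield k" and closed: "\<And>p. poly_over k p \<Longrightarrow> degree p > 0 \<Longrightarrow> \<exists>c\<in>k. poly p c = 0"
    and p: "poly_over k p" "degree p > 0"
  shows "\<exists>c\<in>k. \<exists>a\<in>k. \<exists>b. poly_over k b \<and> b \<noteq> 0 \<and> degree b < degree p \<and> smult a p = [:- c, 1:] * b"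
proof -
  note R = is_subfield_imp_subring[OF k]
  obtain c where c: "c \<in> k" "poly p c = 0"
    using closed p by blast
  have over: "poly_over k [:- c, 1:]"
    using c subfield_intros[OF k] by (simp add: poly_over_pCons[OF R] poly_over_0[OF R])
  obtain a b t where *: "a \<in> k" "a \<noteq> 0" "poly_over k b"
    "smult a p = [:- c, 1:] * b + t" "t = 0 \<or> degree t < degree [:- c, 1:]"
    using pseudo_division[OF R _ over p(1)] by fastforce
  have "degree t = 0"
    using *(5) by auto
  moreover have "poly t c = 0"
    using arg_cong[OF *(4), of "\<lambda>p. poly p c"] c(2) by simp
  ultimately have "t = 0"
    by (metis degree_eq_zeroE mult_zero_right pCons_0_0 poly_0 poly_pCons add.right_neutral)
  then have eq: "smult a p = [:- c, 1:] * b"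
    using *(4) by simp
  have b: "b \<noteq> 0"
    using eq p(2) *(2) by auto
  have "degree p = degree (smult a p)"
    using *(2) by simp
  also have "\<dots> = degree ([:- c, 1:] * b)"
    by (simp only: eq)
  also have "\<dots> = 1 + degree b"
    using b by (subst degree_mult_eq) auto
  finally show ?thesis
    using c(1) *(1,3) eq b by (intro bexI[of _ c] bexI[of _ a] exI[of _ b]) auto
qed


section \<open>Partial homomorphisms and the extension theorem of Chevalley\<close>

text \<open>A homomorphism from a subring of one field to another field is represented by its graph.\<close>

definition partial_hom :: "('a::field \<times> 'b::field) set \<Rightarrow> bool" where
  "partial_hom G \<longleftrightarrow> (1, 1) \<in> G \<and>
     (\<forall>a b c d. (a, b) \<in> G \<longrightarrow> (c, d) \<in> G \<longrightarrow> (a - c, b - d) \<in> G \<and> (a * c, b * d) \<in> G) \<and>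
     (\<forall>b. (0, b) \<in> G \<longrightarrow> b = 0)"

definition poly_pair :: "('a::field \<times> 'b::field) set \<Rightarrow> 'a poly \<Rightarrow> 'b poly \<Rightarrow> bool" where
  "poly_pair G p q \<longleftrightarrow> (\<forall>i. (coeff p i, coeff q i) \<in> G)"

context
  fixes G :: "('a::field \<times> 'b::field) set"
  assumes G: "partial_hom G"
begin

lemma partial_hom_1: "(1, 1) \<in> G"
  using G by (simp add: partial_hom_def)

lemma partial_hom_diff: "(a, b) \<in> G \<Longrightarrow> (c, d) \<in> G \<Longrightarrow> (a - c, b - d) \<in> G"
  using G by (simp add: partial_hom_def)

lemma partial_hom_mult: "(a, b) \<in> G \<Longrightarrow> (c, d) \<in> G \<Longrightarrow> (a * c, b * d) \<in> G"
  using G by (simp add: partial_hom_def)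

lemma partial_hom_0: "(0, 0) \<in> G"
  using partial_hom_diff[OF partial_hom_1 partial_hom_1] by simp

lemma partial_hom_uminus: "(a, b) \<in> G \<Longrightarrow> (- a, - b) \<in> G"
  using partial_hom_diff[OF partial_hom_0, of a b] by simp

lemma partial_hom_add: "(a, b) \<in> G \<Longrightarrow> (c, d) \<in> G \<Longrightarrow> (a + c, b + d) \<in> G"
  using partial_hom_diff[OF _ partial_hom_uminus, of a b c d] by simp

lemma partial_hom_power: "(a, b) \<in> G \<Longrightarrow> (a ^ n, b ^ n) \<in> G"
  by (induction n) (auto intro: partial_hom_1 partial_hom_mult)

lemma partial_hom_sum: "(\<And>i. i \<in> I \<Longrightarrow> (f i, g i) \<in> G) \<Longrightarrow> (sum f I, sum g I) \<in> G"
  by (induction I rule: infinite_finite_induct) (auto intro: partial_hom_0 partial_hom_add)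

lemma partial_hom_prod: "(\<And>i. i \<in> I \<Longrightarrow> (f i, g i) \<in> G) \<Longrightarrow> (prod f I, prod g I) \<in> G"
  by (induction I rule: infinite_finite_induct) (auto intro: partial_hom_1 partial_hom_mult)

lemma partial_hom_zero: "(0, b) \<in> G \<Longrightarrow> b = 0"
  using G by (simp add: partial_hom_def)

lemma partial_hom_unique: "(a, b) \<in> G \<Longrightarrow> (a, c) \<in> G \<Longrightarrow> b = c"
  using partial_hom_diff[of a b a c] partial_hom_zero by fastforce

lemmas partial_hom_intros = partial_hom_1 partial_hom_diff partial_hom_mult partial_hom_0
  partial_hom_uminus partial_hom_add partial_hom_power partial_hom_sum partial_hom_prod

lemma is_subring_Domain: "is_subring (Domain G)"
  unfolding is_subring_def using partial_hom_intros by blast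

lemma is_subring_Range: "is_subring (Range G)"
  unfolding is_subring_def using partial_hom_intros by blast

lemma poly_pair_diff: "poly_pair G p q \<Longrightarrow> poly_pair G p' q' \<Longrightarrow> poly_pair G (p - p') (q - q')"
  by (auto simp: poly_pair_def intro: partial_hom_intros)

lemma poly_pair_mult: "poly_pair G p q \<Longrightarrow> poly_pair G p' q' \<Longrightarrow> poly_pair G (p * p') (q * q')"
  by (auto simp: poly_pair_def coeff_mult intro!: partial_hom_intros)

lemma poly_pair_smult: "(a, b) \<in> G \<Longrightarrow> poly_pair G p q \<Longrightarrow> poly_pair G (smult a p) (smult b q)"
  by (auto simp: poly_pair_def intro!: partial_hom_intros)

lemma poly_pair_monom: "(a, b) \<in> G \<Longrightarrow> poly_pair G (monom a n) (monom b n)"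
  by (auto simp: poly_pair_def intro!: partial_hom_intros)

lemma poly_pair_eval:
  assumes "poly_pair G p q" "(x, y) \<in> G"
  shows "(poly p x, poly q y) \<in> G"
proof -
  \<comment> \<open>The degrees may differ, since a leading coefficient of \<open>p\<close> may be
    sent to 0; both sums therefore run to a common bound.\<close>
  define n where "n = max (degree p) (degree q)"
  have "poly p x = (\<Sum>i\<le>n. coeff p i * x ^ i)" "poly q y = (\<Sum>i\<le>n. coeff q i * y ^ i)"
    by (auto intro!: poly_eq_sum_atMost simp: n_def)
  then show ?thesis
    using assms by (auto simp: poly_pair_def intro!: partial_hom_intros)
qed

lemma poly_pair_lift:
  assumes "poly_over (Range G) q"
  shows "\<exists>p. poly_pair G p q"
proof -
  \<comment> \<open>Zero coefficients are lifted to 0, so that the chosen sequence is the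
    coefficient sequence of a polynomial.\<close>
  have "\<forall>i. \<exists>a. (a, coeff q i) \<in> G \<and> (coeff q i = 0 \<longrightarrow> a = 0)"
    using assms partial_hom_0 by (auto simp: poly_over_def) (metis RangeE)
  then obtain f where f: "\<And>i. (f i, coeff q i) \<in> G" "\<And>i. coeff q i = 0 \<Longrightarrow> f i = 0"
    by metis
  then have "coeff (Abs_poly f) = f"
    by (intro coeff_Abs_poly[of "degree q"]) (auto simp: coeff_eq_0)
  then show ?thesis
    using f by (auto simp: poly_pair_def intro!: exI[of _ "Abs_poly f"])
qed

lemma poly_pair_lift':
  assumes "poly_over (Domain G) p"
  shows "\<exists>q. poly_pair G p q"
proof -
  have "\<forall>i. \<exists>b. (coeff p i, b) \<in> G"
    using assms by (auto simp: poly_over_def)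
  then obtain f where f: "\<And>i. (coeff p i, f i) \<in> G"
    by metis
  have f0: "f i = 0" if "i > degree p" for i
    using f[of i] that by (metis coeff_eq_0 partial_hom_zero)
  have "coeff (Abs_poly f) = f"
    by (rule coeff_Abs_poly[of "degree p"]) (rule f0)
  then have "poly_pair G p (Abs_poly f)"
    using f by (simp add: poly_pair_def)
  then show ?thesis ..
qed

text \<open>The assumption is what makes \<open>z \<mapsto> w\<close> well defined on the ring
  generated by \<open>z\<close> over the domain: every relation of \<open>z\<close> must carry over
  to \<open>w\<close>.\<close>

lemma partial_hom_adjoin:
  assumes "\<And>p q. poly_pair G p q \<Longrightarrow> poly p z = 0 \<Longrightarrow> poly q w = 0"
  shows "partial_hom {(poly p z, poly q w) | p q. poly_pair G p q}" (is "partial_hom ?H")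
    and "G \<subseteq> {(poly p z, poly q w) | p q. poly_pair G p q}"
    and "(z, w) \<in> {(poly p z, poly q w) | p q. poly_pair G p q}"
proof -
  show 1: "G \<subseteq> ?H"
  proof (clarify, rule exI, rule exI, intro conjI)
    fix a b assume "(a, b) \<in> G"
    show "(a, b) = (poly [:a:] z, poly [:b:] w)"
      by simp
    show "poly_pair G [:a:] [:b:]"
      using \<open>(a, b) \<in> G\<close> by (auto simp: poly_pair_def coeff_pCons intro: partial_hom_0 split: nat.splits)
  qed
  show "(z, w) \<in> ?H"
  proof (clarify, rule exI, rule exI, intro conjI)
    show "(z, w) = (poly [:0, 1:] z, poly [:0, 1:] w)"
      by simp
    show "poly_pair G [:0, 1:] [:0, 1:]"
      by (auto simp: poly_pair_def coeff_pCons intro: partial_hom_0 partial_hom_1 split: nat.splits)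
  qed
  show "partial_hom ?H"
    unfolding partial_hom_def
  proof (intro conjI allI impI)
    show "(1, 1) \<in> ?H"
      using 1 partial_hom_1 by blast
    fix a b c d assume "(a, b) \<in> ?H" "(c, d) \<in> ?H"
    then obtain p q p' q' where *: "poly_pair G p q" "poly_pair G p' q'"
      "a = poly p z" "b = poly q w" "c = poly p' z" "d = poly q' w"
      by blast
    show "(a - c, b - d) \<in> ?H"
      using poly_pair_diff[OF *(1,2)] * by (intro CollectI exI conjI) auto
    show "(a * c, b * d) \<in> ?H"
      using poly_pair_mult[OF *(1,2)] * by (intro CollectI exI conjI) auto
  qed (use assms in auto)
qed

end

text \<open>Extensions with values in the same codomain compete. When the codomain is algebraically
  closed, the domains of maximal graphs turn out to be valuation rings.\<close>

definition maximal_hom :: "('a::field \<times> 'b::field) set \<Rightarrow> bool" where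
  "maximal_hom G \<longleftrightarrow> partial_hom G \<and> (\<forall>H. partial_hom H \<longrightarrow> G \<subseteq> H \<longrightarrow> H = G)"

lemma maximal_hom_exists:
  assumes "partial_hom G"
  shows "\<exists>M. maximal_hom M \<and> G \<subseteq> M"
proof -
  define S where "S = {H. partial_hom H \<and> G \<subseteq> H}"
  have "\<exists>M\<in>S. \<forall>X\<in>S. M \<subseteq> X \<longrightarrow> X = M"
  proof (rule subset_Zorn_nonempty)
    show "S \<noteq> {}"
      using assms by (auto simp: S_def)
    fix C assume C: "C \<noteq> {}" "subset.chain S C"
    show "\<Union>C \<in> S"
      unfolding S_def partial_hom_def
    proof (intro CollectI conjI allI impI)
      show "(1, 1) \<in> \<Union>C" "G \<subseteq> \<Union>C"
        using C by (fastforce simp: subset.chain_def S_def partial_hom_def)+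
      show "b = 0" if "(0, b) \<in> \<Union>C" for b
        using C that by (auto simp: subset.chain_def S_def partial_hom_def)
      fix a b c d assume "(a, b) \<in> \<Union>C" "(c, d) \<in> \<Union>C"
      then obtain H1 H2 where "H1 \<in> C" "(a, b) \<in> H1" "H2 \<in> C" "(c, d) \<in> H2"
        by blast
      moreover have "H1 \<subseteq> H2 \<or> H2 \<subseteq> H1"
        using C(2) calculation unfolding subset.chain_def by blast
      ultimately obtain H where "H \<in> C" "(a, b) \<in> H" "(c, d) \<in> H"
        by blast
      moreover have "partial_hom H"
        using C(2) \<open>H \<in> C\<close> by (auto simp: subset.chain_def S_def)
      ultimately show "(a - c, b - d) \<in> \<Union>C" "(a * c, b * d) \<in> \<Union>C"
        using partial_hom_diff partial_hom_mult by blast+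
    qed
  qed
  then obtain M where "M \<in> S" and "\<And>X. X \<in> S \<Longrightarrow> M \<subseteq> X \<Longrightarrow> X = M"
    by blast
  then show ?thesis
    unfolding S_def maximal_hom_def by (intro exI[of _ M]) auto
qed

text \<open>A relation for \<open>inverse a\<close> becomes, after multiplication by
  \<open>a ^ n\<close>, a relation for \<open>a\<close> with reversed coefficients, and its image is
  a relation for \<open>b\<close>; so the inverse can be adjoined. In particular the range is a
  field.\<close>

lemma maximal_hom_inverse:
  assumes "maximal_hom G" "(a, b) \<in> G" "b \<noteq> 0"
  shows "(inverse a, inverse b) \<in> G"
proof -
  have G: "partial_hom G"
    using assms by (simp add: maximal_hom_def)
  have a: "a \<noteq> 0"
    using assms partial_hom_zero[OF G] by auto
  have *: "poly q (inverse b) = 0" if pq: "poly_pair G p q" "poly p (inverse a) = 0" for p q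
  proof -
    define n where "n = max (degree p) (degree q)"
    have "a ^ n * poly p (inverse a) = (\<Sum>i\<le>n. coeff p i * a ^ (n - i))"
      using a by (subst poly_eq_sum_atMost[of _ n])
        (auto simp: n_def sum_distrib_left field_simps power_diff intro!: sum.cong)
    moreover have "b ^ n * poly q (inverse b) = (\<Sum>i\<le>n. coeff q i * b ^ (n - i))"
      using assms(3) by (subst poly_eq_sum_atMost[of _ n])
        (auto simp: n_def sum_distrib_left field_simps power_diff intro!: sum.cong)
    moreover have "(\<Sum>i\<le>n. coeff p i * a ^ (n - i), \<Sum>i\<le>n. coeff q i * b ^ (n - i)) \<in> G"
      using pq(1) assms(2) by (auto simp: poly_pair_def intro!: partial_hom_intros[OF G])
    ultimately show ?thesis
      using partial_hom_zero[OF G] pq(2) assms(3) by fastforce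
  qed
  define H where "H = {(poly p (inverse a), poly q (inverse b)) | p q. poly_pair G p q}"
  have H: "partial_hom H" "G \<subseteq> H" "(inverse a, inverse b) \<in> H"
    unfolding H_def by (rule partial_hom_adjoin[OF G *]; assumption)+
  then have "H = G"
    using assms(1) by (simp add: maximal_hom_def)
  then show ?thesis
    using H by simp
qed

text \<open>A common root \<open>w\<close> of the image polynomials of all relations of
  \<open>z\<close> would allow the extension \<open>z \<mapsto> w\<close>. In an algebraically
  closed field the absence of a common root forces a nonzero constant among them. In ideal terms,
  the kernel generates the unit ideal once \<open>z\<close> is adjoined.\<close>

lemma maximal_hom_relation:
  fixes G :: "('a::field \<times> 'b::alg_closed_field) set"
  assumes "maximal_hom G" "z \<notin> Domain G"
  shows "\<exists>p. poly_pair G p 1 \<and> poly p z = 0"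
proof -
  have G: "partial_hom G"
    using assms by (simp add: maximal_hom_def)
  define I where "I = {q. \<exists>p. poly_pair G p q \<and> poly p z = 0}"
  have no_root: "\<exists>q\<in>I. poly q w \<noteq> 0" for w
  proof (rule ccontr)
    assume "\<not> ?thesis"
    then have *: "\<And>p q. poly_pair G p q \<Longrightarrow> poly p z = 0 \<Longrightarrow> poly q w = 0"
      by (auto simp: I_def)
    define H where "H = {(poly p z, poly q w) | p q. poly_pair G p q}"
    have H: "partial_hom H" "G \<subseteq> H" "(z, w) \<in> H"
      unfolding H_def by (rule partial_hom_adjoin[OF G *]; assumption)+
    then have "H = G"
      using assms(1) by (simp add: maximal_hom_def)
    then show False
      using H(3) assms(2) by blast
  qed
  have I_over: "poly_over (Range G) q" if "q \<in> I" for q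
    using that by (auto simp: I_def poly_over_def poly_pair_def)
  obtain q0 where q0: "q0 \<in> I" "q0 \<noteq> 0"
    and min: "\<And>q. q \<in> I \<Longrightarrow> q \<noteq> 0 \<Longrightarrow> degree q0 \<le> degree q"
  proof -
    obtain q where "q \<in> I \<and> q \<noteq> 0"
      using no_root[of 0] by fastforce
    from ex_has_least_nat[of "\<lambda>q. q \<in> I \<and> q \<noteq> 0", OF this, of degree] show ?thesis
      using that by blast
  qed
  have dvd: "q0 dvd q" if q: "q \<in> I" for q
  proof (rule minimal_annihilator_dvd[where I = I and A = "Range G"])
    show "is_subring (Range G)"
      using is_subring_Range[OF G] .
    fix c s p assume *: "c \<in> Range G" "poly_over (Range G) s" "p \<in> I"
    obtain a where a: "(a, c) \<in> G"
      using * by blast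
    obtain s' where s': "poly_pair G s' s"
      using poly_pair_lift[OF G] * by blast
    obtain p' where p': "poly_pair G p' p" "poly p' z = 0"
      using * by (auto simp: I_def)
    obtain q' where q': "poly_pair G q' q0" "poly q' z = 0"
      using q0 by (auto simp: I_def)
    have "poly_pair G (smult a p' - q' * s') (smult c p - q0 * s)"
      by (intro poly_pair_diff poly_pair_smult poly_pair_mult G a s' p' q')
    then show "smult c p - q0 * s \<in> I"
      using p' q' by (auto simp: I_def intro!: exI[of _ "smult a p' - q' * s'"])
  qed (use q q0 I_over min in auto)
  have "degree q0 = 0"
  proof (rule ccontr)
    assume "degree q0 \<noteq> 0"
    then obtain w where "poly q0 w = 0"
      using alg_closed_imp_poly_has_root by blast
    then show False
      using no_root[of w] dvd by (metis dvdE mult_zero_left poly_mult)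
  qed
  then obtain b where b: "q0 = [:b:]" "b \<noteq> 0"
    using q0 by (metis degree_0_id pCons_0_0)
  obtain p where p: "poly_pair G p q0" "poly p z = 0"
    using q0 by (auto simp: I_def)
  have "(coeff p 0, b) \<in> G"
    using p b by (auto simp: poly_pair_def dest: spec[of _ 0])
  then have "poly_pair G (smult (inverse (coeff p 0)) p) (smult (inverse b) q0)"
    using maximal_hom_inverse[OF assms(1)] b(2) p by (intro poly_pair_smult[OF G]) auto
  moreover have "smult (inverse b) q0 = 1"
    using b by simp
  ultimately show ?thesis
    using p by (auto intro!: exI[of _ "smult (inverse (coeff p 0)) p"])
qed

text \<open>The descent in Chevalley's theorem. Multiplied by \<open>z ^ n\<close>, the relation for
  \<open>inverse z\<close> expresses \<open>z ^ n\<close> by lower powers with coefficients in the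
  kernel; substituting this into the leading term of \<open>p\<close> keeps the image equal to 1 and
  lowers the degree.\<close>

lemma maximal_hom_reduce_relation:
  fixes G :: "('a::field \<times> 'b::alg_closed_field) set"
  assumes max: "maximal_hom G" and z: "z \<noteq> 0"
    and p: "poly_pair G p 1" "poly p z = 0"
    and q: "poly_pair G q 1" "poly q (inverse z) = 0" and deg: "degree q \<le> degree p"
  shows "\<exists>r. poly_pair G r 1 \<and> poly r z = 0 \<and> degree r < degree p"
proof -
  have G: "partial_hom G"
    using assms by (simp add: maximal_hom_def)
  define n m where "n = degree p" and "m = degree q"
  have co: "(coeff p i, of_bool (i = 0)) \<in> G" "(coeff q i, of_bool (i = 0)) \<in> G" for i
    using p(1) q(1) by (auto simp: poly_pair_def)
  have q0: "(coeff q 0, 1) \<in> G" and p0: "(coeff p 0, 1) \<in> G"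
    using co[of 0] by auto
  have pi: "(coeff p i, 0) \<in> G" and qi: "(coeff q i, 0) \<in> G" if "i \<noteq> 0" for i
    using co[of i] that by auto
  have q0': "(inverse (coeff q 0), 1) \<in> G"
    using maximal_hom_inverse[OF max q0] by simp
  have q0nz: "coeff q 0 \<noteq> 0" and p0nz: "coeff p 0 \<noteq> 0"
    using q0 p0 partial_hom_zero[OF G] by fastforce+
  have "n > 0"
  proof (rule ccontr)
    assume "\<not> n > 0"
    then have "p = [:coeff p 0:]"
      by (metis degree_0_id n_def not_gr_zero)
    then show False
      using p(2) p0nz by (metis mult_zero_right poly_0 poly_pCons add.right_neutral)
  qed
  \<comment> \<open>The reversal of \<open>q\<close>, shifted to degree \<open>n\<close> and divided
    by its leading coefficient.\<close>
  define s where "s = (\<Sum>j\<le>m. monom (inverse (coeff q 0) * coeff q j) (n - j))"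
  define t where "t = (\<Sum>j\<in>{1..m}. monom (inverse (coeff q 0) * coeff q j) (n - j))"
  have s_eq: "s = monom 1 n + t"
  proof -
    have "{..m} = insert 0 {1..m}"
      by auto
    then show ?thesis
      using q0nz by (simp add: s_def t_def)
  qed
  have mn: "m \<le> n"
    using deg by (simp add: n_def m_def)
  have "poly s z = inverse (coeff q 0) * z ^ n * poly q (inverse z)"
    using z mn unfolding s_def poly_sum poly_eq_sum_atMost[of q m, simplified m_def, OF order.refl]
    by (auto simp: poly_monom m_def sum_distrib_left field_simps power_diff intro!: sum.cong)
  then have s0: "poly s z = 0"
    using q by simp
  have deg_t: "degree t < n"
    unfolding t_def using \<open>n > 0\<close> mn
    by (intro degree_sum_less) (auto intro!: le_less_trans[OF degree_monom_le])
  have t_pair: "poly_pair G t 0"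
  proof -
    have "(coeff t i, 0) \<in> G" for i
      unfolding t_def coeff_sum
      using partial_hom_sum[OF G, of "{1..m}" "\<lambda>j. coeff (monom (inverse (coeff q 0) * coeff q j) (n - j)) i" "\<lambda>_. 0"]
        partial_hom_mult[OF G q0' qi] partial_hom_0[OF G] by auto
    then show ?thesis
      by (simp add: poly_pair_def)
  qed
  define r where "r = p - smult (coeff p n) s"
  have "(coeff r i, coeff 1 i) \<in> G" for i
  proof -
    have "(coeff (smult (coeff p n) s) i, 0) \<in> G"
    proof -
      have "(coeff p n, 0) \<in> G"
        using pi \<open>n > 0\<close> by simp
      moreover have "(coeff s i, coeff (monom 1 n) i) \<in> G"
        using t_pair partial_hom_add[OF G, of "coeff (monom 1 n) i" "coeff (monom 1 n) i" "coeff t i" 0]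
          poly_pair_monom[OF G partial_hom_1[OF G], of n]
        unfolding s_eq poly_pair_def coeff_add by auto
      ultimately show ?thesis
        using partial_hom_mult[OF G] by fastforce
    qed
    then show ?thesis
      using p(1) partial_hom_diff[OF G, of "coeff p i" "coeff 1 i" "coeff (smult (coeff p n) s) i" 0]
      unfolding r_def poly_pair_def coeff_diff by simp
  qed
  moreover have "poly r z = 0"
    using p s0 by (simp add: r_def)
  moreover have "degree r < n"
  proof -
    have "coeff r i = 0" if "i \<ge> n" for i
      using that deg_t by (cases "i = n") (auto simp: r_def s_eq n_def coeff_eq_0)
    then show ?thesis
      using \<open>n > 0\<close> by (metis leading_coeff_0_iff degree_0 not_le)
  qed
  ultimately show ?thesis
    unfolding poly_pair_def n_def by (intro exI[of _ r]) simp
qed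

text \<open>Otherwise both \<open>z\<close> and \<open>inverse z\<close> have relations with image
  1; taken of least degree, the one of larger or equal degree could be shortened by the
  other.\<close>

theorem maximal_hom_valuation:
  fixes G :: "('a::field \<times> 'b::alg_closed_field) set"
  assumes max: "maximal_hom G"
  shows "z \<in> Domain G \<or> inverse z \<in> Domain G"
proof (rule ccontr)
  assume neg: "\<not> ?thesis"
  have G: "partial_hom G"
    using assms by (simp add: maximal_hom_def)
  have z: "z \<noteq> 0"
    using neg partial_hom_0[OF G] by auto
  define R where "R w n \<longleftrightarrow> (\<exists>p. poly_pair G p 1 \<and> poly p w = 0 \<and> degree p = n)" for w n
  define m1 m2 where "m1 = (LEAST n. R z n)" and "m2 = (LEAST n. R (inverse z) n)"
  have ex: "\<exists>n. R z n" "\<exists>n. R (inverse z) n"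
    using maximal_hom_relation[OF max] neg by (auto simp: R_def)
  then have R: "R z m1" "R (inverse z) m2"
    by (auto simp: m1_def m2_def intro: LeastI_ex)
  have least: "\<And>n. R z n \<Longrightarrow> m1 \<le> n" "\<And>n. R (inverse z) n \<Longrightarrow> m2 \<le> n"
    by (auto simp: m1_def m2_def intro: Least_le)
  obtain p where p: "poly_pair G p 1" "poly p z = 0" "degree p = m1"
    using R by (auto simp: R_def)
  obtain q where q: "poly_pair G q 1" "poly q (inverse z) = 0" "degree q = m2"
    using R by (auto simp: R_def)
  show False
  proof (cases "m2 \<le> m1")
    case True
    then obtain r where "poly_pair G r 1" "poly r z = 0" "degree r < m1"
      using maximal_hom_reduce_relation[OF max z p(1,2) q(1,2)] p q by auto
    then show False
      using least(1)[of "degree r"] by (auto simp: R_def)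
  next
    case False
    then obtain r where "poly_pair G r 1" "poly r (inverse z) = 0" "degree r < m2"
      using maximal_hom_reduce_relation[OF max _ q(1,2), of p] z p q by auto
    then show False
      using least(2)[of "degree r"] by (auto simp: R_def)
  qed
qed

lemma maximal_hom_infinite:
  fixes G :: "('a::field \<times> 'b::alg_closed_field) set"
  assumes max: "maximal_hom G" and z: "z \<notin> Domain G"
  shows "(inverse z, 0) \<in> G"
  using maximal_hom_valuation[OF max, of z] maximal_hom_inverse[OF max, of "inverse z"] z by force

text \<open>Integral closedness, with a leading coefficient that need not be 1. If \<open>z\<close>
  were outside the domain, \<open>inverse z\<close> would go to 0, and dividing the equation by
  \<open>z ^ degree p\<close> would send the leading coefficient to 0.\<close>

lemma maximal_hom_integral:
  fixes G :: "('a::field \<times> 'b::alg_closed_field) set"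
  assumes max: "maximal_hom G" and p: "poly_over (Domain G) p" "poly p z = 0"
    and lead: "(lead_coeff p, 0) \<notin> G"
  shows "z \<in> Domain G"
proof (rule ccontr)
  assume z: "z \<notin> Domain G"
  have G: "partial_hom G"
    using assms by (simp add: maximal_hom_def)
  have z0: "z \<noteq> 0"
    using z partial_hom_0[OF G] by auto
  have zi: "(inverse z, 0) \<in> G"
    using maximal_hom_infinite[OF max z] .
  define n where "n = degree p"
  have "0 = inverse z ^ n * poly p z"
    using p by simp
  also have "\<dots> = (\<Sum>i\<le>n. coeff p i * inverse z ^ (n - i))"
    using z0 unfolding poly_altdef n_def by (auto simp: sum_distrib_left field_simps power_diff intro!: sum.cong)
  also have "\<dots> = (\<Sum>i<n. coeff p i * inverse z ^ (n - i)) + lead_coeff p"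
    by (simp add: n_def flip: lessThan_Suc_atMost)
  finally have lead_eq: "lead_coeff p = - (\<Sum>i<n. coeff p i * inverse z ^ (n - i))"
    by (simp add: eq_neg_iff_add_eq_0 add.commute)
  have "(coeff p i * inverse z ^ (n - i), 0) \<in> G" if "i < n" for i
  proof -
    obtain b where "(coeff p i, b) \<in> G"
      using p(1) by (auto simp: poly_over_def)
    then show ?thesis
      using partial_hom_mult[OF G _ partial_hom_power[OF G zi, of "n - i"]] that
      by (fastforce simp: power_0_left)
  qed
  then have "(- (\<Sum>i<n. coeff p i * inverse z ^ (n - i)), - (\<Sum>i<n. 0)) \<in> G"
    by (intro partial_hom_intros G) auto
  then show False
    using lead lead_eq by simp
qed


section \<open>Automorphisms of the ambient field\<close>

text \<open>Automorphisms of the whole ambient field rather than of one extension: the powers of a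
  single \<open>\<sigma>\<close> then act on every level of the tower and on every finite extension
  at once.\<close>

definition field_auto :: "'a::field set \<Rightarrow> ('a \<Rightarrow> 'a) \<Rightarrow> bool" where
  "field_auto L \<sigma> \<longleftrightarrow> bij \<sigma> \<and> (\<forall>x y. \<sigma> (x + y) = \<sigma> x + \<sigma> y \<and> \<sigma> (x * y) = \<sigma> x * \<sigma> y) \<and>
     (\<forall>x\<in>L. \<sigma> x = x)"

context
  fixes L :: "'a::field set" and \<sigma> :: "'a \<Rightarrow> 'a"
  assumes \<sigma>: "field_auto L \<sigma>"
begin

lemma field_auto_add: "\<sigma> (x + y) = \<sigma> x + \<sigma> y"
  using \<sigma> by (simp add: field_auto_def)

lemma field_auto_mult: "\<sigma> (x * y) = \<sigma> x * \<sigma> y"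
  using \<sigma> by (simp add: field_auto_def)

lemma field_auto_fix: "x \<in> L \<Longrightarrow> \<sigma> x = x"
  using \<sigma> by (simp add: field_auto_def)

lemma field_auto_bij: "bij \<sigma>"
  using \<sigma> by (simp add: field_auto_def)

lemma field_auto_eq_iff: "\<sigma> x = \<sigma> y \<longleftrightarrow> x = y"
  using field_auto_bij by (auto simp: bij_def inj_def)

lemma field_auto_0: "\<sigma> 0 = 0"
  using field_auto_add[of 0 0] by (metis add_0 add_left_cancel add.right_neutral)

lemma field_auto_1: "\<sigma> 1 = 1"
proof -
  have "\<sigma> 1 * \<sigma> 1 = \<sigma> 1"
    using field_auto_mult[of 1 1] by simp
  moreover have "\<sigma> 1 \<noteq> 0"
    using field_auto_eq_iff[of 1 0] field_auto_0 by simp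
  ultimately show ?thesis
    by simp
qed

lemma field_auto_uminus: "\<sigma> (- x) = - \<sigma> x"
  using field_auto_add[of x "- x"] field_auto_0 by (simp add: eq_neg_iff_add_eq_0 add.commute)

lemma field_auto_diff: "\<sigma> (x - y) = \<sigma> x - \<sigma> y"
  using field_auto_add[of x "- y"] field_auto_uminus by simp

lemma field_auto_inverse: "\<sigma> (inverse x) = inverse (\<sigma> x)"
proof (cases "x = 0")
  case False
  then have "\<sigma> x * \<sigma> (inverse x) = 1"
    using field_auto_mult[of x "inverse x"] field_auto_1 by simp
  then show ?thesis
    by (metis inverse_unique)
qed (simp add: field_auto_0)

lemma field_auto_power: "\<sigma> (x ^ n) = \<sigma> x ^ n"
  by (induction n) (simp_all add: field_auto_1 field_auto_mult)

lemma field_auto_sum: "\<sigma> (sum f I) = (\<Sum>i\<in>I. \<sigma> (f i))"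
  by (induction I rule: infinite_finite_induct) (simp_all add: field_auto_0 field_auto_add)

lemma field_auto_numeral: "\<sigma> (numeral n) = numeral n"
proof -
  have "\<sigma> (of_nat m) = of_nat m" for m
    by (induction m) (simp_all add: field_auto_0 field_auto_1 field_auto_add)
  from this[of "numeral n"] show ?thesis
    by simp
qed

lemmas field_auto_simps = field_auto_add field_auto_mult field_auto_0 field_auto_1
  field_auto_uminus field_auto_diff field_auto_inverse field_auto_power field_auto_numeral

lemma field_auto_poly: "poly_over L p \<Longrightarrow> \<sigma> (poly p x) = poly p (\<sigma> x)"
  by (simp add: poly_altdef field_auto_sum field_auto_mult field_auto_power poly_over_def field_auto_fix)

lemma field_auto_mono: "M \<subseteq> L \<Longrightarrow> field_auto M \<sigma>"
  using \<sigma> by (auto simp: field_auto_def)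

lemma is_subfield_vimage: "is_subfield M \<Longrightarrow> is_subfield {x. \<sigma> x \<in> M}"
  unfolding is_subfield_def
  by (auto simp: field_auto_1 field_auto_diff field_auto_mult field_auto_inverse)

lemma field_auto_funpow: "field_auto L (\<sigma> ^^ n)"
proof (induction n)
  case (Suc n)
  then show ?case
    using \<sigma> unfolding field_auto_def by (auto simp: bij_comp)
qed (simp add: field_auto_def bij_def)

end

lemma is_subfield_fixed: "field_auto L \<sigma> \<Longrightarrow> is_subfield {x. \<sigma> x = x}"
  unfolding is_subfield_def
  by (auto simp: field_auto_1 field_auto_diff field_auto_mult field_auto_inverse)

text \<open>Every element is a root of a nonzero polynomial over \<open>L\<close>, and an injection
  maps the finite set of roots onto itself.\<close>

lemma root_preserving_injection_surj:
  fixes \<sigma> :: "'a::field \<Rightarrow> 'a"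
  assumes "\<And>z. algebraic_over L z" "inj \<sigma>"
    and "\<And>p x. poly_over L p \<Longrightarrow> poly p x = 0 \<Longrightarrow> poly p (\<sigma> x) = 0"
  shows "surj \<sigma>"
proof -
  have "\<exists>x. \<sigma> x = w" for w
  proof -
    obtain p where p: "p \<noteq> 0" "poly_over L p" "poly p w = 0"
      using assms(1)[of w] by (auto simp: algebraic_over_def)
    let ?R = "{x. poly p x = 0}"
    have "finite ?R"
      using p by (simp add: poly_roots_finite)
    moreover have "\<sigma> ` ?R \<subseteq> ?R"
      using assms(3) p by auto
    ultimately have "\<sigma> ` ?R = ?R"
      using assms(2) by (intro endo_inj_surj) (auto intro: inj_on_subset)
    then show ?thesis
      using p(3) by (metis (mono_tags, lifting) image_iff mem_Collect_eq)
  qed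
  then show ?thesis
    by (metis surjI)
qed

text \<open>Extend \<open>x \<mapsto> y\<close> to a maximal homomorphism into the same field. Its
  domain is everything, because every element is algebraic over the field \<open>L\<close> and the
  domain is integrally closed.\<close>

lemma field_auto_extend:
  fixes L :: "'a::alg_closed_field set"
  assumes L: "is_subfield L" and alg: "\<And>z. algebraic_over L z"
    and xy: "\<And>p. poly_over L p \<Longrightarrow> poly p x = 0 \<Longrightarrow> poly p y = 0"
  shows "\<exists>\<sigma>. field_auto L \<sigma> \<and> \<sigma> x = y"
proof -
  have R: "is_subring L"
    using L by (rule is_subfield_imp_subring)
  define G where "G = {(a, a) | a. a \<in> L}"
  have "partial_hom G"
    using R by (auto simp: partial_hom_def G_def is_subring_def)
  moreover have eq: "p = q \<and> poly_over L p" if "poly_pair G p q" for p q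
    using that by (auto simp: poly_pair_def G_def poly_over_def poly_eq_iff)
  ultimately have *: "\<And>p q. poly_pair G p q \<Longrightarrow> poly p x = 0 \<Longrightarrow> poly q y = 0"
    using xy by blast
  define H where "H = {(poly p x, poly q y) | p q. poly_pair G p q}"
  have H: "partial_hom H" "G \<subseteq> H" "(x, y) \<in> H"
    unfolding H_def by (rule partial_hom_adjoin[OF \<open>partial_hom G\<close> *]; assumption)+
  obtain M where M: "maximal_hom M" "H \<subseteq> M"
    using maximal_hom_exists[OF H(1)] by blast
  have MP: "partial_hom M"
    using M by (simp add: maximal_hom_def)
  have LM: "(a, a) \<in> M" if "a \<in> L" for a
    using H M that by (auto simp: G_def)
  have "z \<in> Domain M" for z
  proof -
    obtain p where p: "p \<noteq> 0" "poly_over L p" "poly p z = 0"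
      using alg[of z] by (auto simp: algebraic_over_def)
    show ?thesis
    proof (rule maximal_hom_integral[OF M(1)])
      show "poly_over (Domain M) p"
        using p LM by (auto simp: poly_over_def)
      show "(lead_coeff p, 0) \<notin> M"
      proof
        assume "(lead_coeff p, 0) \<in> M"
        moreover have "(lead_coeff p, lead_coeff p) \<in> M"
          using p by (intro LM) (simp add: poly_over_def)
        ultimately have "lead_coeff p = 0"
          by (rule partial_hom_unique[OF MP, rotated])
        then show False
          using p by simp
      qed
    qed (use p in auto)
  qed
  then have "\<forall>z. \<exists>w. (z, w) \<in> M"
    by (simp add: Domain_iff)
  then obtain \<sigma> where \<sigma>: "\<And>z. (z, \<sigma> z) \<in> M"
    by metis
  have uniq: "\<sigma> z = w" if "(z, w) \<in> M" for z w
    using partial_hom_unique[OF MP] \<sigma> that by blast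
  have fix_L: "\<sigma> a = a" if "a \<in> L" for a
    using uniq LM that by blast
  have add: "\<sigma> (a + b) = \<sigma> a + \<sigma> b" and diff: "\<sigma> (a - b) = \<sigma> a - \<sigma> b" 
    and mult: "\<sigma> (a * b) = \<sigma> a * \<sigma> b" for a b
    by (intro uniq partial_hom_intros[OF MP] \<sigma>)+
  have one: "\<sigma> 1 = 1" "\<sigma> 0 = 0"
    by (intro uniq partial_hom_intros[OF MP])+
  have "inj \<sigma>"
  proof (rule injI)
    fix a b assume "\<sigma> a = \<sigma> b"
    then have "\<sigma> (a - b) = 0"
      by (simp add: diff)
    then show "a = b"
      using mult[of "a - b" "inverse (a - b)"] one by (cases "a = b") auto
  qed
  moreover have "poly p (\<sigma> u) = 0" if p: "poly_over L p" "poly p u = 0" for p u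
  proof -
    have "poly_pair M p p"
      using p LM by (auto simp: poly_pair_def poly_over_def)
    then have "(poly p u, poly p (\<sigma> u)) \<in> M"
      using \<sigma> poly_pair_eval[OF MP] by blast
    then show ?thesis
      using p partial_hom_zero[OF MP] by simp
  qed
  ultimately have "bij \<sigma>"
    using root_preserving_injection_surj[OF alg] by (simp add: bij_def)
  moreover have "\<sigma> x = y"
    using uniq H M by blast
  ultimately show ?thesis
    using add mult fix_L by (auto simp: field_auto_def)
qed

section \<open>Minimal polynomials and conjugate elements\<close>

lemma min_poly_dvd:
  assumes "is_subring L" "is_min_poly L x p" "poly_over L q" "poly q x = 0"
  shows "p dvd (q :: 'a::field poly)"
  using assms
  by (intro minimal_annihilator_dvd[where I = "{q. poly q x = 0}" and A = L])
     (auto simp: is_min_poly_def)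

lemma min_poly_conjugate:
  fixes L :: "'a::alg_closed_field set"
  assumes "is_subfield L" "\<And>z. algebraic_over L z" "is_min_poly L x p" "poly p y = 0"
  shows "\<exists>\<sigma>. field_auto L \<sigma> \<and> \<sigma> x = y"
  using field_auto_extend[OF assms(1,2)] min_poly_dvd[OF is_subfield_imp_subring[OF assms(1)] assms(3)]
    assms(4) by (metis dvdE mult_zero_left poly_mult)


section \<open>Finite-dimensional extensions\<close>

text \<open>Gaussian elimination inside the subfield \<open>K\<close>: equation \<open>m\<close> is
  solved for the unknown at an index \<open>i0\<close> with \<open>a i0 m \<noteq> 0\<close>, and
  the result is substituted into the other equations.\<close>

lemma homogeneous_system_solution:
  fixes a :: "'i \<Rightarrow> nat \<Rightarrow> 'a::field"
  assumes K: "is_subfield K" and "finite I" "card I = Suc m"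
    and "\<And>i j. i \<in> I \<Longrightarrow> a i j \<in> K"
  shows "\<exists>c. (\<forall>i\<in>I. c i \<in> K) \<and> (\<exists>i\<in>I. c i \<noteq> 0) \<and> (\<forall>j<m. (\<Sum>i\<in>I. c i * a i j) = 0)"
  using assms(2-)
proof (induction m arbitrary: I a)
  case 0
  then obtain i where "I = {i}"
    by (metis One_nat_def card_1_singletonE)
  then show ?case
    using subfield_intros(2)[OF K] by (intro exI[of _ "\<lambda>_. 1"]) auto
next
  case (Suc m)
  show ?case
  proof (cases "\<forall>i\<in>I. a i m = 0")
    case True
    obtain i0 where i0: "i0 \<in> I"
      using Suc.prems(2) by fastforce
    have "\<exists>c. (\<forall>i\<in>I-{i0}. c i \<in> K) \<and> (\<exists>i\<in>I-{i0}. c i \<noteq> 0) \<and> (\<forall>j<m. (\<Sum>i\<in>I-{i0}. c i * a i j) = 0)"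
      by (rule Suc.IH) (use Suc.prems i0 in auto)
    then obtain c where c: "\<forall>i\<in>I-{i0}. c i \<in> K" "\<exists>i\<in>I-{i0}. c i \<noteq> 0"
      "\<forall>j<m. (\<Sum>i\<in>I-{i0}. c i * a i j) = 0"
      by blast
    define c' where "c' = c(i0 := 0)"
    have "(\<Sum>i\<in>I. c' i * a i j) = (\<Sum>i\<in>I-{i0}. c i * a i j)" for j
      using Suc.prems(1) i0 by (subst sum.remove[of I i0]) (auto simp: c'_def intro!: sum.cong)
    then show ?thesis
      using c True subfield_intros(1)[OF K]
      by (intro exI[of _ c']) (auto simp: c'_def less_Suc_eq)
  next
    case False
    then obtain i0 where i0: "i0 \<in> I" "a i0 m \<noteq> 0"
      by blast
    define b where "b i j = a i j - a i m / a i0 m * a i0 j" for i j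
    have "\<exists>c. (\<forall>i\<in>I-{i0}. c i \<in> K) \<and> (\<exists>i\<in>I-{i0}. c i \<noteq> 0) \<and> (\<forall>j<m. (\<Sum>i\<in>I-{i0}. c i * b i j) = 0)"
      by (rule Suc.IH) (use Suc.prems i0 in \<open>auto simp: b_def intro!: subfield_intros[OF K]\<close>)
    then obtain c where c: "\<forall>i\<in>I-{i0}. c i \<in> K" "\<exists>i\<in>I-{i0}. c i \<noteq> 0"
      "\<forall>j<m. (\<Sum>i\<in>I-{i0}. c i * b i j) = 0"
      by blast
    define d where "d = - (\<Sum>i\<in>I-{i0}. c i * (a i m / a i0 m))"
    define c' where "c' = c(i0 := d)"
    have *: "(\<Sum>i\<in>I. c' i * a i j) = (\<Sum>i\<in>I-{i0}. c i * b i j)" for j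
    proof -
      have "(\<Sum>i\<in>I. c' i * a i j) = d * a i0 j + (\<Sum>i\<in>I-{i0}. c i * a i j)"
        using Suc.prems(1) i0 by (subst sum.remove[of I i0]) (auto simp: c'_def intro!: sum.cong)
      also have "\<dots> = (\<Sum>i\<in>I-{i0}. c i * b i j)"
        by (simp add: d_def b_def sum_distrib_right sum_distrib_left algebra_simps sum_subtractf
            sum_negf)
      finally show ?thesis .
    qed
    have "b i m = 0" for i
      using i0 by (simp add: b_def)
    then have "\<forall>j<Suc m. (\<Sum>i\<in>I. c' i * a i j) = 0"
      using c(3) unfolding * by (auto simp: less_Suc_eq)
    moreover have "d \<in> K"
      unfolding d_def using c Suc.prems i0 by (intro subfield_intros[OF K]) auto
    ultimately show ?thesis
      using c by (intro exI[of _ c']) (auto simp: c'_def)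
  qed
qed

definition span_over :: "'a::field set \<Rightarrow> 'a set \<Rightarrow> 'a set" where
  "span_over K S = {\<Sum>s\<in>S. c s * s | c. \<forall>s\<in>S. c s \<in> K}"

text \<open>The vectors form an indexed family, so repetitions count. Applied to the powers of an
  element this yields a polynomial relation even when some powers coincide.\<close>

lemma span_over_dependent:
  fixes v :: "'i \<Rightarrow> 'a::field"
  assumes K: "is_subfield K" and S: "finite S" and I: "finite I" "card I > card S"
    and v: "\<And>i. i \<in> I \<Longrightarrow> v i \<in> span_over K S"
  shows "\<exists>c. (\<forall>i\<in>I. c i \<in> K) \<and> (\<exists>i\<in>I. c i \<noteq> 0) \<and> (\<Sum>i\<in>I. c i * v i) = 0"
proof -
  obtain J where J: "J \<subseteq> I" "card J = Suc (card S)" "finite J"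
    using I by (metis Suc_leI obtain_subset_with_card_n)
  have "\<forall>i\<in>J. \<exists>c. (\<forall>s\<in>S. c s \<in> K) \<and> v i = (\<Sum>s\<in>S. c s * s)"
    using v J by (fastforce simp: span_over_def)
  then obtain b where b: "\<And>i s. i \<in> J \<Longrightarrow> s \<in> S \<Longrightarrow> b i s \<in> K"
    "\<And>i. i \<in> J \<Longrightarrow> v i = (\<Sum>s\<in>S. b i s * s)"
    by metis
  obtain f where f: "bij_betw f {..<card S} S"
    using S by (metis ex_bij_betw_nat_finite lessThan_atLeast0)
  define a where "a i j = (if j < card S then b i (f j) else 0)" for i j
  have "a i j \<in> K" if "i \<in> J" for i j
    using b(1) that f subfield_intros(1)[OF K] by (auto simp: a_def bij_betw_def)
  then obtain c where c: "\<forall>i\<in>J. c i \<in> K" "\<exists>i\<in>J. c i \<noteq> 0"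
    "\<forall>j<card S. (\<Sum>i\<in>J. c i * a i j) = 0"
    using homogeneous_system_solution[OF K J(3,2), of a] by blast
  have S0: "(\<Sum>i\<in>J. c i * b i s) = 0" if "s \<in> S" for s
  proof -
    have "s \<in> f ` {..<card S}"
      using f that by (simp add: bij_betw_def)
    then obtain j where "j < card S" "s = f j"
      by auto
    then show ?thesis
      using c(3) by (auto simp: a_def)
  qed
  have "(\<Sum>i\<in>J. c i * v i) = (\<Sum>i\<in>J. \<Sum>s\<in>S. c i * b i s * s)"
    by (intro sum.cong) (auto simp: b sum_distrib_left mult.assoc)
  also have "\<dots> = (\<Sum>s\<in>S. (\<Sum>i\<in>J. c i * b i s) * s)"
    by (subst sum.swap) (simp add: sum_distrib_right)
  also have "\<dots> = 0"
    by (intro sum.neutral) (simp add: S0)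
  finally have 0: "(\<Sum>i\<in>J. c i * v i) = 0" .
  define c' where "c' i = (if i \<in> J then c i else 0)" for i
  have "(\<Sum>i\<in>I. c' i * v i) = (\<Sum>i\<in>J. c i * v i)"
    using J I by (intro sum.mono_neutral_cong_right) (auto simp: c'_def)
  then show ?thesis
    using 0 c J subfield_intros(1)[OF K] by (intro exI[of _ c']) (auto simp: c'_def)
qed

text \<open>The powers of \<open>x\<close> are dependent; cancelling the lowest power that occurs
  shows that \<open>x\<close> divides a nonzero element of \<open>K\<close> inside
  \<open>A\<close>.\<close>

lemma subring_in_span_imp_subfield:
  assumes K: "is_subfield K" and A: "is_subring A" "K \<subseteq> A" and S: "finite S" "A \<subseteq> span_over K S"
  shows "is_subfield (A :: 'a::field set)"
proof -
  have "inverse x \<in> A" if x: "x \<in> A" "x \<noteq> 0" for x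
  proof -
    have "\<exists>c. (\<forall>i\<in>{..card S}. c i \<in> K) \<and> (\<exists>i\<in>{..card S}. c i \<noteq> 0) \<and> (\<Sum>i\<in>{..card S}. c i * x ^ i) = 0"
      using S x(1) by (intro span_over_dependent[OF K]) (auto intro: subring_power[OF A(1)])
    then obtain c where c: "\<And>i. i \<le> card S \<Longrightarrow> c i \<in> K" "\<exists>i\<le>card S. c i \<noteq> 0"
      "(\<Sum>i\<le>card S. c i * x ^ i) = 0"
      by auto
    define j where "j = (LEAST i. i \<le> card S \<and> c i \<noteq> 0)"
    have j: "j \<le> card S" "c j \<noteq> 0"
      using LeastI_ex[OF c(2)] unfolding j_def by auto
    have j0: "c i = 0" if "i < j" for i
      using not_less_Least[of i "\<lambda>i. i \<le> card S \<and> c i \<noteq> 0"] that j(1) unfolding j_def[symmetric] by auto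
    have "0 = (\<Sum>i\<in>{j..card S}. c i * x ^ i)"
      unfolding c(3)[symmetric] using j0 by (intro sum.mono_neutral_right) auto
    also have "\<dots> = x ^ j * (\<Sum>i\<in>{j..card S}. c i * x ^ (i - j))"
      by (auto simp: sum_distrib_left mult_ac simp flip: power_add intro!: sum.cong)
    finally have "0 = (\<Sum>i\<in>{j..card S}. c i * x ^ (i - j))"
      using x by simp
    also have "{j..card S} = insert j {j<..card S}"
      using j by auto
    also have "(\<Sum>i\<in>\<dots>. c i * x ^ (i - j)) = c j + (\<Sum>i\<in>{j<..card S}. c i * x ^ (i - j))"
      by simp
    also have "(\<Sum>i\<in>{j<..card S}. c i * x ^ (i - j)) = x * (\<Sum>i\<in>{j<..card S}. c i * x ^ (i - j - 1))"
      unfolding sum_distrib_left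
    proof (intro sum.cong refl)
      fix i assume "i \<in> {j<..card S}"
      then have "i - j = Suc (i - j - 1)"
        by auto
      then show "c i * x ^ (i - j) = x * (c i * x ^ (i - j - 1))"
        by (metis mult.left_commute power_Suc)
    qed
    finally have "x * (- inverse (c j) * (\<Sum>i\<in>{j<..card S}. c i * x ^ (i - j - 1))) = 1"
      using j(2) by (simp add: field_simps) (metis add.commute minus_unique)
    then have "inverse x = - inverse (c j) * (\<Sum>i\<in>{j<..card S}. c i * x ^ (i - j - 1))"
      by (metis inverse_unique)
    moreover have "inverse (c j) \<in> A"
      using A(2) c(1) j(1) subfield_inverse[OF K] by blast
    ultimately show ?thesis
      using x(1) A(2) c(1) by (auto intro!: subring_intros[OF A(1)])
  qed
  then show ?thesis
    using A(1) subring_0[OF A(1)] unfolding is_subfield_iff by (metis inverse_zero)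
qed

lemma algebraic_over_span_power:
  assumes K: "is_subfield K" and x: "algebraic_over K x"
  shows "\<exists>d. \<forall>p. poly_over K p \<longrightarrow> poly p x \<in> span_over K ((\<lambda>i. x ^ i) ` {..<d::nat})"
proof -
  obtain q where q: "q \<noteq> 0" "poly_over K q" "poly q x = 0"
    using x by (auto simp: algebraic_over_def)
  have "poly p x \<in> span_over K ((\<lambda>i. x ^ i) ` {..<degree q})" if p: "poly_over K p" for p
  proof -
    obtain c s t where *: "c \<in> K" "c \<noteq> 0" "poly_over K t"
      "smult c p = q * s + t" "t = 0 \<or> degree t < degree q"
      using pseudo_division[OF is_subfield_imp_subring[OF K] q(1,2) p] by blast
    have "c * poly p x = poly t x"
      using arg_cong[OF *(4), of "\<lambda>p. poly p x"] q by simp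
    then have px: "poly p x = inverse c * poly t x"
      using * by (simp add: field_simps)
    define n where "n = degree q"
    have tx: "poly t x = (\<Sum>i<n. coeff t i * x ^ i)"
    proof (cases "t = 0")
      case False
      then show ?thesis
        unfolding poly_altdef using *(5)
        by (intro sum.mono_neutral_left) (auto simp: n_def coeff_eq_0)
    qed simp
    \<comment> \<open>Different exponents may give the same power of \<open>x\<close>, which the
      spanning set contains only once; \<open>b\<close> adds up the coefficients of equal
      powers.\<close>
    define b where "b s = (\<Sum>i\<in>{i\<in>{..<n}. x ^ i = s}. inverse c * coeff t i)" for s
    have "poly p x = (\<Sum>i<n. inverse c * coeff t i * x ^ i)"
      by (simp add: px tx sum_distrib_left mult.assoc)
    also have "\<dots> = (\<Sum>s\<in>(\<lambda>i. x ^ i) ` {..<n}. \<Sum>i\<in>{i\<in>{..<n}. x ^ i = s}. inverse c * coeff t i * x ^ i)"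
      by (rule sum.image_gen) simp
    also have "\<dots> = (\<Sum>s\<in>(\<lambda>i. x ^ i) ` {..<n}. b s * s)"
      by (auto simp: b_def sum_distrib_right intro!: sum.cong)
    finally show ?thesis
      unfolding span_over_def n_def[symmetric] using *(1,3)
      by (auto simp: b_def poly_over_def intro!: exI[of _ b] subfield_intros[OF K])
  qed
  then show ?thesis
    by blast
qed

lemma span_over_add:
  assumes "is_subfield K" "a \<in> span_over K S" "b \<in> span_over K S"
  shows "a + b \<in> span_over K (S :: 'a::field set)"
proof -
  obtain c d where "\<forall>s\<in>S. c s \<in> K" "\<forall>s\<in>S. d s \<in> K" "a = (\<Sum>s\<in>S. c s * s)" "b = (\<Sum>s\<in>S. d s * s)"
    using assms by (auto simp: span_over_def)
  then show ?thesis
    unfolding span_over_def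
    by (intro CollectI exI[of _ "\<lambda>s. c s + d s"])
       (auto simp: algebra_simps sum.distrib intro!: subfield_intros[OF assms(1)])
qed

lemma span_over_sum:
  assumes K: "is_subfield K" and "\<And>i. i \<in> I \<Longrightarrow> f i \<in> span_over K S"
  shows "sum f I \<in> span_over K (S :: 'a::field set)"
proof -
  have "0 \<in> span_over K S"
    unfolding span_over_def using subfield_intros(1)[OF K] by (auto intro!: exI[of _ "\<lambda>_. 0"])
  then show ?thesis
    using assms(2) by (induction I rule: infinite_finite_induct) (auto intro: span_over_add[OF K])
qed

lemma span_over_mult:
  assumes K: "is_subfield K" and fin: "finite S" "finite T"
    and ab: "a \<in> span_over K S" "b \<in> span_over K T"
  shows "a * b \<in> span_over K ((\<lambda>(s, t). s * t) ` (S \<times> T) :: 'a::field set)"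
proof -
  obtain c d where cd: "\<forall>s\<in>S. c s \<in> K" "\<forall>s\<in>T. d s \<in> K" "a = (\<Sum>s\<in>S. c s * s)" "b = (\<Sum>s\<in>T. d s * s)"
    using ab by (auto simp: span_over_def)
  have single: "k * s \<in> span_over K U" if "k \<in> K" "s \<in> U" "finite U" for k s U
    unfolding span_over_def using that subfield_intros(1)[OF K]
    by (intro CollectI exI[of _ "\<lambda>t. if t = s then k else 0"]) (auto simp: if_distrib[of "\<lambda>x. x * _"] cong: if_cong)
  have "c s * d t * (s * t) \<in> span_over K ((\<lambda>(s, t). s * t) ` (S \<times> T))" if "s \<in> S" "t \<in> T" for s t
    using cd that fin by (intro single) (auto intro!: subfield_intros[OF K])
  moreover have "a * b = (\<Sum>s\<in>S. \<Sum>t\<in>T. c s * d t * (s * t))"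
    by (simp add: cd sum_product mult_ac)
  ultimately have "a * b \<in> span_over K ((\<lambda>(s, t). s * t) ` (S \<times> T))"
    by (simp add: span_over_sum[OF K])
  then show ?thesis .
qed

text \<open>The spanning set may lie outside \<open>M\<close>, so the property passes to subsets
  without a change of basis.\<close>

definition finite_dim :: "'a::field set \<Rightarrow> 'a set \<Rightarrow> bool" where
  "finite_dim K M \<longleftrightarrow> (\<exists>S. finite S \<and> M \<subseteq> span_over K S)"

text \<open>Products of a spanning set of \<open>M\<close> with finitely many powers of
  \<open>x\<close> span \<open>adjoin_ring M x\<close>, which is then already a field.\<close>

lemma finite_dim_adjoin_one:
  assumes K: "is_subfield K" and M: "is_subfield M" "K \<subseteq> M" "finite_dim K M"
    and x: "algebraic_over K x"
  shows "\<exists>N. is_subfield N \<and> insert x M \<subseteq> N \<and> finite_dim K N"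
proof -
  have MR: "is_subring M"
    using M by (intro is_subfield_imp_subring)
  obtain S where S: "finite S" "M \<subseteq> span_over K S"
    using M by (auto simp: finite_dim_def)
  obtain d :: nat where d: "\<And>p. poly_over K p \<Longrightarrow> poly p x \<in> span_over K ((\<lambda>i. x ^ i) ` {..<d})"
    using algebraic_over_span_power[OF K x] by blast
  define N where "N = adjoin_ring M x"
  have N: "is_subring N" and "x \<in> N" "M \<subseteq> N"
    using adjoin_ring_is_subring[OF MR] adjoin_ring_superset[OF MR, of x] by (auto simp: N_def)
  define T where "T = (\<lambda>(s, t). s * t) ` (S \<times> (\<lambda>i. x ^ i) ` {..<d})"
  have "N \<subseteq> span_over K T"
  proof
    fix a assume "a \<in> N"
    then obtain p where p: "poly_over M p" "a = poly p x"
      by (auto simp: N_def adjoin_ring_def)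
    have "poly p x = (\<Sum>i\<le>degree p. coeff p i * x ^ i)"
      by (simp add: poly_altdef)
    also have "\<dots> \<in> span_over K T"
    proof (intro span_over_sum K)
      fix i
      have "poly (monom 1 i) x \<in> span_over K ((\<lambda>i. x ^ i) ` {..<d})"
        using subring_1 subfield_intros(2)[OF K] is_subfield_imp_subring[OF K]
        by (intro d poly_over_monom) auto
      then show "coeff p i * x ^ i \<in> span_over K T"
        unfolding T_def using p S by (intro span_over_mult K) (auto simp: poly_over_def poly_monom)
    qed
    finally show "a \<in> span_over K T"
      using p by simp
  qed
  moreover have "finite T"
    using S by (simp add: T_def)
  ultimately have "is_subfield N" "finite_dim K N"
    using subring_in_span_imp_subfield[OF K N] \<open>M \<subseteq> N\<close> M(2) by (auto simp: finite_dim_def)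
  then show ?thesis
    using \<open>x \<in> N\<close> \<open>M \<subseteq> N\<close> by blast
qed

lemma finite_dim_adjoin:
  assumes K: "is_subfield K" and X: "finite X" "\<And>x. x \<in> X \<Longrightarrow> algebraic_over K x"
  shows "\<exists>N. is_subfield N \<and> K \<union> X \<subseteq> N \<and> finite_dim K N"
  using X
proof (induction X rule: finite_induct)
  case empty
  have "K \<subseteq> span_over K {1}"
    unfolding span_over_def by auto
  then show ?case
    using K unfolding finite_dim_def by (intro exI[of _ K]) (auto intro!: exI[of _ "{1}"])
next
  case (insert x X)
  then obtain N where N: "is_subfield N" "K \<union> X \<subseteq> N" "finite_dim K N"
    by auto
  then show ?case
    using finite_dim_adjoin_one[OF K N(1) _ N(3), of x] insert.prems by (auto 4 4)
qed


section \<open>Valuation rings\<close>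

context
  fixes F V :: "'a::field set"
  assumes F: "is_subfield F" and V: "valuation_ring F V"
begin

lemma valuation_ring_subset: "V \<subseteq> F"
  using V by (simp add: valuation_ring_def)

lemma valuation_ring_is_subring: "is_subring V"
  using V by (simp add: valuation_ring_def is_subring_def)

lemma valuation_ring_cases: "x \<in> F \<Longrightarrow> x \<in> V \<or> inverse x \<in> V"
  using V by (simp add: valuation_ring_def)

lemma maximal_ideal_subset: "maximal_ideal_of V \<subseteq> V"
  by (auto simp: maximal_ideal_of_def)

lemma maximal_ideal_0: "0 \<in> maximal_ideal_of V"
  using subring_0[OF valuation_ring_is_subring] by (auto simp: maximal_ideal_of_def)

lemma maximal_ideal_1: "1 \<notin> maximal_ideal_of V"
  using subring_1[OF valuation_ring_is_subring] by (auto simp: maximal_ideal_of_def)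

lemma valuation_ring_unit: "x \<in> V \<Longrightarrow> x \<notin> maximal_ideal_of V \<Longrightarrow> inverse x \<in> V"
  by (auto simp: maximal_ideal_of_def)

lemma inverse_in_maximal_ideal: "x \<in> F \<Longrightarrow> x \<notin> V \<Longrightarrow> inverse x \<in> maximal_ideal_of V"
  using valuation_ring_cases[of x] by (auto simp: maximal_ideal_of_def)

lemma maximal_ideal_mult:
  assumes "x \<in> maximal_ideal_of V" "y \<in> V"
  shows "x * y \<in> maximal_ideal_of V"
proof -
  have "inverse x \<in> V" if "inverse (x * y) \<in> V" "x * y \<noteq> 0"
  proof -
    have "inverse x = y * inverse (x * y)"
      using that(2) by (simp add: field_simps)
    then show ?thesis
      using that assms subring_mult[OF valuation_ring_is_subring] by metis
  qed
  then show ?thesis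
    using assms subring_mult[OF valuation_ring_is_subring, of x y] by (auto simp: maximal_ideal_of_def)
qed

lemma maximal_ideal_diff:
  assumes xy: "x \<in> maximal_ideal_of V" "y \<in> maximal_ideal_of V"
  shows "x - y \<in> maximal_ideal_of V"
proof -
  have *: "b * (a / b - 1) \<in> maximal_ideal_of V"
    if "b \<in> maximal_ideal_of V" "a / b \<in> V" for a b
    using that subring_diff[OF valuation_ring_is_subring that(2) subring_1[OF valuation_ring_is_subring]]
    by (intro maximal_ideal_mult)
  have neg: "- a \<in> maximal_ideal_of V" if "a \<in> maximal_ideal_of V" for a
    using maximal_ideal_mult[OF that, of "-1"] subring_uminus[OF valuation_ring_is_subring
        subring_1[OF valuation_ring_is_subring]] by simp
  show ?thesis
  proof (cases "x = 0 \<or> y = 0")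
    case True
    then show ?thesis
      using neg xy by auto
  next
    case False
    have "x / y \<in> F"
      using xy maximal_ideal_subset valuation_ring_subset by (intro subfield_intros[OF F]) auto
    then consider "x / y \<in> V" | "y / x \<in> V"
      using valuation_ring_cases[of "x / y"] by auto
    then show ?thesis
    proof cases
      case 1
      then show ?thesis
        using *[OF xy(2) 1] False by (simp add: field_simps)
    next
      case 2
      then show ?thesis
        using neg[OF *[OF xy(1) 2]] False by (simp add: field_simps)
    qed
  qed
qed

lemma maximal_ideal_uminus: "x \<in> maximal_ideal_of V \<Longrightarrow> - x \<in> maximal_ideal_of V"
  using maximal_ideal_diff[OF maximal_ideal_0] by fastforce

lemma maximal_ideal_add: "x \<in> maximal_ideal_of V \<Longrightarrow> y \<in> maximal_ideal_of V \<Longrightarrow> x + y \<in> maximal_ideal_of V"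
  using maximal_ideal_diff[of x "- y"] maximal_ideal_uminus by simp

lemma maximal_ideal_sum: "(\<And>i. i \<in> I \<Longrightarrow> f i \<in> maximal_ideal_of V) \<Longrightarrow> sum f I \<in> maximal_ideal_of V"
  by (induction I rule: infinite_finite_induct) (auto intro: maximal_ideal_0 maximal_ideal_add)

lemma maximal_ideal_prime:
  assumes "x * y \<in> maximal_ideal_of V" "x \<in> V" "y \<in> V"
  shows "x \<in> maximal_ideal_of V \<or> y \<in> maximal_ideal_of V"
proof (rule ccontr)
  assume *: "\<not> ?thesis"
  then have "inverse x * inverse y \<in> V"
    using assms valuation_ring_unit subring_mult[OF valuation_ring_is_subring] by blast
  moreover have "x \<noteq> 0" "y \<noteq> 0"
    using * maximal_ideal_0 by auto
  ultimately show False
    using assms(1) by (simp add: maximal_ideal_of_def mult.commute)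
qed

text \<open>Integral closedness for the equation of the quadratic steps. Were \<open>a\<close>
  outside \<open>V\<close>, dividing by its square would put 1 into the maximal ideal.\<close>

lemma valuation_ring_integral:
  assumes "a \<in> F" "a * (a - 1) \<in> V"
  shows "a \<in> V"
proof (rule ccontr)
  assume a: "a \<notin> V"
  then have b: "inverse a \<in> maximal_ideal_of V"
    using assms inverse_in_maximal_ideal by blast
  have "a \<noteq> 0"
    using a subring_0[OF valuation_ring_is_subring] by auto
  then have "1 = inverse a * (inverse a * (a * (a - 1))) + inverse a"
    by (simp add: field_simps)
  moreover have "inverse a * (a * (a - 1)) \<in> V"
    using b assms(2) maximal_ideal_subset subring_mult[OF valuation_ring_is_subring] by blast
  then have "inverse a * (inverse a * (a * (a - 1))) + inverse a \<in> maximal_ideal_of V"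
    using b maximal_ideal_add maximal_ideal_mult by blast
  ultimately show False
    using maximal_ideal_1 by simp
qed

text \<open>Since \<open>(2 * a - 1)\<^sup>2 - 4 * a * (a - 1) = 1\<close>, the two quantities
  cannot vanish at the same place.\<close>

lemma double_minus_one_imp_product_unit:
  assumes "a \<in> V" "2 * a - 1 \<in> maximal_ideal_of V"
  shows "a * (a - 1) \<notin> maximal_ideal_of V"
proof
  note R = valuation_ring_is_subring
  assume "a * (a - 1) \<in> maximal_ideal_of V"
  moreover have "1 = (2 * a - 1) * (2 * a - 1) - a * (a - 1) * 4"
    by (simp add: algebra_simps)
  moreover have "2 * a - 1 \<in> V" "4 \<in> V"
    using assms by (auto intro!: subring_intros[OF R])
  ultimately have "1 \<in> maximal_ideal_of V"
    using assms by (metis maximal_ideal_diff maximal_ideal_mult)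
  then show False
    using maximal_ideal_1 by simp
qed

end

section \<open>Galois automorphisms acting on a valuation ring\<close>

lemma galois_group_simps:
  assumes "is_subfield F" "\<sigma> \<in> galois_group L F" "x \<in> F" "y \<in> F"
  shows "\<sigma> (x + y) = \<sigma> x + \<sigma> y" "\<sigma> (x * y) = \<sigma> x * \<sigma> y" "\<sigma> (x - y) = \<sigma> x - \<sigma> y"
    "\<sigma> x \<in> F" "\<sigma> 0 = 0" "\<sigma> 1 = 1" "\<sigma> (inverse x) = inverse (\<sigma> x)" "\<sigma> x = \<sigma> y \<longleftrightarrow> x = y"
proof -
  have hom: "\<sigma> (a + b) = \<sigma> a + \<sigma> b" "\<sigma> (a * b) = \<sigma> a * \<sigma> b" if "a \<in> F" "b \<in> F" for a b
    using assms(2) that by (auto simp: galois_group_def)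
  have bij: "bij_betw \<sigma> F F"
    using assms(2) by (auto simp: galois_group_def)
  note F = subfield_intros[OF assms(1)]
  show "\<sigma> (x + y) = \<sigma> x + \<sigma> y" "\<sigma> (x * y) = \<sigma> x * \<sigma> y"
    using hom assms by auto
  show "\<sigma> x \<in> F" and inj: "\<sigma> x = \<sigma> y \<longleftrightarrow> x = y"
    using bij assms by (auto simp: bij_betw_def inj_on_def)
  show "\<sigma> (x - y) = \<sigma> x - \<sigma> y"
    using hom(1)[of "x - y" y] F(3)[of x y] assms by simp
  show 0: "\<sigma> 0 = 0"
    using hom(1)[of 0 0] F(1) by (metis add_0 add_left_cancel add.right_neutral)
  have "\<sigma> 1 \<noteq> \<sigma> 0"
    using bij F(1,2) unfolding bij_betw_def by (metis inj_on_eq_iff zero_neq_one)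
  then show 1: "\<sigma> 1 = 1"
    using hom(2)[of 1 1] F(2) 0 by simp
  show "\<sigma> (inverse x) = inverse (\<sigma> x)"
  proof (cases "x = 0")
    case False
    then have "\<sigma> x * \<sigma> (inverse x) = 1"
      using hom(2)[of x "inverse x"] 1 assms(3) subfield_inverse[OF assms(1,3)] by simp
    then show ?thesis
      by (metis inverse_unique)
  qed (simp add: 0)
qed

lemma decomposition_group_maximal_ideal:
  assumes F: "is_subfield F" and V: "valuation_ring F V" and \<sigma>: "\<sigma> \<in> decomposition_group L F V"
    and x: "x \<in> maximal_ideal_of V"
  shows "\<sigma> x \<in> maximal_ideal_of V"
proof -
  have G: "\<sigma> \<in> galois_group L F" and im: "\<sigma> ` V = V"
    using \<sigma> by (auto simp: decomposition_group_def)
  note VF = subsetD[OF valuation_ring_subset[OF F V]]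
  have xV: "x \<in> V"
    using x maximal_ideal_subset[OF F V] by blast
  have "inverse x \<in> V" if "inverse (\<sigma> x) \<in> V" "x \<noteq> 0"
  proof -
    have "inverse (\<sigma> x) \<in> \<sigma> ` V"
      using that(1) im by simp
    then obtain w where w: "w \<in> V" "\<sigma> w = \<sigma> (inverse x)"
      using galois_group_simps(7)[OF F G VF[OF xV] VF[OF xV]] by auto
    have "w = inverse x"
      using galois_group_simps(8)[OF F G VF[OF w(1)] subfield_inverse[OF F VF[OF xV]]] w by simp
    then show ?thesis
      using w by simp
  qed
  moreover have "\<sigma> x \<in> V"
    using im xV by blast
  moreover have "\<sigma> 0 = 0"
    using galois_group_simps(5)[OF F G VF[OF xV] VF[OF xV]] .
  ultimately show ?thesis
    using x by (auto simp: maximal_ideal_of_def)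
qed


section \<open>Bounded degree composita\<close>

text \<open>The orbit of \<open>e\<close> consists of roots of one polynomial over \<open>L\<close>
  of degree at most \<open>d\<close>, so its period is at most \<open>d\<close> and divides
  \<open>fact d\<close>. This exponent serves all extensions of degree at most \<open>d\<close> at
  once, normal or not.\<close>

lemma finite_extension_funpow_fixed:
  fixes L :: "'a::field set"
  assumes \<sigma>: "field_auto L \<sigma>" and E: "finite_extension L E" "ext_degree L E \<le> d" and e: "e \<in> E"
  shows "(\<sigma> ^^ fact d) e = e"
proof -
  have ext: "is_subfield L" "is_subfield E" "L \<subseteq> E"
    using E by (auto simp: finite_extension_def is_extension_def)
  have "\<exists>m S. spans_over L S E \<and> card S = m"
    using E by (auto simp: finite_extension_def)
  from LeastI_ex[OF this] obtain S where S: "spans_over L S E" "card S = ext_degree L E"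
    unfolding ext_degree_def by blast
  have "e ^ i \<in> span_over L S" for i
    using S subring_power[OF is_subfield_imp_subring[OF ext(2)] e, of i]
    by (fastforce simp: spans_over_def span_over_def)
  then have "\<exists>c. (\<forall>i\<in>{..card S}. c i \<in> L) \<and> (\<exists>i\<in>{..card S}. c i \<noteq> 0) \<and> (\<Sum>i\<in>{..card S}. c i * e ^ i) = 0"
    using S by (intro span_over_dependent[OF ext(1), of S]) (auto simp: spans_over_def)
  then obtain c where c: "\<forall>i\<le>card S. c i \<in> L" "\<exists>i\<le>card S. c i \<noteq> 0" "(\<Sum>i\<le>card S. c i * e ^ i) = 0"
    by auto
  define p where "p = (\<Sum>i\<le>card S. monom (c i) i)"
  have co: "coeff p i = (if i \<le> card S then c i else 0)" for i
    by (simp add: p_def coeff_sum)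
  have p: "p \<noteq> 0" "poly_over L p" "poly p e = 0"
    using c subfield_intros(1)[OF ext(1)] by (auto simp: co poly_over_def poly_eq_iff)
      (simp add: p_def poly_sum poly_monom)
  have "degree p \<le> d"
    using E(2) S(2) by (intro order.trans[OF degree_le[of "card S"]]) (auto simp: co)
  then have roots: "finite {x. poly p x = 0}" "card {x. poly p x = 0} \<le> d"
    using card_poly_roots_bound[OF p(1)] poly_roots_finite[OF p(1)] by auto
  have orbit: "poly p ((\<sigma> ^^ j) e) = 0" for j
    using field_auto_poly[OF field_auto_funpow[OF \<sigma>] p(2), of j e] field_auto_0[OF field_auto_funpow[OF \<sigma>], of j] p(3)
    by simp
  have "\<not> inj_on (\<lambda>j. (\<sigma> ^^ j) e) {..d}"
    using card_inj_on_le[of "\<lambda>j. (\<sigma> ^^ j) e" "{..d}" "{x. poly p x = 0}"] roots orbit by auto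
  then obtain i j where ij: "i < j" "j \<le> d" "(\<sigma> ^^ i) e = (\<sigma> ^^ j) e"
    unfolding inj_on_def by (metis atMost_iff linorder_neqE_nat)
  have "(\<sigma> ^^ i) e = (\<sigma> ^^ i) ((\<sigma> ^^ (j - i)) e)"
    using ij funpow_add[of i "j - i" \<sigma>] by (simp add: comp_def)
  then have fixed: "(\<sigma> ^^ (j - i)) e = e"
    using field_auto_eq_iff[OF field_auto_funpow[OF \<sigma>], of i "(\<sigma> ^^ (j - i)) e" e] by simp
  have "j - i dvd fact d"
    using ij by (intro dvd_fact) auto
  then obtain m where m: "fact d = (j - i) * m"
    by (metis dvdE)
  have "((\<sigma> ^^ (j - i)) ^^ m) e = e"
    using fixed by (induction m) auto
  then show ?thesis
    by (simp add: m funpow_mult)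
qed

lemma bounded_degree_compositum_fixed:
  assumes \<sigma>: "field_auto L \<sigma>" and z: "z \<in> bounded_degree_compositum L d"
  shows "(\<sigma> ^^ fact d) z = z"
proof -
  have "bounded_degree_compositum L d \<subseteq> {z. (\<sigma> ^^ fact d) z = z}"
    unfolding bounded_degree_compositum_def
    using is_subfield_fixed[OF field_auto_funpow[OF \<sigma>]] finite_extension_funpow_fixed[OF \<sigma>]
    by (intro generated_subfield_least) auto
  then show ?thesis
    using z by blast
qed

lemma finite_extension_subset_compositum:
  assumes "finite_extension L F"
  shows "F \<subseteq> bounded_degree_compositum L (max 1 (ext_degree L F))"
  unfolding bounded_degree_compositum_def
  using assms by (intro order.trans[OF _ generated_subfield_superset]) auto


section \<open>Quadratic towers\<close>

text \<open>For \<open>u * (u - 1) \<in> M\<close> this is the field generated by \<open>M\<close>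
  and \<open>u\<close>, also when \<open>u\<close> already lies in \<open>M\<close>.\<close>

definition quadratic_adjoin :: "'a::field set \<Rightarrow> 'a \<Rightarrow> 'a set" where
  "quadratic_adjoin M u = {a + b * u | a b. a \<in> M \<and> b \<in> M}"

lemma quadratic_adjoin_superset:
  assumes "is_subfield M"
  shows "insert u M \<subseteq> quadratic_adjoin M u"
proof -
  have "u = 0 + 1 * u" "\<And>a. a = a + 0 * u"
    by auto
  then show ?thesis
    unfolding quadratic_adjoin_def using subfield_intros(1,2)[OF assms] by blast
qed

lemma quadratic_adjoin_is_subfield:
  assumes M: "is_subfield M" and u: "u * (u - 1) \<in> M"
  shows "is_subfield (quadratic_adjoin M u)"
proof (cases "u \<in> M")
  case True
  then have "quadratic_adjoin M u \<subseteq> M"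
    by (auto simp: quadratic_adjoin_def intro!: subfield_intros[OF M])
  then have "quadratic_adjoin M u = M"
    using quadratic_adjoin_superset[OF M] by blast
  then show ?thesis
    using M by simp
next
  case False
  note I = subfield_intros[OF M]
  have "inverse (a + b * u) \<in> quadratic_adjoin M u" if ab: "a \<in> M" "b \<in> M" for a b
  proof (cases "a + b * u = 0")
    case True
    then show ?thesis
      using quadratic_adjoin_superset[OF M] I(1) by auto
  next
    case nz: False
    have conj: "a + b - b * u \<noteq> 0"
    proof
      assume *: "a + b - b * u = 0"
      then have "b \<noteq> 0"
        using nz by auto
      then have "u = (a + b) / b"
        using * by (simp add: field_simps)
      then show False
        using False ab by (auto intro: I)
    qed
    \<comment> \<open>The norm of \<open>a + b * u\<close>, whose conjugate is
      \<open>a + b * (1 - u)\<close>.\<close>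
    define N where "N = a * a + a * b - b * b * (u * (u - 1))"
    have prod: "(a + b * u) * (a + b - b * u) = N"
      by (simp add: N_def algebra_simps)
    then have "N \<noteq> 0"
      using nz conj by auto
    then have "(a + b * u) * ((a + b - b * u) / N) = 1"
      using prod by simp
    then have "inverse (a + b * u) = (a + b - b * u) / N"
      by (rule inverse_unique)
    also have "\<dots> = (a + b) / N + (- b / N) * u"
      by (simp add: diff_divide_distrib)
    finally have "inverse (a + b * u) = (a + b) / N + (- b / N) * u" .
    moreover have "a * a + a * b - b * b * w \<in> M" if "w \<in> M" for w
      using ab that by (intro I)
    then have "N \<in> M"
      unfolding N_def using u .
    then have "(a + b) / N \<in> M" "- b / N \<in> M"
      using ab by (auto intro: I)
    ultimately show ?thesis
      unfolding quadratic_adjoin_def by blast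
  qed
  moreover have "(a + b * u) - (c + d * u) \<in> quadratic_adjoin M u \<and> (a + b * u) * (c + d * u) \<in> quadratic_adjoin M u"
    if "a \<in> M" "b \<in> M" "c \<in> M" "d \<in> M" for a b c d
  proof -
    have "(a + b * u) - (c + d * u) = (a - c) + (b - d) * u"
      "(a + b * u) * (c + d * u) = (a * c + b * d * (u * (u - 1))) + (a * d + b * c + b * d) * u"
      by (simp_all add: algebra_simps)
    moreover have "a * c + b * d * w \<in> M" if "w \<in> M" for w
      using \<open>a \<in> M\<close> \<open>b \<in> M\<close> \<open>c \<in> M\<close> \<open>d \<in> M\<close> that by (intro I)
    then have "a * c + b * d * (u * (u - 1)) \<in> M"
      using u .
    moreover have "a - c \<in> M" "b - d \<in> M" "a * d + b * c + b * d \<in> M"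
      using that by (auto intro!: I)
    ultimately show ?thesis
      unfolding quadratic_adjoin_def by blast
  qed
  moreover have "1 \<in> quadratic_adjoin M u"
    using quadratic_adjoin_superset[OF M] I(2) by blast
  ultimately show ?thesis
    unfolding is_subfield_def by (auto simp: quadratic_adjoin_def)
qed

text \<open>No nonzero polynomial of degree below 2 over \<open>M\<close> vanishes at
  \<open>u\<close>, so every relation of \<open>u\<close> is, up to a constant, a multiple of the
  quadratic equation, and the other root \<open>1 - u\<close> satisfies it too.\<close>

lemma quadratic_conjugation:
  fixes M :: "'a::alg_closed_field set"
  assumes M: "is_subfield M" and alg: "\<And>z. algebraic_over M z" and u: "u * (u - 1) \<in> M" "u \<notin> M"
  shows "\<exists>\<sigma>. field_auto M \<sigma> \<and> \<sigma> u = 1 - u"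
proof (rule field_auto_extend[OF M alg])
  note R = is_subfield_imp_subring[OF M]
  fix p assume p: "poly_over M p" "poly p u = 0"
  define q where "q = [:- (u * (u - 1)), -1, 1:]"
  have q: "q \<noteq> 0" "poly_over M q" "degree q = 2"
    using u(1) subfield_intros[OF M] by (auto simp: q_def poly_over_pCons[OF R] poly_over_0[OF R])
  obtain c s t where *: "c \<in> M" "c \<noteq> 0" "poly_over M t"
      "smult c p = q * s + t" "t = 0 \<or> degree t < degree q"
    using pseudo_division[OF R q(1,2) p(1)] by blast
  have qu: "poly q u = 0" "poly q (1 - u) = 0"
    by (simp_all add: q_def algebra_simps)
  have t: "t = [:coeff t 0, coeff t 1:]"
    using *(5) q(3) by (intro poly_eqI) (auto simp: coeff_pCons coeff_eq_0 split: nat.splits)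
  have "poly t u = 0"
    using arg_cong[OF *(4), of "\<lambda>p. poly p u"] p(2) qu(1) by simp
  then have tu: "coeff t 0 + u * coeff t 1 = 0"
    by (subst (asm) t) simp
  have "coeff t 1 = 0"
  proof (rule ccontr)
    assume "coeff t 1 \<noteq> 0"
    then have "u = - coeff t 0 / coeff t 1"
      using tu by (simp add: field_simps eq_neg_iff_add_eq_0)
    moreover have "- coeff t 0 / coeff t 1 \<in> M"
      using *(3) by (auto simp: poly_over_def intro!: subfield_intros[OF M])
    ultimately show False
      using u(2) by simp
  qed
  then have "t = 0"
    using t tu by simp
  then show "poly p (1 - u) = 0"
    using arg_cong[OF *(4), of "\<lambda>p. poly p (1 - u)"] qu(2) *(2) by simp
qed

text \<open>Up to sign this is the difference of the conjugates \<open>u\<close> and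
  \<open>1 - u\<close>. In characteristic 2 it is -1; otherwise it vanishes only at 1/2, which lies
  in every subfield.\<close>

lemma double_ne_1:
  assumes "is_subfield M" "u \<notin> M"
  shows "2 * u - 1 \<noteq> (0 :: 'a::field)"
proof
  assume *: "2 * u - 1 = 0"
  then have "(2 :: 'a) \<noteq> 0"
    by auto
  then have "inverse 2 = u"
    using * by (intro inverse_unique) simp
  moreover have "inverse 2 \<in> M"
    by (intro subfield_intros assms)
  ultimately show False
    using assms(2) by metis
qed

text \<open>Trivial steps with \<open>u\<close> in \<open>M\<close> are allowed, so each step of one
  tower can be repeated on top of another; this gives any two towers a common upper bound.\<close>

inductive quadratic_tower :: "'a::field set \<Rightarrow> 'a set \<Rightarrow> bool" for L where
  base: "quadratic_tower L L"
| step: "quadratic_tower L M \<Longrightarrow> u * (u - 1) \<in> M \<Longrightarrow> quadratic_tower L (quadratic_adjoin M u)"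

lemma quadratic_tower_is_subfield:
  assumes "is_subfield L" "quadratic_tower L M"
  shows "is_subfield M \<and> L \<subseteq> M"
  using assms(2,1)
  by (induction rule: quadratic_tower.induct)
     (use quadratic_adjoin_is_subfield quadratic_adjoin_superset in blast)+

lemma quadratic_tower_join:
  assumes L: "is_subfield L" and MN: "quadratic_tower L M" "quadratic_tower L N"
  shows "\<exists>Q. quadratic_tower L Q \<and> M \<subseteq> Q \<and> N \<subseteq> Q"
  using MN(2)
proof (induction rule: quadratic_tower.induct)
  case base
  then show ?case
    using MN(1) quadratic_tower_is_subfield[OF L] by blast
next
  case (step N u)
  then obtain Q where Q: "quadratic_tower L Q" "M \<subseteq> Q" "N \<subseteq> Q"
    by blast
  moreover have "quadratic_tower L (quadratic_adjoin Q u)"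
    using Q step.hyps by (intro quadratic_tower.step) auto
  moreover have "Q \<subseteq> quadratic_adjoin Q u"
    using quadratic_adjoin_superset quadratic_tower_is_subfield[OF L Q(1)] by blast
  moreover have "quadratic_adjoin N u \<subseteq> quadratic_adjoin Q u"
    using Q(3) by (auto simp: quadratic_adjoin_def)
  ultimately show ?case
    by blast
qed

lemma quadratic_tower_union_is_subfield:
  assumes L: "is_subfield L"
  shows "is_subfield (\<Union>{M. quadratic_tower L M})"
  unfolding is_subfield_def
proof (intro conjI ballI)
  show "1 \<in> \<Union>{M. quadratic_tower L M}"
    using quadratic_tower.base[of L] subfield_intros(2)[OF L] by blast
  fix x assume "x \<in> \<Union>{M. quadratic_tower L M}"
  then obtain M where M: "quadratic_tower L M" "x \<in> M"
    by blast
  then show "inverse x \<in> \<Union>{M. quadratic_tower L M}"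
    using quadratic_tower_is_subfield[OF L M(1)] subfield_inverse by blast
  fix y assume "y \<in> \<Union>{M. quadratic_tower L M}"
  then obtain N where N: "quadratic_tower L N" "y \<in> N"
    by blast
  obtain Q where Q: "quadratic_tower L Q" "M \<subseteq> Q" "N \<subseteq> Q"
    using quadratic_tower_join[OF L M(1) N(1)] by blast
  have "x - y \<in> Q" "x * y \<in> Q"
    using quadratic_tower_is_subfield[OF L Q(1)] M N Q by (auto intro: subfield_intros)
  then show "x - y \<in> \<Union>{M. quadratic_tower L M}" "x * y \<in> \<Union>{M. quadratic_tower L M}"
    using Q(1) by blast+
qed

text \<open>Descend the tower: the conjugation of a proper step fixes \<open>a + b * u\<close> only
  if \<open>b * (2 * u - 1) = 0\<close>, that is, \<open>b = 0\<close>.\<close>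

lemma quadratic_tower_fixed:
  fixes L :: "'a::alg_closed_field set"
  assumes L: "is_subfield L" and alg: "\<And>z. algebraic_over L z"
    and M: "quadratic_tower L M" "z \<in> M" and fixed: "\<And>\<sigma>. field_auto L \<sigma> \<Longrightarrow> \<sigma> z = z"
  shows "z \<in> L"
  using M
proof (induction rule: quadratic_tower.induct)
  case (step M u)
  have M: "is_subfield M" "L \<subseteq> M"
    using quadratic_tower_is_subfield[OF L step.hyps(1)] by auto
  obtain a b where ab: "a \<in> M" "b \<in> M" "z = a + b * u"
    using step.prems by (auto simp: quadratic_adjoin_def)
  have "z \<in> M"
  proof (cases "u \<in> M")
    case True
    then show ?thesis
      using ab by (auto intro: subfield_intros[OF M(1)])
  next
    case False
    then obtain \<sigma> where \<sigma>: "field_auto M \<sigma>" "\<sigma> u = 1 - u"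
      using quadratic_conjugation[OF M(1) algebraic_over_mono[OF alg M(2)] step.hyps(2)] by blast
    have "\<sigma> z = a + b * (1 - u)"
      using ab \<sigma> by (simp add: field_auto_simps[OF \<sigma>(1)] field_auto_fix[OF \<sigma>(1)])
    moreover have "\<sigma> z = z"
      using fixed field_auto_mono[OF \<sigma>(1) M(2)] by blast
    ultimately have "b * (2 * u - 1) = 0"
      using ab(3) by (simp add: algebra_simps)
    then have "b = 0"
      using double_ne_1[OF M(1) False] by simp
    then show ?thesis
      using ab by simp
  qed
  then show ?case
    using step.IH by blast
qed


section \<open>The tower of 2-isogenies\<close>

text \<open>The curve \<open>r (r - 1) q (q - 1) = \<kappa>\<^sup>2\<close> has the automorphism \<open>(r, q) \<mapsto> (q, 1 - r)\<close>, which is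
  translation by a point of order 4. The quotient by its square \<open>(r, q) \<mapsto> (1 - r, 1 - q)\<close> has an
  equation of the same shape, with the same constant when \<open>4 \<kappa>\<^sup>2 + 3 \<kappa> + 1 = 0\<close>, in every
  characteristic. The relation below says that the quotient map sends \<open>(u, v)\<close> to \<open>(r, q)\<close>.\<close>

definition isogeny :: "'a::field \<Rightarrow> 'a \<Rightarrow> 'a \<Rightarrow> 'a \<Rightarrow> 'a \<Rightarrow> bool" where
  "isogeny \<kappa> u v r q \<longleftrightarrow> u * (u - 1) * (r - 1) = \<kappa> * r \<and>
     v * (2 * u - 1) = (1 + 4 * \<kappa>) * q - 2 * \<kappa> + u - 1"

inductive_set tower_points :: "'a::field \<Rightarrow> 'a \<Rightarrow> 'a \<Rightarrow> ('a \<times> 'a) set" for \<kappa> x s where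
  base: "(x, s) \<in> tower_points \<kappa> x s"
| step: "(r, q) \<in> tower_points \<kappa> x s \<Longrightarrow> isogeny \<kappa> u v r q \<Longrightarrow> (u, v) \<in> tower_points \<kappa> x s"

text \<open>Projective geometry is kept out of the arithmetic of the tower: the curve will enter
  through \<open>k\<close> as the field of constants, \<open>L\<close> as the function field, and a
  nonconstant function \<open>x\<close> over which \<open>L\<close> is finite.\<close>

locale isogeny_tower =
  fixes k L :: "'a::alg_closed_field set" and \<kappa> x s :: 'a
  assumes k: "is_subfield k" and L: "is_subfield L" and k_subset: "k \<subseteq> L"
    and k_closed: "\<And>p. poly_over k p \<Longrightarrow> degree p > 0 \<Longrightarrow> \<exists>c\<in>k. poly p c = 0"
    and \<kappa>: "\<kappa> \<in> k" "4 * \<kappa>\<^sup>2 + 3 * \<kappa> + 1 = 0"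
    and x: "x \<in> L" "x \<notin> k" and s: "x * (x - 1) * (s * (s - 1)) = \<kappa>\<^sup>2"
    and algebraic: "\<And>z. algebraic_over L z"
    and fin: "finite_dim (generated_subfield (insert x k)) L"
begin

abbreviation "points \<equiv> tower_points \<kappa> x s"

definition "tower_field = generated_subfield (L \<union> (fst ` points \<union> snd ` points))"

section \<open>The constant of the curve and a single step of the tower\<close>

lemma \<kappa>_nonzero: "\<kappa> \<noteq> 0"
  using \<kappa>(2) by auto

text \<open>The factor \<open>1 + 4 * \<kappa>\<close> scales the second coordinate in
  \<open>isogeny\<close>; this relation is what gives the curve upstairs the same constant as the
  curve downstairs.\<close>

lemma \<kappa>_square: "\<kappa> * (1 + 4 * \<kappa>)\<^sup>2 = 1"
proof -
  have "\<kappa> * (1 + 4 * \<kappa>)\<^sup>2 - 1 = (4 * \<kappa> - 1) * (4 * \<kappa>\<^sup>2 + 3 * \<kappa> + 1)"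
    by (simp add: algebra_simps power2_eq_square)
  then show ?thesis
    using \<kappa>(2) by simp
qed

text \<open>Outside characteristic 2 the point (1/2, 1/2) lies on the curve, as a singular point,
  exactly when equality holds. It is also the only finite fixed point that the reflection
  \<open>(r, q) \<mapsto> (1 - r, 1 - q)\<close> could have.\<close>

lemma \<kappa>_nonsingular: "16 * \<kappa>\<^sup>2 \<noteq> 1"
proof
  assume "16 * \<kappa>\<^sup>2 = 1"
  then have "(4 * \<kappa> - 1) * (1 + 4 * \<kappa>) = 0"
    by (simp add: algebra_simps power2_eq_square)
  moreover have "1 + 4 * \<kappa> \<noteq> 0"
    using \<kappa>_square by (metis mult_zero_right power_zero_numeral zero_neq_one)
  ultimately have *: "4 * \<kappa> = 1"
    by simp
  \<comment> \<open>Substituting \<open>4 * \<kappa> = 1\<close> gives \<open>8 = 0\<close>, hence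
    characteristic 2, where \<open>4 * \<kappa> = 1\<close> is absurd.\<close>
  have "4 * (4 * \<kappa>\<^sup>2 + 3 * \<kappa> + 1) = (4 * \<kappa>) * (4 * \<kappa>) + 3 * (4 * \<kappa>) + 4"
    by (simp add: algebra_simps power2_eq_square)
  then have "(8 :: 'a) = 0"
    using \<kappa>(2) unfolding * by simp
  then have "(2 :: 'a) ^ 3 = 0"
    by simp
  then have "(2 :: 'a) = 0"
    by (simp only: power_eq_0_iff)
  then have "4 * \<kappa> = 0"
    using mult_2[of "2 * \<kappa>"] by (metis mult_zero_left numeral_Bit0 add_0)
  then show False
    using * by simp
qed

lemmas k_intros = subfield_intros[OF k]

text \<open>With \<open>U = u * (u - 1)\<close> the equation reads
  \<open>r = U / (U - \<kappa>)\<close>, so a constant \<open>u\<close> would make \<open>r\<close>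
  constant.\<close>

lemma isogeny_abscissa_not_in_k:
  assumes "r \<notin> k" "u * (u - 1) * (r - 1) = \<kappa> * r"
  shows "u \<notin> k"
proof
  assume u: "u \<in> k"
  have r: "r * (u * (u - 1) - \<kappa>) = u * (u - 1)"
    using assms(2) by (simp add: algebra_simps)
  have "u * (u - 1) - \<kappa> \<noteq> 0"
    using r \<kappa>_nonzero by auto
  then have "r = u * (u - 1) / (u * (u - 1) - \<kappa>)"
    using r by (simp add: field_simps)
  moreover have "u * (u - 1) / (u * (u - 1) - \<kappa>) \<in> k"
    using u \<kappa>(1) by (intro k_intros)
  ultimately show False
    using assms(1) by simp
qed

lemma isogeny_not_in_k: "r \<notin> k \<Longrightarrow> isogeny \<kappa> u v r q \<Longrightarrow> u \<notin> k"
  using isogeny_abscissa_not_in_k by (simp add: isogeny_def)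

lemma not_in_k_nonzero:
  assumes "r \<notin> k"
  shows "r \<noteq> 0" "r - 1 \<noteq> 0"
proof -
  show "r \<noteq> 0"
    using assms k_intros(1) by blast
  show "r - 1 \<noteq> 0"
    using assms k_intros(2) by (metis eq_iff_diff_eq_0)
qed

text \<open>With \<open>U\<close> and \<open>W\<close> as below, the curve downstairs gives
  \<open>U * q * (q - 1) = \<kappa> * (U - \<kappa>)\<^sup>2\<close>, and the second isogeny
  equation gives \<open>v * (v - 1) * (2 * u - 1)\<^sup>2 = W * (W - 1) - U\<close>. Eliminating
  \<open>q\<close> by means of \<open>\<kappa>_square\<close> leaves the factor
  \<open>1 + 4 * U = (2 * u - 1)\<^sup>2\<close> on both sides.\<close>

lemma isogeny_curve:
  assumes r: "r \<notin> k" and rq: "r * (r - 1) * (q * (q - 1)) = \<kappa>\<^sup>2" and uv: "isogeny \<kappa> u v r q"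
  shows "u * (u - 1) * (v * (v - 1)) = \<kappa>\<^sup>2"
proof -
  define U where "U = u * (u - 1)"
  define W where "W = (1 + 4 * \<kappa>) * q - 2 * \<kappa>"
  have u: "u \<notin> k" "2 * u - 1 \<noteq> 0"
    using isogeny_not_in_k[OF r uv] double_ne_1[OF k] by auto
  have U: "U * (r - 1) = \<kappa> * r" and v: "v * (2 * u - 1) = W + u - 1"
    using uv by (simp_all add: isogeny_def U_def W_def)
  have U0: "U \<noteq> 0" "U - \<kappa> \<noteq> 0"
    using U not_in_k_nonzero[OF r] \<kappa>_nonzero by (auto simp: algebra_simps)
  have r_eq: "r * (U - \<kappa>) = U" "(r - 1) * (U - \<kappa>) = \<kappa>"
    using U by (simp_all add: algebra_simps)
  have "U * (q * (q - 1)) * \<kappa> = (r * (U - \<kappa>)) * ((r - 1) * (U - \<kappa>)) * (q * (q - 1))"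
    by (simp add: r_eq)
  also have "\<dots> = r * (r - 1) * (q * (q - 1)) * (U - \<kappa>)\<^sup>2"
    by (simp add: power2_eq_square algebra_simps)
  also have "\<dots> = \<kappa>\<^sup>2 * (U - \<kappa>)\<^sup>2"
    by (simp add: rq)
  finally have Uq: "U * (q * (q - 1)) = \<kappa> * (U - \<kappa>)\<^sup>2"
    using \<kappa>_nonzero by (simp add: power2_eq_square mult_ac)
  have "\<kappa> * (W * (W - 1)) = \<kappa> * (1 + 4 * \<kappa>)\<^sup>2 * (q * (q - 1)) + \<kappa> * (2 * \<kappa> + 4 * \<kappa>\<^sup>2)"
    by (simp add: W_def power2_eq_square algebra_simps)
  then have W: "\<kappa> * (W * (W - 1)) = q * (q - 1) + \<kappa> * (2 * \<kappa> + 4 * \<kappa>\<^sup>2)"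
    by (simp add: \<kappa>_square)
  have "v * (2 * u - 1) * (v * (2 * u - 1) - (2 * u - 1)) = (W + u - 1) * (W - u)"
    by (simp add: v)
  then have v2: "v * (v - 1) * (2 * u - 1)\<^sup>2 = W * (W - 1) - U"
    by (simp add: U_def power2_eq_square algebra_simps)
  have "\<kappa> * (2 * u - 1)\<^sup>2 * (U * (v * (v - 1))) = U * (\<kappa> * (W * (W - 1))) - \<kappa> * U * U"
    using arg_cong[OF v2, of "\<lambda>z. \<kappa> * U * z"] by (simp add: algebra_simps)
  also have "\<dots> = U * (q * (q - 1)) + U * \<kappa> * (2 * \<kappa> + 4 * \<kappa>\<^sup>2) - \<kappa> * U * U"
    by (simp only: W distrib_left mult.assoc)
  also have "\<dots> = \<kappa> * (1 + 4 * U) * \<kappa>\<^sup>2"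
    unfolding Uq by (simp add: power2_eq_square algebra_simps)
  also have "1 + 4 * U = (2 * u - 1)\<^sup>2"
    by (simp add: U_def power2_eq_square algebra_simps)
  finally show ?thesis
    using u(2) \<kappa>_nonzero by (simp add: U_def)
qed

lemma points_props: "(r, q) \<in> points \<Longrightarrow> r \<notin> k \<and> r * (r - 1) * (q * (q - 1)) = \<kappa>\<^sup>2"
proof (induction rule: tower_points.induct)
  case base
  then show ?case
    using x(2) s by blast
next
  case (step r q u v)
  then show ?case
    using isogeny_not_in_k[OF _ step.hyps(2)] isogeny_curve[OF _ _ step.hyps(2)] by blast
qed

lemma isogeny_exists:
  assumes "r \<notin> k"
  shows "\<exists>u v. isogeny \<kappa> u v r q"
proof -
  define h where "h = \<kappa> * r / (r - 1)"
  obtain u where "poly [:- h, -1, 1:] u = 0"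
    using alg_closed_imp_poly_has_root[of "[:- h, -1, 1:]"] by auto
  then have "u * (u - 1) * (r - 1) = h * (r - 1)"
    by (simp add: algebra_simps eq_neg_iff_add_eq_0)
  then have u: "u * (u - 1) * (r - 1) = \<kappa> * r"
    using not_in_k_nonzero(2)[OF assms] by (simp add: h_def)
  have "2 * u - 1 \<noteq> 0"
    by (rule double_ne_1[OF k isogeny_abscissa_not_in_k[OF assms u]])
  then have "isogeny \<kappa> u (((1 + 4 * \<kappa>) * q - 2 * \<kappa> + u - 1) / (2 * u - 1)) r q"
    using u by (simp add: isogeny_def)
  then show ?thesis
    by blast
qed

text \<open>The first equation determines \<open>u\<close> up to conjugation, and the second then
  determines \<open>v\<close> because \<open>2 * u - 1 \<noteq> 0\<close>. The two points of a fibre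
  are exchanged by the generator of the kernel.\<close>

lemma isogeny_fibre:
  assumes r: "r \<notin> k" and "isogeny \<kappa> u v r q" "isogeny \<kappa> u' v' r q"
  shows "(u' = u \<and> v' = v) \<or> (u' = 1 - u \<and> v' = 1 - v)"
proof -
  have u: "2 * u - 1 \<noteq> 0"
    using isogeny_not_in_k assms double_ne_1[OF k] by blast
  have "(u' - u) * (u' + u - 1) * (r - 1) = u' * (u' - 1) * (r - 1) - u * (u - 1) * (r - 1)"
    by (simp add: algebra_simps)
  then have "(u' - u) * (u' + u - 1) * (r - 1) = 0"
    using assms by (simp add: isogeny_def)
  then have "u' - u = 0 \<or> u' + u - 1 = 0"
    using not_in_k_nonzero(2)[OF r] by (metis mult_eq_0_iff)
  then have "u' = u \<or> u' = 1 - u"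
    by (auto simp: eq_diff_eq)
  moreover have e: "v * (2 * u - 1) = (1 + 4 * \<kappa>) * q - 2 * \<kappa> + u - 1"
    "v' * (2 * u' - 1) = (1 + 4 * \<kappa>) * q - 2 * \<kappa> + u' - 1"
    using assms(2,3) unfolding isogeny_def by blast+
  have "v' = v" if "u' = u"
  proof -
    have "v' * (2 * u - 1) = v * (2 * u - 1)"
      by (simp only: e(1) e(2)[unfolded that])
    then show ?thesis
      using u by simp
  qed
  moreover have "v' = 1 - v" if "u' = 1 - u"
  proof -
    have "2 * u - 1 = - (2 * (1 - u) - 1)"
      by simp
    then have "v' * (2 * u - 1) = - (v' * (2 * (1 - u) - 1))"
      by (simp only: mult_minus_right)
    also have "v' * (2 * (1 - u) - 1) = v * (2 * u - 1) - (2 * u - 1)"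
      by (simp only: e(1) e(2)[unfolded that]) simp
    finally have "v' * (2 * u - 1) = (1 - v) * (2 * u - 1)"
      by (simp add: algebra_simps)
    then show ?thesis
      using u by simp
  qed
  ultimately show ?thesis
    by blast
qed

text \<open>Reflecting only the second coordinate is the involution over the abscissa line. That it
  commutes with the isogeny lets automorphisms that move \<open>s\<close> act on the tower.\<close>

lemma isogeny_reflect:
  assumes "isogeny \<kappa> u v r q"
  shows "isogeny \<kappa> u (1 - v) r (1 - q)"
proof -
  have e: "u * (u - 1) * (r - 1) = \<kappa> * r" "v * (2 * u - 1) = (1 + 4 * \<kappa>) * q - 2 * \<kappa> + u - 1"
    using assms unfolding isogeny_def by blast+
  have "(1 - v) * (2 * u - 1) = (2 * u - 1) - v * (2 * u - 1)"
    by (simp only: left_diff_distrib mult_1)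
  also have "\<dots> = (1 + 4 * \<kappa>) * (1 - q) - 2 * \<kappa> + u - 1"
    unfolding e(2) by (simp add: algebra_simps)
  finally show ?thesis
    unfolding isogeny_def using e(1) by blast
qed

text \<open>Translation by the point of order 4 upstairs covers translation by the point of order 2
  downstairs.\<close>

lemma isogeny_translate:
  assumes r: "r \<notin> k" and rq: "r * (r - 1) * (q * (q - 1)) = \<kappa>\<^sup>2" and uv: "isogeny \<kappa> u v r q"
  shows "isogeny \<kappa> v (1 - u) (1 - r) (1 - q)"
proof -
  define U Z where "U = u * (u - 1)" and "Z = v * (v - 1)"
  have UZ: "U * Z = \<kappa>\<^sup>2"
    using isogeny_curve[OF assms] by (simp add: U_def Z_def)
  have U: "U * (r - 1) = \<kappa> * r" and v: "v * (2 * u - 1) = (1 + 4 * \<kappa>) * q - 2 * \<kappa> + u - 1"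
    using uv by (simp_all add: isogeny_def U_def)
  have "U \<noteq> 0"
    using UZ \<kappa>_nonzero by auto
  have "U * (Z * r) = \<kappa>\<^sup>2 * r"
    by (simp add: UZ flip: mult.assoc)
  also have "\<dots> = \<kappa> * (\<kappa> * r)"
    by (simp add: power2_eq_square)
  also have "\<dots> = U * (\<kappa> * (r - 1))"
    by (simp flip: U)
  finally have "Z * r = \<kappa> * (r - 1)"
    using \<open>U \<noteq> 0\<close> by simp
  then have "Z * (1 - r - 1) = \<kappa> * (1 - r)"
    by (simp add: algebra_simps)
  moreover have "(1 - u) * (2 * v - 1) = (1 + 4 * \<kappa>) * (1 - q) - 2 * \<kappa> + v - 1"
  proof -
    have "(1 + 4 * \<kappa>) * q = v * (2 * u - 1) + 2 * \<kappa> - u + 1"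
      using v by (simp add: algebra_simps)
    then show ?thesis
      by (simp add: right_diff_distrib) (simp add: algebra_simps)
  qed
  ultimately show ?thesis
    by (simp add: isogeny_def Z_def)
qed

lemma field_auto_isogeny:
  assumes \<sigma>: "field_auto k \<sigma>" and "isogeny \<kappa> u v r q"
  shows "isogeny \<kappa> (\<sigma> u) (\<sigma> v) (\<sigma> r) (\<sigma> q)"
proof -
  have "\<sigma> (u * (u - 1) * (r - 1)) = \<sigma> (\<kappa> * r)" "\<sigma> (v * (2 * u - 1)) = \<sigma> ((1 + 4 * \<kappa>) * q - 2 * \<kappa> + u - 1)"
    using assms by (simp_all add: isogeny_def)
  then show ?thesis
    by (simp add: isogeny_def field_auto_simps[OF \<sigma>] field_auto_fix[OF \<sigma> \<kappa>(1)])
qed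

text \<open>By \<open>isogeny_translate\<close> the two points above \<open>(1 - r, 1 - q)\<close>
  are \<open>(v, 1 - u)\<close> and \<open>(1 - v, u)\<close>. Whichever of them is the image of
  \<open>(u, v)\<close>, \<open>\<sigma>\<close> acts there as a translation of order 4, and its
  square is the reflection.\<close>

lemma square_of_lifted_translation:
  assumes \<sigma>: "field_auto k \<sigma>" and r: "r \<notin> k" and rq: "r * (r - 1) * (q * (q - 1)) = \<kappa>\<^sup>2"
    and uv: "isogeny \<kappa> u v r q" and tr: "\<sigma> r = 1 - r" "\<sigma> q = 1 - q"
  shows "\<sigma> (\<sigma> u) = 1 - u \<and> \<sigma> (\<sigma> v) = 1 - v"
proof -
  have "isogeny \<kappa> (\<sigma> u) (\<sigma> v) (1 - r) (1 - q)"
    using field_auto_isogeny[OF \<sigma> uv] tr by simp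
  moreover have "1 - r \<notin> k"
    using r k_intros(3)[OF k_intros(2), of "1 - r"] by auto
  ultimately have "(\<sigma> u = v \<and> \<sigma> v = 1 - u) \<or> (\<sigma> u = 1 - v \<and> \<sigma> v = u)"
    using isogeny_fibre[OF _ isogeny_translate[OF r rq uv]] by fastforce
  then show ?thesis
    using field_auto_diff[OF \<sigma>, of 1] field_auto_1[OF \<sigma>] by auto
qed


subsection \<open>The tower field is Galois\<close>

lemma tower_field_is_subfield: "is_subfield tower_field"
  unfolding tower_field_def by (rule generated_subfield_is_subfield)

lemma L_subset_tower_field: "L \<subseteq> tower_field"
  unfolding tower_field_def
  using generated_subfield_superset[of "L \<union> (fst ` points \<union> snd ` points)"] by simp

lemma points_in_tower_field: "(r, q) \<in> points \<Longrightarrow> r \<in> tower_field \<and> q \<in> tower_field"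
proof -
  assume "(r, q) \<in> points"
  then have "r \<in> fst ` points" "q \<in> snd ` points"
    by force+
  then show ?thesis
    unfolding tower_field_def
    using generated_subfield_superset[of "L \<union> (fst ` points \<union> snd ` points)"] by auto
qed

lemma s_eq: "s * (s - 1) = \<kappa>\<^sup>2 / (x * (x - 1))"
proof -
  have "x * (x - 1) \<noteq> 0"
    using not_in_k_nonzero[OF x(2)] by simp
  then show ?thesis
    using nonzero_mult_div_cancel_left[of "x * (x - 1)" "s * (s - 1)"] s by simp
qed

lemma quadratic_over_L: "s * (s - 1) \<in> L"
  unfolding s_eq using x(1) \<kappa>(1) k_subset by (intro subfield_intros[OF L]) auto

lemma isogeny_coordinate_in:
  assumes M: "is_subfield M" "k \<subseteq> M" and r: "r \<notin> k" "q \<in> M" and uv: "isogeny \<kappa> u v r q" "u \<in> M"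
  shows "v \<in> M"
proof -
  have "2 * u - 1 \<noteq> 0"
    using isogeny_not_in_k[OF r(1) uv(1)] double_ne_1[OF k] by blast
  then have "v = ((1 + 4 * \<kappa>) * q - 2 * \<kappa> + u - 1) / (2 * u - 1)"
    using uv(1) by (simp add: isogeny_def field_simps)
  moreover have "((1 + 4 * \<kappa>) * q - 2 * \<kappa> + u - 1) / (2 * u - 1) \<in> M"
    using M(2) r(2) uv(2) \<kappa>(1) by (intro subfield_intros[OF M(1)]) auto
  ultimately show ?thesis
    by simp
qed

lemma isogeny_quadratic:
  assumes M: "is_subfield M" "k \<subseteq> M" and r: "r \<notin> k" "r \<in> M" and uv: "isogeny \<kappa> u v r q"
  shows "u * (u - 1) \<in> M"
proof -
  have "u * (u - 1) = \<kappa> * r / (r - 1)"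
    using uv not_in_k_nonzero(2)[OF r(1)] by (simp add: isogeny_def field_simps)
  moreover have "\<kappa> * r / (r - 1) \<in> M"
    using M(2) r(2) \<kappa>(1) by (intro subfield_intros[OF M(1)]) auto
  ultimately show ?thesis
    by (simp only:)
qed

text \<open>Each level adjoins an abscissa only: the second isogeny equation is linear in
  \<open>v\<close> and yields the other coordinate.\<close>

lemma points_in_quadratic_tower:
  "(r, q) \<in> points \<Longrightarrow> \<exists>M. quadratic_tower L M \<and> r \<in> M \<and> q \<in> M"
proof (induction rule: tower_points.induct)
  case base
  show ?case
    using quadratic_tower.step[OF quadratic_tower.base quadratic_over_L]
      quadratic_adjoin_superset[OF L, of s] x(1) by blast
next
  case (step r q u v)
  then obtain M where M: "quadratic_tower L M" "r \<in> M" "q \<in> M"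
    by blast
  have MS: "is_subfield M" "k \<subseteq> M"
    using quadratic_tower_is_subfield[OF L M(1)] k_subset by auto
  have r: "r \<notin> k"
    using points_props step.hyps by blast
  have N: "quadratic_tower L (quadratic_adjoin M u)"
    using quadratic_tower.step[OF M(1) isogeny_quadratic[OF MS r M(2) step.hyps(2)]] .
  have sub: "insert u M \<subseteq> quadratic_adjoin M u"
    using quadratic_adjoin_superset[OF MS(1)] .
  have "v \<in> quadratic_adjoin M u"
    using quadratic_tower_is_subfield[OF L N] k_subset sub M(3)
    by (intro isogeny_coordinate_in[OF _ _ r _ step.hyps(2)]) auto
  then show ?case
    using N sub by blast
qed

lemma tower_field_quadratic: "z \<in> tower_field \<Longrightarrow> \<exists>M. quadratic_tower L M \<and> z \<in> M"
proof -
  have "tower_field \<subseteq> \<Union>{M. quadratic_tower L M}"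
    unfolding tower_field_def
  proof (rule generated_subfield_least[OF quadratic_tower_union_is_subfield[OF L]])
    show "L \<union> (fst ` points \<union> snd ` points) \<subseteq> \<Union>{M. quadratic_tower L M}"
    proof
      fix z assume "z \<in> L \<union> (fst ` points \<union> snd ` points)"
      then consider "z \<in> L" | q where "(z, q) \<in> points" | r where "(r, z) \<in> points"
        by force
      then show "z \<in> \<Union>{M. quadratic_tower L M}"
        using quadratic_tower.base[of L] points_in_quadratic_tower by cases blast+
    qed
  qed
  then show "z \<in> tower_field \<Longrightarrow> ?thesis"
    by blast
qed

text \<open>An automorphism over \<open>L\<close> may send \<open>s\<close> to \<open>1 - s\<close>.
  The image of a point of the tower then lies above \<open>(x, 1 - s)\<close>, and reflecting its
  second coordinate brings it back above \<open>(x, s)\<close>.\<close>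

lemma field_auto_points:
  assumes \<sigma>: "field_auto L \<sigma>"
  shows "(r, q) \<in> points \<Longrightarrow> (\<sigma> r, if \<sigma> s = s then \<sigma> q else 1 - \<sigma> q) \<in> points"
proof (induction rule: tower_points.induct)
  case base
  have "x * (x - 1) * (\<sigma> s * (\<sigma> s - 1)) = \<sigma> (x * (x - 1) * (s * (s - 1)))"
    using field_auto_fix[OF \<sigma> x(1)] by (simp add: field_auto_simps[OF \<sigma>])
  also have "\<dots> = \<kappa>\<^sup>2"
    using field_auto_fix[OF \<sigma>, of \<kappa>] \<kappa>(1) k_subset by (simp add: s field_auto_simps[OF \<sigma>] subset_iff)
  finally have "\<sigma> s * (\<sigma> s - 1) = s * (s - 1)"
    using not_in_k_nonzero[OF x(2)] by (simp add: s_eq field_simps)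
  then have "(\<sigma> s - s) * (\<sigma> s + s - 1) = 0"
    by (simp add: algebra_simps)
  then have "\<sigma> s - s = 0 \<or> \<sigma> s + s - 1 = 0"
    by (metis mult_eq_0_iff)
  then have "\<sigma> s = s \<or> 1 - \<sigma> s = s"
    by (auto simp: algebra_simps)
  then show ?case
    using field_auto_fix[OF \<sigma> x(1)] by (auto intro: tower_points.base)
next
  case (step r q u v)
  have "isogeny \<kappa> (\<sigma> u) (\<sigma> v) (\<sigma> r) (\<sigma> q)"
    using field_auto_isogeny[OF field_auto_mono[OF \<sigma> k_subset] step.hyps(2)] .
  note iso = this
  show ?case
  proof (cases "\<sigma> s = s")
    case True
    then show ?thesis
      using tower_points.step[OF _ iso] step.IH by simp
  next
    case False
    then show ?thesis
      using tower_points.step[OF _ isogeny_reflect[OF iso]] step.IH by simp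
  qed
qed

lemma field_auto_tower_field:
  assumes \<sigma>: "field_auto L \<sigma>" and z: "z \<in> tower_field"
  shows "\<sigma> z \<in> tower_field"
proof -
  have pts: "\<sigma> r \<in> tower_field \<and> \<sigma> q \<in> tower_field" if "(r, q) \<in> points" for r q
  proof -
    note * = points_in_tower_field[OF field_auto_points[OF \<sigma> that]]
    have "\<sigma> q \<in> tower_field" if "1 - \<sigma> q \<in> tower_field"
      using subfield_intros(3)[OF tower_field_is_subfield subfield_intros(2)[OF tower_field_is_subfield] that]
      by simp
    then show ?thesis
      using * by (auto split: if_splits)
  qed
  have "generated_subfield (L \<union> (fst ` points \<union> snd ` points)) \<subseteq> {z. \<sigma> z \<in> tower_field}"
    using pts L_subset_tower_field field_auto_fix[OF \<sigma>]
    by (intro generated_subfield_least is_subfield_vimage[OF \<sigma> tower_field_is_subfield]) auto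
  then show ?thesis
    using z[unfolded tower_field_def] by blast
qed

lemma tower_field_galois: "galois_extension L tower_field"
  unfolding galois_extension_def
proof (intro conjI ballI allI impI)
  show "is_extension L tower_field"
    using L tower_field_is_subfield L_subset_tower_field by (simp add: is_extension_def)
  show "algebraic_over L z" for z
    by (rule algebraic)
  fix z p assume z: "z \<in> tower_field" and p: "is_min_poly L z p"
  have p0: "p \<noteq> 0" "poly_over L p" "poly p z = 0"
    using p by (auto simp: is_min_poly_def)
  define R where "R = {y. poly p y = 0}"
  have finR: "finite R"
    using poly_roots_finite[OF p0(1)] by (simp add: R_def)
  have R: "R \<subseteq> tower_field"
    using min_poly_conjugate[OF L algebraic p] field_auto_tower_field[OF _ z] by (auto simp: R_def)
  then show "{y. poly p y = 0} \<subseteq> tower_field"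
    by (simp add: R_def)
  \<comment> \<open>The product over the distinct roots is squarefree by construction. Its
    coefficients are fixed by every automorphism over \<open>L\<close> and lie in quadratic towers,
    hence in \<open>L\<close>; so \<open>p\<close> divides it and is squarefree as well.\<close>
  define Q where "Q = (\<Prod>y\<in>R. [:- y, 1:])"
  have Q0: "Q \<noteq> 0"
    by (simp add: Q_def finR)
  have inv: "coeff Q i \<in> L" for i
  proof -
    have fixed: "\<sigma> (coeff Q i) = coeff Q i" if \<sigma>: "field_auto L \<sigma>" for \<sigma>
    proof -
      have "\<sigma> ` R \<subseteq> R"
        by (auto simp: R_def field_auto_0[OF \<sigma>] simp flip: field_auto_poly[OF \<sigma> p0(2)])
      then have im: "\<sigma> ` R = R"
        using finR field_auto_eq_iff[OF \<sigma>] by (intro endo_inj_surj) (auto simp: inj_on_def)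
      have co: "coeff (map_poly \<sigma> q) j = \<sigma> (coeff q j)" for q j
        using field_auto_0[OF \<sigma>] by (rule coeff_map_poly)
      have mult: "map_poly \<sigma> (a * b) = map_poly \<sigma> a * map_poly \<sigma> b" for a b
        by (rule poly_eqI) (simp add: co coeff_mult field_auto_sum[OF \<sigma>] field_auto_mult[OF \<sigma>])
      have "map_poly \<sigma> (\<Prod>y\<in>A. [:- y, 1:]) = (\<Prod>y\<in>A. [:- \<sigma> y, 1:])" for A
      proof (induction A rule: infinite_finite_induct)
        case (insert y A)
        have "map_poly \<sigma> [:- y, 1:] = [:- \<sigma> y, 1:]"
          by (rule poly_eqI) (auto simp: co coeff_pCons field_auto_simps[OF \<sigma>] split: nat.splits)
        then show ?case
          using insert by (simp add: mult del: mult_pCons_left)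
      qed (simp_all add: field_auto_1[OF \<sigma>])
      then have "map_poly \<sigma> Q = (\<Prod>y\<in>R. [:- \<sigma> y, 1:])"
        by (simp add: Q_def)
      also have "\<dots> = (\<Prod>y\<in>\<sigma> ` R. [:- y, 1:])"
        using field_auto_eq_iff[OF \<sigma>] by (subst prod.reindex) (auto simp: inj_on_def)
      also have "\<dots> = Q"
        by (simp add: im Q_def)
      finally show ?thesis
        using co[of Q i] by simp
    qed
    have "poly_over tower_field Q"
    proof -
      have "poly_over tower_field (\<Prod>y\<in>A. [:- y, 1:])" if "A \<subseteq> tower_field" for A
        using that
        by (induction A rule: infinite_finite_induct)
          (auto simp: poly_over_pCons[OF is_subfield_imp_subring[OF tower_field_is_subfield]]
            simp del: mult_pCons_left
            intro!: poly_over_1 poly_over_0 poly_over_mult is_subfield_imp_subring tower_field_is_subfield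
              subfield_intros(2)[OF tower_field_is_subfield] subfield_intros(5)[OF tower_field_is_subfield])
      then show ?thesis
        using R by (simp add: Q_def)
    qed
    then obtain M where "quadratic_tower L M" "coeff Q i \<in> M"
      using tower_field_quadratic by (auto simp: poly_over_def)
    then show ?thesis
      using quadratic_tower_fixed[OF L algebraic] fixed by blast
  qed
  have "poly Q z = 0"
    using p0(3) finR by (auto simp: Q_def poly_prod R_def)
  then have dvd: "p dvd Q"
    using min_poly_dvd[OF is_subfield_imp_subring[OF L] p] inv by (simp add: poly_over_def)
  have "order a Q \<le> 1" for a
  proof -
    consider "a \<notin> R" | "a \<in> R"
      by blast
    then show ?thesis
    proof cases
      case 1
      then have "poly Q a \<noteq> 0"
        using finR by (auto simp: Q_def poly_prod)
      then show ?thesis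
        by (simp add: order_0I)
    next
      case 2
      define T where "T = (\<Prod>y\<in>R - {a}. [:- y, 1:])"
      have "poly T a \<noteq> 0"
        using finR by (auto simp: T_def poly_prod)
      moreover have QT: "Q = [:- a, 1:] ^ 1 * T"
        unfolding Q_def T_def power_one_right using finR 2 by (rule prod.remove)
      ultimately have "order a Q = 1"
        using Q0 order_mult[of "[:- a, 1:] ^ 1" T a] order_power_n_n[of a 1]
        by (simp add: order_0I del: power_one_right mult_pCons_left)
      then show ?thesis
        by simp
    qed
  qed
  then have "order a p \<le> 1" for a
    using dvd_imp_order_le[OF Q0 dvd, of a] order.trans by blast
  then show "rsquarefree p"
    unfolding rsquarefree_def using p0(1) by (auto simp: le_Suc_eq)
qed


subsection \<open>The tower field lies in no bounded degree compositum\<close>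

text \<open>A polynomial over \<open>k\<close> splits into linear factors with roots in
  \<open>k\<close>, and none of these vanishes at \<open>u\<close>.\<close>

lemma transcendental_over_k:
  assumes "poly_over k p" "poly p u = 0" "u \<notin> k"
  shows "p = 0"
  using assms
proof (induction "degree p" arbitrary: p rule: less_induct)
  case less
  show ?case
  proof (cases "degree p = 0")
    case True
    then show ?thesis
      using less.prems(2) by (metis degree_eq_zeroE mult_zero_right pCons_0_0 poly_0 poly_pCons add.right_neutral)
  next
    case False
    then obtain c a b where *: "c \<in> k" "poly_over k b" "b \<noteq> 0" "degree b < degree p"
      "smult a p = [:- c, 1:] * b"
      using closed_subfield_factor[OF k k_closed less.prems(1)] by blast
    have "(u - c) * poly b u = 0"
      using arg_cong[OF *(5), of "\<lambda>p. poly p u"] less.prems(2) by (auto simp: algebra_simps)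
    then have "poly b u = 0"
      using *(1) less.prems(3) by auto
    then show ?thesis
      using less.hyps[OF *(4,2)] less.prems(3) *(3) by blast
  qed
qed

text \<open>The substitution \<open>u \<mapsto> 1 - u\<close> fixes \<open>r\<close> but not \<open>u\<close>.\<close>

lemma isogeny_proper_extension:
  assumes r: "r \<notin> k" and uv: "isogeny \<kappa> u v r q"
  shows "u \<notin> generated_subfield (insert r k)"
proof
  assume *: "u \<in> generated_subfield (insert r k)"
  have u: "u \<notin> k" "2 * u - 1 \<noteq> 0"
    using isogeny_not_in_k[OF r uv] double_ne_1[OF k] by auto
  define G where "G = {(a, a) | a. a \<in> k}"
  have G: "partial_hom G"
    using is_subfield_imp_subring[OF k] by (auto simp: partial_hom_def G_def is_subring_def)
  have eq: "p = q \<and> poly_over k p" if "poly_pair G p q" for p q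
    using that by (auto simp: poly_pair_def G_def poly_over_def poly_eq_iff)
  have root: "poly q (1 - u) = 0" if "poly_pair G p q" "poly p u = 0" for p q
    using eq[OF that(1)] transcendental_over_k[OF _ that(2) u(1)] by auto
  define H where "H = {(poly p u, poly q (1 - u)) | p q. poly_pair G p q}"
  have H: "partial_hom H" "G \<subseteq> H" "(u, 1 - u) \<in> H"
    unfolding H_def by (rule partial_hom_adjoin[OF G root]; assumption)+
  obtain M where M: "maximal_hom M" "H \<subseteq> M"
    using maximal_hom_exists[OF H(1)] by blast
  have MP: "partial_hom M"
    using M(1) by (simp add: maximal_hom_def)
  \<comment> \<open>The elements fixed by the extended substitution. Passing to a maximal
    homomorphism makes \<open>S\<close> closed under inverses, so that the rational function
    \<open>r\<close> of \<open>u * (u - 1)\<close> belongs to it.\<close>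
  define S where "S = {a. (a, a) \<in> M}"
  have "inverse a \<in> S" if "a \<in> S" for a
    using that maximal_hom_inverse[OF M(1), of a a] by (cases "a = 0") (auto simp: S_def)
  then have S: "is_subfield S"
    unfolding is_subfield_def S_def by (auto intro: partial_hom_intros[OF MP])
  have kS: "k \<subseteq> S"
    using H(2) M(2) by (auto simp: S_def G_def)
  define U where "U = u * (u - 1)"
  have uM: "(u, 1 - u) \<in> M"
    using H(3) M(2) by blast
  have "(u * (u - 1), (1 - u) * ((1 - u) - 1)) \<in> M"
    by (intro partial_hom_intros[OF MP] uM)
  then have U: "U \<in> S"
    by (simp add: S_def U_def algebra_simps)
  have "r * (U - \<kappa>) = U"
    using uv by (simp add: isogeny_def U_def algebra_simps)
  moreover have "U - \<kappa> \<noteq> 0"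
    using calculation \<kappa>_nonzero by auto
  ultimately have "r = U / (U - \<kappa>)"
    by (simp add: field_simps)
  then have "r \<in> S"
    using U kS \<kappa>(1) by (auto intro!: subfield_intros[OF S])
  then have "u \<in> S"
    using * generated_subfield_least[OF S, of "insert r k"] kS by blast
  then have "u = 1 - u"
    using partial_hom_unique[OF MP _ uM] by (simp add: S_def)
  then show False
    using u(2) by (metis diff_add_cancel mult_2 right_minus_eq)
qed

lemma chain_exists:
  "\<exists>P Q. P 0 = x \<and> Q 0 = s \<and> (\<forall>n. isogeny \<kappa> (P (Suc n)) (Q (Suc n)) (P n) (Q n))"
proof -
  have "\<exists>f. \<forall>n. f n \<in> points \<and> (n = 0 \<longrightarrow> f n = (x, s)) \<and>
     isogeny \<kappa> (fst (f (Suc n))) (snd (f (Suc n))) (fst (f n)) (snd (f n))"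
  proof (rule exE[OF dependent_nat_choice[where P = "\<lambda>n p. p \<in> points \<and> (n = 0 \<longrightarrow> p = (x, s))"
        and Q = "\<lambda>n p p'. isogeny \<kappa> (fst p') (snd p') (fst p) (snd p)"]])
    show "\<exists>p. p \<in> points \<and> (0 = 0 \<longrightarrow> p = (x, s))"
      using tower_points.base by blast
    fix p :: "'a \<times> 'a" and n :: nat
    assume "p \<in> points \<and> (n = 0 \<longrightarrow> p = (x, s))"
    then obtain r q where rq: "p = (r, q)" "(r, q) \<in> points"
      by (cases p) auto
    obtain u v where "isogeny \<kappa> u v r q"
      using isogeny_exists points_props[OF rq(2)] by blast
    then show "\<exists>p'. (p' \<in> points \<and> (Suc n = 0 \<longrightarrow> p' = (x, s))) \<and> isogeny \<kappa> (fst p') (snd p') (fst p) (snd p)"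
      using rq tower_points.step by (intro exI[of _ "(u, v)"]) auto
  qed blast
  then obtain f where f: "f 0 = (x, s)"
    "\<And>n. isogeny \<kappa> (fst (f (Suc n))) (snd (f (Suc n))) (fst (f n)) (snd (f n))"
    by blast
  then show ?thesis
    by (intro exI[of _ "fst \<circ> f"] exI[of _ "snd \<circ> f"]) simp
qed

lemma chain_props:
  assumes "P 0 = x" "Q 0 = s" "\<And>n. isogeny \<kappa> (P (Suc n)) (Q (Suc n)) (P n) (Q n)"
  shows "(P n, Q n) \<in> points"
  using assms by (induction n) (auto intro: tower_points.intros)

text \<open>The fields generated over \<open>k\<close> by \<open>P n\<close> increase strictly. In a
  linear relation over the lowest of them, the term of largest index with a nonzero coefficient
  would lie in the preceding field.\<close>

lemma chain_leaves_finite_dim: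
  assumes P: "P 0 = x" "Q 0 = s" "\<And>n. isogeny \<kappa> (P (Suc n)) (Q (Suc n)) (P n) (Q n)"
    and M: "finite_dim (generated_subfield (insert x k)) M"
  shows "\<exists>n. P n \<notin> M"
proof (rule ccontr)
  assume *: "\<not> ?thesis"
  define E where "E n = generated_subfield (insert (P n) k)" for n
  have E: "is_subfield (E n)" "insert (P n) k \<subseteq> E n" for n
    by (simp_all add: E_def generated_subfield_is_subfield generated_subfield_superset)
  have Pk: "P n \<notin> k" for n
    using chain_props[OF P] points_props by blast
  have PE: "P n \<in> E (Suc n)" for n
  proof -
    define U where "U = P (Suc n) * (P (Suc n) - 1)"
    have "P n * (U - \<kappa>) = U"
      using P(3)[of n] by (simp add: isogeny_def U_def algebra_simps)
    moreover have "U - \<kappa> \<noteq> 0"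
      using calculation \<kappa>_nonzero by auto
    ultimately have "P n = U / (U - \<kappa>)"
      by (simp add: field_simps)
    moreover have "U \<in> E (Suc n)"
      unfolding U_def using E(2) by (intro subfield_intros[OF E(1)]) auto
    then have "U / (U - \<kappa>) \<in> E (Suc n)"
      using E(2)[of "Suc n"] \<kappa>(1) by (intro subfield_intros[OF E(1)]) auto
    ultimately show ?thesis
      by simp
  qed
  have step: "E n \<subseteq> E (Suc n)" for n
    unfolding E_def[of n] using PE E(2)[of "Suc n"] by (intro generated_subfield_least E(1)) auto
  have mono: "E m \<subseteq> E n" if "m \<le> n" for m n
    using lift_Suc_mono_le[of E, OF step that] .
  obtain S where S: "finite S" "M \<subseteq> span_over (E 0) S"
    using M P(1) by (auto simp: finite_dim_def E_def)
  \<comment> \<open>The index 0 is left out because \<open>P 0\<close> lies in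
    \<open>E 0\<close>.\<close>
  define I where "I = {1..card S + 1}"
  have "\<exists>c. (\<forall>i\<in>I. c i \<in> E 0) \<and> (\<exists>i\<in>I. c i \<noteq> 0) \<and> (\<Sum>i\<in>I. c i * P i) = 0"
    using * S by (intro span_over_dependent[OF E(1) S(1)]) (auto simp: I_def)
  then obtain c where c: "\<forall>i\<in>I. c i \<in> E 0" "\<exists>i\<in>I. c i \<noteq> 0" "(\<Sum>i\<in>I. c i * P i) = 0"
    by blast
  define J where "J = {i\<in>I. c i \<noteq> 0}"
  define j where "j = Max J"
  have J: "finite J" "J \<noteq> {}"
    using c(2) by (auto simp: J_def I_def)
  then have jJ: "j \<in> J" and jmax: "\<And>i. i \<in> J \<Longrightarrow> i \<le> j"
    by (auto simp: j_def)
  have "0 = (\<Sum>i\<in>J. c i * P i)"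
    unfolding c(3)[symmetric] by (rule sum.mono_neutral_right) (auto simp: J_def I_def)
  also have "\<dots> = c j * P j + (\<Sum>i\<in>J - {j}. c i * P i)"
    using J jJ by (simp add: sum.remove)
  finally have "c j * P j = - (\<Sum>i\<in>J - {j}. c i * P i)"
    by (simp add: eq_neg_iff_add_eq_0)
  then have "P j = - (\<Sum>i\<in>J - {j}. c i * P i) / c j"
    using jJ by (simp add: J_def field_simps)
  moreover have "- (\<Sum>i\<in>J - {j}. c i * P i) / c j \<in> E (j - 1)"
  proof -
    have "P i \<in> E (j - 1)" if "i \<in> J - {j}" for i
    proof -
      have "i \<le> j - 1"
        using jmax[of i] that by (cases "i = j") auto
      then show ?thesis
        using mono E(2)[of i] by blast
    qed
    moreover have "c i \<in> E (j - 1)" if "i \<in> J" for i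
      using c(1) mono[of 0 "j - 1"] that by (auto simp: J_def)
    ultimately show ?thesis
      using jJ by (intro subfield_intros[OF E(1)]) auto
  qed
  moreover have "P j \<notin> E (j - 1)"
  proof -
    obtain i where "j = Suc i"
      using jJ by (cases j) (auto simp: J_def I_def)
    then show ?thesis
      using isogeny_proper_extension[OF Pk P(3), of i] by (simp add: E_def)
  qed
  ultimately show False
    by simp
qed

text \<open>Adjoin \<open>s\<close> to \<open>L\<close> and let \<open>n\<close> be the first level
  at which the abscissa leaves the resulting field \<open>M\<close>. All earlier coordinates lie in
  \<open>M\<close>, so the conjugation of \<open>P n\<close> over \<open>M\<close> fixes the point
  below and must exchange the two points of the fibre.\<close>

lemma chain_reflection:
  assumes P: "P 0 = x" "Q 0 = s" "\<And>n. isogeny \<kappa> (P (Suc n)) (Q (Suc n)) (P n) (Q n)"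
  shows "\<exists>n \<sigma>. field_auto L \<sigma> \<and> \<sigma> (P n) = 1 - P n \<and> \<sigma> (Q n) = 1 - Q n"
proof -
  define E where "E = generated_subfield (insert x k)"
  have E: "is_subfield E" "E \<subseteq> L"
    unfolding E_def using x(1) k_subset by (auto intro!: generated_subfield_is_subfield generated_subfield_least[OF L])
  have "algebraic_over E s"
    unfolding algebraic_over_def
  proof (intro exI conjI)
    have "insert x k \<subseteq> E"
      by (simp add: E_def generated_subfield_superset)
    then have "s * (s - 1) \<in> E"
      unfolding s_eq using \<kappa>(1) by (intro subfield_intros[OF E(1)]) auto
    then show "poly_over E [:- (s * (s - 1)), -1, 1:]"
      using subfield_intros[OF E(1)]
      by (simp add: poly_over_pCons[OF is_subfield_imp_subring[OF E(1)]] poly_over_0[OF is_subfield_imp_subring[OF E(1)]])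
  qed (simp_all add: algebra_simps)
  then obtain M where M: "is_subfield M" "insert s L \<subseteq> M" "finite_dim E M"
    using finite_dim_adjoin_one[OF E(1) L E(2)] fin by (auto simp: E_def)
  have kM: "k \<subseteq> M"
    using M(2) k_subset by blast
  obtain n0 where "P n0 \<notin> M"
    using chain_leaves_finite_dim[OF P] M(3) by (auto simp: E_def)
  define n where "n = (LEAST n. P n \<notin> M)"
  have n: "P n \<notin> M" "\<And>m. m < n \<Longrightarrow> P m \<in> M"
    using LeastI[of "\<lambda>n. P n \<notin> M", OF \<open>P n0 \<notin> M\<close>] not_less_Least by (auto simp: n_def)
  have "n \<noteq> 0"
    using n(1) P(1) x(1) M(2) by (metis insert_subset subsetD)
  then obtain m where m: "n = Suc m"
    by (cases n) auto
  have Pk: "P n \<notin> k" for n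
    using chain_props[OF P] points_props by blast
  have QM: "Q i \<in> M" if "i < n" for i
    using that
  proof (induction i)
    case 0
    then show ?case
      using P(2) M(2) by auto
  next
    case (Suc i)
    then show ?case
      using isogeny_coordinate_in[OF M(1) kM Pk _ P(3)] n(2) by auto
  qed
  have "P n * (P n - 1) \<in> M"
    unfolding m using isogeny_quadratic[OF M(1) kM Pk _ P(3)] n(2) m by auto
  then obtain \<sigma> where \<sigma>: "field_auto M \<sigma>" "\<sigma> (P n) = 1 - P n"
    using quadratic_conjugation[OF M(1) algebraic_over_mono[OF algebraic] _ n(1)] M(2) by auto
  have fixed: "\<sigma> (P m) = P m" "\<sigma> (Q m) = Q m"
    using n(2)[of m] QM[of m] m field_auto_fix[OF \<sigma>(1)] by auto
  have "isogeny \<kappa> (\<sigma> (P n)) (\<sigma> (Q n)) (P m) (Q m)"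
    using field_auto_isogeny[OF field_auto_mono[OF \<sigma>(1) kM] P(3)[of m]] by (simp add: fixed m)
  then have "\<sigma> (P n) = P n \<or> \<sigma> (Q n) = 1 - Q n"
    using isogeny_fibre[OF Pk P(3)[of m]] m by auto
  moreover have "\<sigma> (P n) \<noteq> P n"
  proof
    assume "\<sigma> (P n) = P n"
    then have "2 * P n - 1 = 0"
      using \<sigma>(2) by (metis diff_add_cancel mult_2 right_minus_eq)
    then show False
      using double_ne_1[OF k Pk] by blast
  qed
  ultimately show ?thesis
    using \<sigma>(2) field_auto_mono[OF \<sigma>(1), of L] M(2) by blast
qed

text \<open>One level above a point that \<open>\<tau>\<close> reflects, \<open>\<tau>\<close> acts
  as a translation of order 4 and \<open>\<tau> \<circ> \<tau>\<close> as the reflection; each level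
  costs one squaring.\<close>

lemma chain_reflection_power:
  assumes P: "P 0 = x" "Q 0 = s" "\<And>n. isogeny \<kappa> (P (Suc n)) (Q (Suc n)) (P n) (Q n)"
    and \<sigma>: "field_auto L \<sigma>" "\<sigma> (P n) = 1 - P n" "\<sigma> (Q n) = 1 - Q n"
  shows "(\<sigma> ^^ (2 ^ j)) (P (n + j)) = 1 - P (n + j) \<and> (\<sigma> ^^ (2 ^ j)) (Q (n + j)) = 1 - Q (n + j)"
proof (induction j)
  case (Suc j)
  define \<tau> where "\<tau> = \<sigma> ^^ (2 ^ j)"
  have \<tau>: "field_auto k \<tau>"
    unfolding \<tau>_def by (rule field_auto_mono[OF field_auto_funpow[OF \<sigma>(1)] k_subset])
  have "\<sigma> ^^ (2 ^ Suc j) = \<tau> \<circ> \<tau>"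
    by (simp add: \<tau>_def mult_2 funpow_add)
  moreover have "P (n + j) \<notin> k \<and> P (n + j) * (P (n + j) - 1) * (Q (n + j) * (Q (n + j) - 1)) = \<kappa>\<^sup>2"
    using points_props[OF chain_props[OF P]] .
  then have "\<tau> (\<tau> (P (Suc (n + j)))) = 1 - P (Suc (n + j)) \<and> \<tau> (\<tau> (Q (Suc (n + j)))) = 1 - Q (Suc (n + j))"
    using square_of_lifted_translation[OF \<tau> _ _ P(3)[of "n + j"]] Suc.IH by (simp add: \<tau>_def)
  ultimately show ?case
    by simp
qed (use \<sigma> in simp)

text \<open>Write \<open>fact d = 2 ^ a * b\<close> with \<open>b\<close> odd. The
  \<open>2 ^ a\<close>-th power of \<open>\<sigma>\<close> reflects level \<open>n + a\<close>, and
  so does its odd power of exponent \<open>b\<close>; but that is the power by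
  \<open>fact d\<close>, which is trivial on the compositum.\<close>

lemma tower_field_not_in_compositum: "\<not> tower_field \<subseteq> bounded_degree_compositum L d"
proof
  assume sub: "tower_field \<subseteq> bounded_degree_compositum L d"
  obtain P Q where P: "P 0 = x" "Q 0 = s" "\<And>n. isogeny \<kappa> (P (Suc n)) (Q (Suc n)) (P n) (Q n)"
    using chain_exists by blast
  obtain n \<sigma> where \<sigma>: "field_auto L \<sigma>" "\<sigma> (P n) = 1 - P n" "\<sigma> (Q n) = 1 - Q n"
    using chain_reflection[OF P] by blast
  have "\<exists>a b. N = 2 ^ a * b \<and> odd b" if "N > 0" for N :: nat
    using that
  proof (induction N rule: less_induct)
    case (less N)
    show ?case
    proof (cases "odd N")
      case True
      then show ?thesis
        by (intro exI[of _ 0] exI[of _ N]) simp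
    next
      case False
      then obtain m where m: "N = 2 * m"
        by blast
      then obtain a b where "m = 2 ^ a * b" "odd b"
        using less by (metis mult_2 less_add_same_cancel1 nat_0_less_mult_iff)
      then show ?thesis
        using m by (intro exI[of _ "Suc a"] exI[of _ b]) simp
    qed
  qed
  then obtain a b where ab: "(fact d :: nat) = 2 ^ a * b" "odd b"
    by (metis fact_gt_zero)
  define \<tau> where "\<tau> = \<sigma> ^^ (2 ^ a)"
  define z where "z = P (n + a)"
  have \<tau>: "field_auto L \<tau>"
    unfolding \<tau>_def by (rule field_auto_funpow[OF \<sigma>(1)])
  have \<tau>z: "\<tau> z = 1 - z"
    using chain_reflection_power[OF P \<sigma>, of a] by (simp add: \<tau>_def z_def)
  have "(\<tau> ^^ i) z = (if even i then z else 1 - z)" for i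
    by (induction i) (auto simp: \<tau>z field_auto_diff[OF \<tau>] field_auto_1[OF \<tau>])
  then have "(\<tau> ^^ b) z = 1 - z"
    using ab(2) by simp
  moreover have "(\<tau> ^^ b) z = (\<sigma> ^^ fact d) z"
    by (simp add: \<tau>_def funpow_mult ab(1))
  moreover have pt: "(z, Q (n + a)) \<in> points"
    using chain_props[OF P] by (simp add: z_def)
  then have "(\<sigma> ^^ fact d) z = z"
    using bounded_degree_compositum_fixed[OF \<sigma>(1)] points_in_tower_field sub by blast
  ultimately have "2 * z - 1 = 0"
    by (metis diff_add_cancel mult_2 right_minus_eq)
  then show False
    using double_ne_1[OF k] points_props[OF pt] by blast
qed


subsection \<open>Decomposition groups of the tower field\<close>

text \<open>The hypotheses say that the reflection fixes the reduction of \<open>(a, b)\<close>. A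
  pole of one coordinate makes the other reduce to 0 or 1, where twice it minus 1 is a unit. If both
  are finite, they give \<open>16 * \<kappa>\<^sup>2 = 1\<close> in the residue field. This is the
  unramifiedness of the tower above \<open>s\<close>.\<close>

lemma reflected_curve_point_singular:
  assumes V: "valuation_ring tower_field V" and kV: "k \<subseteq> V"
    and ab: "a \<in> tower_field" "b \<in> tower_field" "a * (a - 1) * (b * (b - 1)) = \<kappa>\<^sup>2"
    and fa: "a \<in> V \<Longrightarrow> 2 * a - 1 \<in> maximal_ideal_of V"
    and fb: "b \<in> V \<Longrightarrow> 2 * b - 1 \<in> maximal_ideal_of V"
  shows False
proof -
  note F = tower_field_is_subfield
  note VR = valuation_ring_is_subring[OF F V]
  note mult = maximal_ideal_mult[OF F V] and mdiff = maximal_ideal_diff[OF F V]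
    and madd = maximal_ideal_add[OF F V]
  have \<kappa>V: "\<kappa>\<^sup>2 \<in> V"
    using \<kappa>(1) kV by (auto intro: subring_power[OF VR])
  have finite_a: "a \<in> V"
    if a: "a \<in> tower_field" and b: "b \<in> tower_field" and e: "a * (a - 1) * (b * (b - 1)) = \<kappa>\<^sup>2"
      and fb: "b \<in> V \<Longrightarrow> 2 * b - 1 \<in> maximal_ideal_of V" for a b
  proof (rule ccontr)
    assume "a \<notin> V"
    define c where "c = inverse a"
    have c: "c \<in> maximal_ideal_of V" "c \<in> V"
      using inverse_in_maximal_ideal[OF F V a \<open>a \<notin> V\<close>] maximal_ideal_subset[OF F V] by (auto simp: c_def)
    have a0: "a \<noteq> 0"
      using \<open>a \<notin> V\<close> subring_0[OF VR] by auto
    have "1 - c \<notin> maximal_ideal_of V"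
      using madd[OF _ c(1), of "1 - c"] maximal_ideal_1[OF F V] by auto
    then have inv: "inverse (1 - c) \<in> V"
      by (rule valuation_ring_unit[OF F V subring_diff[OF VR subring_1[OF VR] c(2)]])
    have inv0: "1 - c \<noteq> 0"
      using \<open>1 - c \<notin> maximal_ideal_of V\<close> maximal_ideal_0[OF F V] by metis
    have "b * (b - 1) * (1 - c) = (a * (a - 1) * (b * (b - 1))) * (c * c)"
      using a0 by (simp add: c_def field_simps)
    then have "b * (b - 1) * (1 - c) = \<kappa>\<^sup>2 * (c * c)"
      by (simp only: e)
    then have "b * (b - 1) = \<kappa>\<^sup>2 * (c * c) / (1 - c)"
      using inv0 by (metis nonzero_eq_divide_eq)
    then have "b * (b - 1) = c * (c * \<kappa>\<^sup>2 * inverse (1 - c))"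
      by (simp add: divide_inverse mult_ac)
    moreover have "c * \<kappa>\<^sup>2 * inverse (1 - c) \<in> V"
      using c(2) \<kappa>V inv by (intro subring_mult[OF VR])
    ultimately have bm: "b * (b - 1) \<in> maximal_ideal_of V"
      using mult[OF c(1)] by simp
    then have bV: "b \<in> V"
      using valuation_ring_integral[OF F V b] maximal_ideal_subset[OF F V] by blast
    show False
      using double_minus_one_imp_product_unit[OF F V bV fb[OF bV]] bm by blast
  qed
  have "b * (b - 1) * (a * (a - 1)) = \<kappa>\<^sup>2"
    using ab(3) by (simp add: mult_ac)
  then have aV: "a \<in> V" and bV: "b \<in> V"
    using finite_a[OF ab fb] finite_a[OF ab(2,1) _ fa] by auto
  have "(2 * a - 1) * (2 * a - 1) \<in> maximal_ideal_of V" "(2 * b - 1) * (2 * b - 1) \<in> maximal_ideal_of V"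
    "((2 * a - 1) * (2 * a - 1)) * ((2 * b - 1) * (2 * b - 1)) \<in> maximal_ideal_of V"
    using fa[OF aV] fb[OF bV] maximal_ideal_subset[OF F V] mult by blast+
  then have "((2 * a - 1) * (2 * a - 1)) * ((2 * b - 1) * (2 * b - 1)) - (2 * a - 1) * (2 * a - 1)
      - (2 * b - 1) * (2 * b - 1) \<in> maximal_ideal_of V"
    using mdiff by blast
  \<comment> \<open>With \<open>A = (2 * a - 1)\<^sup>2 = 1 + 4 * a * (a - 1)\<close> and
    \<open>C\<close> the same for \<open>b\<close>, this is
    \<open>A * C - A - C = (A - 1) * (C - 1) - 1\<close>.\<close>
  also have "((2 * a - 1) * (2 * a - 1)) * ((2 * b - 1) * (2 * b - 1)) - (2 * a - 1) * (2 * a - 1)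
      - (2 * b - 1) * (2 * b - 1) = 16 * (a * (a - 1) * (b * (b - 1))) - 1"
    by (simp add: algebra_simps)
  finally have "16 * \<kappa>\<^sup>2 - 1 \<in> maximal_ideal_of V"
    by (simp add: ab(3))
  moreover have "inverse (16 * \<kappa>\<^sup>2 - 1) \<in> k"
    using \<kappa>(1) by (intro k_intros)
  ultimately show False
    using \<kappa>_nonsingular kV by (auto simp: maximal_ideal_of_def)
qed

text \<open>The residue field is \<open>k\<close>, which \<open>\<sigma>\<close> fixes; so the
  decomposition group is its own inertia group.\<close>

lemma decomposition_group_residue:
  assumes V: "valuation_ring tower_field V" and kV: "k \<subseteq> V"
    and residue: "\<And>v. v \<in> V \<Longrightarrow> \<exists>c\<in>k. v - c \<in> maximal_ideal_of V"
    and \<sigma>: "\<sigma> \<in> decomposition_group L tower_field V" and v: "v \<in> V"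
  shows "\<sigma> v - v \<in> maximal_ideal_of V"
proof -
  note F = tower_field_is_subfield
  have G: "\<sigma> \<in> galois_group L tower_field"
    using \<sigma> by (simp add: decomposition_group_def)
  obtain c where c: "c \<in> k" "v - c \<in> maximal_ideal_of V"
    using residue[OF v] by blast
  have "v \<in> tower_field" "c \<in> tower_field"
    using v c kV valuation_ring_subset[OF F V] by auto
  moreover have "\<sigma> c = c"
    using G c(1) k_subset by (auto simp: galois_group_def)
  ultimately have "\<sigma> (v - c) = \<sigma> v - c"
    using galois_group_simps(3)[OF F G] by metis
  then have "\<sigma> v - c \<in> maximal_ideal_of V"
    using decomposition_group_maximal_ideal[OF F V \<sigma> c(2)] by simp
  from maximal_ideal_diff[OF F V this c(2)] show ?thesis
    by simp
qed

lemma galois_group_isogeny: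
  assumes \<sigma>: "\<sigma> \<in> galois_group L tower_field" and rq: "(r, q) \<in> points" and uv: "isogeny \<kappa> u v r q"
  shows "isogeny \<kappa> (\<sigma> u) (\<sigma> v) (\<sigma> r) (\<sigma> q)"
    and "\<sigma> u * (\<sigma> u - 1) * (\<sigma> v * (\<sigma> v - 1)) = \<kappa>\<^sup>2"
proof -
  note F = tower_field_is_subfield
  note hom = galois_group_simps[OF F \<sigma>]
  have fixed: "\<sigma> c = c" if "c \<in> k" for c
    using \<sigma> that k_subset by (auto simp: galois_group_def)
  have "(u, v) \<in> points"
    using rq uv by (rule tower_points.step)
  then have mem: "u \<in> tower_field" "v \<in> tower_field" "r \<in> tower_field" "q \<in> tower_field" "\<kappa> \<in> tower_field"
    and curve: "u * (u - 1) * (v * (v - 1)) = \<kappa>\<^sup>2"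
    using points_in_tower_field rq points_props \<kappa>(1) k_subset L_subset_tower_field by blast+
  note I = subfield_intros[OF F]
  have num: "2 \<in> tower_field" "4 \<in> tower_field" "1 \<in> tower_field"
    by (intro I)+
  have s: "\<sigma> 2 = 2" "\<sigma> 4 = 4" "\<sigma> 1 = 1" "\<sigma> \<kappa> = \<kappa>" "\<sigma> (\<kappa> * \<kappa>) = \<kappa> * \<kappa>"
    using \<kappa>(1) by (auto intro!: fixed k_intros)
  have e: "\<sigma> (u * (u - 1) * (r - 1)) = \<sigma> (\<kappa> * r)" "\<sigma> (v * (2 * u - 1)) = \<sigma> ((1 + 4 * \<kappa>) * q - 2 * \<kappa> + u - 1)"
    "\<sigma> (u * (u - 1) * (v * (v - 1))) = \<sigma> (\<kappa> * \<kappa>)"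
    using uv curve by (simp_all add: isogeny_def power2_eq_square)
  show "isogeny \<kappa> (\<sigma> u) (\<sigma> v) (\<sigma> r) (\<sigma> q)" "\<sigma> u * (\<sigma> u - 1) * (\<sigma> v * (\<sigma> v - 1)) = \<kappa>\<^sup>2"
    using e mem num by (simp_all add: isogeny_def hom(1-3) s power2_eq_square I(3,4,6))
qed

text \<open>Where \<open>\<sigma>\<close> and \<open>\<tau>\<close> agree on a point but not on one
  above it, they differ there by the reflection. Both act trivially on residues, so the image point
  would reduce to a fixed point of the reflection, against
  \<open>reflected_curve_point_singular\<close>.\<close>

lemma decomposition_group_agree:
  assumes V: "valuation_ring tower_field V" and kV: "k \<subseteq> V"
    and residue: "\<And>v. v \<in> V \<Longrightarrow> \<exists>c\<in>k. v - c \<in> maximal_ideal_of V"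
    and \<sigma>: "\<sigma> \<in> decomposition_group L tower_field V" and \<tau>: "\<tau> \<in> decomposition_group L tower_field V"
    and agree: "\<sigma> s = \<tau> s"
  shows "\<sigma> = \<tau>"
proof -
  note F = tower_field_is_subfield
  have G: "\<sigma> \<in> galois_group L tower_field" "\<tau> \<in> galois_group L tower_field"
    and im: "\<sigma> ` V = V" "\<tau> ` V = V"
    using \<sigma> \<tau> by (auto simp: decomposition_group_def)
  have fixed: "\<sigma> z = z" "\<tau> z = z" if "z \<in> L" for z
    using G that by (auto simp: galois_group_def)
  have pts: "\<sigma> r = \<tau> r \<and> \<sigma> q = \<tau> q" if "(r, q) \<in> points" for r q
    using that
  proof (induction rule: tower_points.induct)
    case base
    then show ?case
      using fixed x(1) agree by simp
  next
    case (step r q u v)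
    have iso: "isogeny \<kappa> (\<sigma> u) (\<sigma> v) (\<sigma> r) (\<sigma> q)" "isogeny \<kappa> (\<tau> u) (\<tau> v) (\<sigma> r) (\<sigma> q)"
      and curve: "\<sigma> u * (\<sigma> u - 1) * (\<sigma> v * (\<sigma> v - 1)) = \<kappa>\<^sup>2"
      using galois_group_isogeny[OF G(1) step.hyps] galois_group_isogeny[OF G(2) step.hyps] step.IH by auto
    have "(u, v) \<in> points"
      using step.hyps by (rule tower_points.step)
    then have uv: "u \<in> tower_field" "v \<in> tower_field"
      using points_in_tower_field by auto
    have r: "r \<notin> k" "r \<in> tower_field"
      using points_props points_in_tower_field step.hyps(1) by blast+
    have "\<sigma> r \<notin> k"
    proof
      assume *: "\<sigma> r \<in> k"
      then have "\<sigma> (\<sigma> r) = \<sigma> r"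
        using fixed k_subset by blast
      then have "\<sigma> r = r"
        using galois_group_simps(8)[OF F G(1), of "\<sigma> r" r] galois_group_simps(4)[OF F G(1) r(2) r(2)] r(2) by simp
      then show False
        using * r(1) by simp
    qed
    from isogeny_fibre[OF this iso] show ?case
    proof
      assume "\<tau> u = 1 - \<sigma> u \<and> \<tau> v = 1 - \<sigma> v"
      then have refl: "\<tau> u = 1 - \<sigma> u" "\<tau> v = 1 - \<sigma> v"
        by auto
      have *: "2 * \<sigma> w - 1 \<in> maximal_ideal_of V"
        if w: "w \<in> tower_field" "\<sigma> w \<in> V" "\<tau> w = 1 - \<sigma> w" for w
      proof -
        obtain w' where w': "w' \<in> V" "\<sigma> w = \<sigma> w'"
          using w(2) im(1) by blast
        then have "w \<in> V"
          using galois_group_simps(8)[OF F G(1) w(1), of w'] valuation_ring_subset[OF F V] by auto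
        then have "(\<sigma> w - w) - (\<tau> w - w) \<in> maximal_ideal_of V"
          using decomposition_group_residue[OF V kV residue] \<sigma> \<tau>
          by (intro maximal_ideal_diff[OF F V, of "\<sigma> w - w" "\<tau> w - w"]) auto
        then show ?thesis
          by (simp add: w(3) algebra_simps)
      qed
      have False
        using reflected_curve_point_singular[OF V kV _ _ curve] galois_group_simps(4)[OF F G(1)] uv *[OF uv(1)] *[OF uv(2)] refl
        by blast
      then show ?thesis ..
    qed auto
  qed
  have S: "is_subfield {z \<in> tower_field. \<sigma> z = \<tau> z}"
    unfolding is_subfield_def
  proof (intro conjI ballI)
    show "1 \<in> {z \<in> tower_field. \<sigma> z = \<tau> z}"
      using fixed subfield_intros(2)[OF L] subfield_intros(2)[OF F] by simp
    fix a assume "a \<in> {z \<in> tower_field. \<sigma> z = \<tau> z}"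
    then have a: "a \<in> tower_field" "\<sigma> a = \<tau> a"
      by auto
    show "inverse a \<in> {z \<in> tower_field. \<sigma> z = \<tau> z}"
      using galois_group_simps(7)[OF F G(1) a(1) a(1)] galois_group_simps(7)[OF F G(2) a(1) a(1)]
        subfield_inverse[OF F a(1)] a(2) by simp
    fix b assume "b \<in> {z \<in> tower_field. \<sigma> z = \<tau> z}"
    then have b: "b \<in> tower_field" "\<sigma> b = \<tau> b"
      by auto
    show "a - b \<in> {z \<in> tower_field. \<sigma> z = \<tau> z}" "a * b \<in> {z \<in> tower_field. \<sigma> z = \<tau> z}"
      using galois_group_simps(2,3)[OF F G(1) a(1) b(1)] galois_group_simps(2,3)[OF F G(2) a(1) b(1)]
        subfield_intros(3,4)[OF F a(1) b(1)] a b by simp_all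
  qed
  have "generated_subfield (L \<union> (fst ` points \<union> snd ` points)) \<subseteq> {z \<in> tower_field. \<sigma> z = \<tau> z}"
    using fixed pts points_in_tower_field L_subset_tower_field
    by (intro generated_subfield_least S) auto
  then have "\<sigma> z = \<tau> z" if "z \<in> tower_field" for z
    using that[unfolded tower_field_def] by blast
  moreover have "\<sigma> \<in> extensional tower_field" "\<tau> \<in> extensional tower_field"
    using G by (auto simp: galois_group_def)
  ultimately show ?thesis
    by (meson extensionalityI)
qed

lemma galois_group_conjugate_s:
  assumes "\<sigma> \<in> galois_group L tower_field"
  shows "\<sigma> s = s \<or> \<sigma> s = 1 - s"
proof -
  note F = tower_field_is_subfield
  note hom = galois_group_simps[OF F assms]
  have s: "s \<in> tower_field"
    using points_in_tower_field[OF tower_points.base] by simp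
  have one: "1 \<in> tower_field"
    by (rule subfield_intros(2)[OF F])
  have "\<sigma> (s * (s - 1)) = s * (s - 1)"
    using assms quadratic_over_L by (auto simp: galois_group_def)
  then have "\<sigma> s * (\<sigma> s - 1) = s * (s - 1)"
    using hom(2)[OF s subfield_intros(3)[OF F s one]] hom(3)[OF s one] hom(6)[OF s s] by simp
  then have "(\<sigma> s - s) * (\<sigma> s + s - 1) = 0"
    by (simp add: algebra_simps)
  then have "\<sigma> s - s = 0 \<or> \<sigma> s + s - 1 = 0"
    by (metis mult_eq_0_iff)
  then show ?thesis
    by (auto simp: eq_diff_eq)
qed

text \<open>An element of the group is determined by its value at \<open>s\<close>, for which there
  are at most two candidates.\<close>

lemma decomposition_group_card:
  assumes V: "valuation_ring tower_field V" and kV: "k \<subseteq> V"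
    and residue: "\<And>v. v \<in> V \<Longrightarrow> \<exists>c\<in>k. v - c \<in> maximal_ideal_of V"
  shows "finite (decomposition_group L tower_field V) \<and> card (decomposition_group L tower_field V) \<le> 2"
proof -
  let ?D = "decomposition_group L tower_field V"
  have inj: "inj_on (\<lambda>\<sigma>. \<sigma> s) ?D"
    using decomposition_group_agree[OF V kV residue] by (auto simp: inj_on_def)
  have sub: "(\<lambda>\<sigma>. \<sigma> s) ` ?D \<subseteq> {s, 1 - s}"
    using galois_group_conjugate_s by (auto simp: decomposition_group_def)
  have "card ?D \<le> card {s, 1 - s}"
    using card_inj_on_le[OF inj sub] by simp
  also have "\<dots> \<le> 2"
    by (simp add: card_insert_if)
  finally show ?thesis
    using inj sub by (meson finite.emptyI finite.insertI inj_on_finite)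
qed

text \<open>The finite branch values of the double cover by \<open>s\<close>: the zeros of
  \<open>c * (c - 1)\<close>, where \<open>s\<close> has a pole, and those of the discriminant
  \<open>1 + 4 * \<kappa>\<^sup>2 / (c * (c - 1))\<close>, cleared of its denominator.\<close>

definition "branch_values = {c \<in> k. c * (c - 1) * (c * (c - 1) + 4 * \<kappa>\<^sup>2) = 0}"

lemma finite_branch_values: "finite branch_values"
proof -
  have "finite {c. poly ([:0, -1, 1:] * [:4 * \<kappa>\<^sup>2, -1, 1:]) c = 0}"
    by (rule poly_roots_finite) auto
  moreover have "branch_values \<subseteq> {c. poly ([:0, -1, 1:] * [:4 * \<kappa>\<^sup>2, -1, 1:]) c = 0}"
    by (auto simp: branch_values_def algebra_simps)
  ultimately show ?thesis
    by (rule rev_finite_subset)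
qed

text \<open>A nontrivial element cannot fix \<open>s\<close>, for it would agree with the identity;
  so it sends \<open>s\<close> to \<open>1 - s\<close>. If \<open>x\<close> reduces to a
  \<open>c\<close> that is no branch value, then \<open>s\<close> is finite and its two conjugates
  reduce to different values, although the element acts trivially on residues.\<close>

lemma inertia_branch_value:
  assumes V: "valuation_ring tower_field V" and kV: "k \<subseteq> V"
    and residue: "\<And>v. v \<in> V \<Longrightarrow> \<exists>c\<in>k. v - c \<in> maximal_ideal_of V"
    and \<sigma>: "\<sigma> \<in> decomposition_group L tower_field V" and nontriv: "\<exists>z\<in>tower_field. \<sigma> z \<noteq> z"
  shows "inverse x \<in> maximal_ideal_of V \<or> (\<exists>c\<in>branch_values. x - c \<in> maximal_ideal_of V)"
proof (cases "x \<in> V")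
  case False
  then show ?thesis
    using inverse_in_maximal_ideal[OF tower_field_is_subfield V] x(1) L_subset_tower_field by blast
next
  case xV: True
  note F = tower_field_is_subfield
  note VR = valuation_ring_is_subring[OF F V]
  note mult = maximal_ideal_mult[OF F V] and mdiff = maximal_ideal_diff[OF F V]
    and madd = maximal_ideal_add[OF F V]
  \<comment> \<open>The identity in the form that \<open>galois_group\<close> prescribes, with the
    default value outside \<open>tower_field\<close>.\<close>
  define e where "e = restrict id tower_field"
  have "e \<in> galois_group L tower_field"
    using L_subset_tower_field subfield_intros[OF F]
    by (auto simp: galois_group_def e_def bij_betw_def inj_on_def)
  moreover have "e ` V = V"
    using valuation_ring_subset[OF F V] by (force simp: e_def)
  ultimately have e: "e \<in> decomposition_group L tower_field V"
    by (simp add: decomposition_group_def)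
  have sF: "s \<in> tower_field"
    using points_in_tower_field[OF tower_points.base] by simp
  have "\<sigma> s \<noteq> s"
    using decomposition_group_agree[OF V kV residue \<sigma> e] nontriv sF by (auto simp: e_def)
  then have \<sigma>s: "\<sigma> s = 1 - s"
    using galois_group_conjugate_s \<sigma> by (auto simp: decomposition_group_def)
  obtain c where c: "c \<in> k" "x - c \<in> maximal_ideal_of V"
    using residue[OF xV] by blast
  have cV: "c \<in> V"
    using c(1) kV by blast
  have unit: "d \<notin> maximal_ideal_of V" if "d \<in> k" "d \<noteq> 0" for d
    using that kV k_intros(11)[OF that(1)] by (auto simp: maximal_ideal_of_def)
  have "c \<in> branch_values"
  proof (rule ccontr)
    assume "c \<notin> branch_values"
    then have nz: "c * (c - 1) \<noteq> 0" "c * (c - 1) + 4 * \<kappa>\<^sup>2 \<noteq> 0"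
      using c(1) by (auto simp: branch_values_def)
    have diff: "x * (x - 1) - c * (c - 1) \<in> maximal_ideal_of V"
    proof -
      have "x * (x - 1) - c * (c - 1) = (x - c) * (x + c - 1)"
        by (simp add: algebra_simps)
      then show ?thesis
        using mult[OF c(2), of "x + c - 1"] xV cV by (auto intro: subring_intros[OF VR])
    qed
    have xx: "x * (x - 1) \<in> V"
      using xV by (intro subring_intros[OF VR])
    have "x * (x - 1) \<notin> maximal_ideal_of V"
    proof
      assume "x * (x - 1) \<in> maximal_ideal_of V"
      from mdiff[OF this diff] show False
        using unit[of "c * (c - 1)"] nz(1) c(1) by (auto intro: k_intros)
    qed
    then have inv: "inverse (x * (x - 1)) \<in> V"
      using valuation_ring_unit[OF F V xx] by blast
    have "s * (s - 1) = \<kappa>\<^sup>2 * inverse (x * (x - 1))"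
      by (simp add: s_eq divide_inverse)
    then have "s * (s - 1) \<in> V"
      using inv \<kappa>(1) kV by (auto intro!: subring_mult[OF VR] subring_power[OF VR])
    then have sV: "s \<in> V"
      by (rule valuation_ring_integral[OF F V sF])
    have "\<sigma> s - s \<in> maximal_ideal_of V"
      by (rule decomposition_group_residue[OF V kV residue \<sigma> sV])
    then have "(\<sigma> s - s) * (\<sigma> s - s) * (x * (x - 1)) \<in> maximal_ideal_of V"
      using maximal_ideal_subset[OF F V] xx mult by blast
    moreover have "(\<sigma> s - s) * (\<sigma> s - s) * (x * (x - 1)) = x * (x - 1) + 4 * (x * (x - 1) * (s * (s - 1)))"
      by (simp add: \<sigma>s algebra_simps)
    ultimately have "x * (x - 1) + 4 * \<kappa>\<^sup>2 \<in> maximal_ideal_of V"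
      by (simp add: s)
    from mdiff[OF this diff] have "c * (c - 1) + 4 * \<kappa>\<^sup>2 \<in> maximal_ideal_of V"
      by (simp add: algebra_simps)
    moreover have "c * (c - 1) + 4 * \<kappa>\<^sup>2 \<in> k"
      using c(1) \<kappa>(1) by (intro k_intros)
    ultimately show False
      using unit nz(2) by blast
  qed
  then show ?thesis
    using c(2) by blast
qed

end


section \<open>Residue fields over an algebraically closed field\<close>

text \<open>Provides an element of least valuation; dividing a relation by such a coefficient makes
  all coefficients integral and one of them equal to 1.\<close>

lemma valuation_ring_max:
  assumes F: "is_subfield F" and V: "valuation_ring F V"
    and A: "finite A" "A \<noteq> {}" "A \<subseteq> F" "0 \<notin> A"
  shows "\<exists>a\<in>A. \<forall>b\<in>A. b / a \<in> V"
  using A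
proof (induction A rule: finite_ne_induct)
  case (singleton a)
  then show ?case
    using subring_1[OF valuation_ring_is_subring[OF F V]] by auto
next
  case (insert b A)
  note VR = valuation_ring_is_subring[OF F V]
  obtain a where a: "a \<in> A" "\<And>c. c \<in> A \<Longrightarrow> c / a \<in> V"
    using insert by auto
  have "b / a \<in> F"
    using a insert.prems by (auto intro: subfield_intros[OF F])
  then consider "b / a \<in> V" | "a / b \<in> V"
    using valuation_ring_cases[OF F V, of "b / a"] by auto
  then show ?case
  proof cases
    case 1
    then show ?thesis
      using a by auto
  next
    case 2
    have "c / b \<in> V" if "c \<in> A" for c
    proof -
      have "a \<noteq> 0"
        using a(1) insert.prems by auto
      then have "c / b = (c / a) * (a / b)"
        by simp
      then show ?thesis
        using subring_mult[OF VR a(2)[OF that] 2] by (simp only:)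
    qed
    moreover have "b / b \<in> V"
      using insert.prems subring_1[OF VR] by simp
    ultimately show ?thesis
      by blast
  qed
qed

text \<open>Split \<open>q\<close> into linear factors over \<open>k\<close>; since the maximal
  ideal is prime, it contains the value of one of them at \<open>v\<close>.\<close>

lemma residue_of_root:
  fixes k :: "'a::field set"
  assumes F: "is_subfield F" and V: "valuation_ring F V" and k: "is_subfield k" "k \<subseteq> V"
    and closed: "\<And>p. poly_over k p \<Longrightarrow> degree p > 0 \<Longrightarrow> \<exists>c\<in>k. poly p c = 0"
    and q: "poly_over k q" "q \<noteq> 0" "poly q v \<in> maximal_ideal_of V" and v: "v \<in> V"
  shows "\<exists>c\<in>k. v - c \<in> maximal_ideal_of V"
  using q
proof (induction "degree q" arbitrary: q rule: less_induct)
  case less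
  note VR = valuation_ring_is_subring[OF F V]
  show ?case
  proof (cases "degree q = 0")
    case True
    then obtain d where d: "q = [:d:]"
      by (metis degree_eq_zeroE)
    then have "d \<in> k" "d \<noteq> 0" "d \<in> maximal_ideal_of V"
      using less.prems by (auto simp: poly_over_def dest: spec[of _ 0])
    then show ?thesis
      using k subfield_inverse[OF k(1)] by (auto simp: maximal_ideal_of_def)
  next
    case False
    then obtain c a b where *: "c \<in> k" "a \<in> k" "poly_over k b" "b \<noteq> 0" "degree b < degree q"
      "smult a q = [:- c, 1:] * b"
      using closed_subfield_factor[OF k(1) closed less.prems(1)] by blast
    have "a * poly q v \<in> maximal_ideal_of V"
      using maximal_ideal_mult[OF F V less.prems(3)] *(2) k(2) by (auto simp: mult.commute)
    moreover have "a * poly q v = (v - c) * poly b v"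
      using arg_cong[OF *(6), of "\<lambda>p. poly p v"] by (simp add: algebra_simps)
    moreover have "v - c \<in> V" "poly b v \<in> V"
      using v *(1) k(2) poly_in_subring[OF VR poly_over_mono[OF *(3) k(2)] v] by (auto intro: subring_diff[OF VR])
    ultimately have "v - c \<in> maximal_ideal_of V \<or> poly b v \<in> maximal_ideal_of V"
      using maximal_ideal_prime[OF F V] by metis
    then show ?thesis
      using less.hyps[OF *(5,3,4)] *(1) by blast
  qed
qed

text \<open>Algebraic extensions do not enlarge the residue field \<open>k\<close>. Divide an
  equation of \<open>v\<close> by a coefficient of least valuation; its reduction is a nonzero
  polynomial over \<open>k\<close> to which \<open>residue_of_root\<close> applies.\<close>

lemma residue_of_algebraic:
  fixes k :: "'a::field set"
  assumes F: "is_subfield F" and V: "valuation_ring F V" and k: "is_subfield k" "k \<subseteq> V"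
    and closed: "\<And>p. poly_over k p \<Longrightarrow> degree p > 0 \<Longrightarrow> \<exists>c\<in>k. poly p c = 0"
    and L: "is_subfield L" "L \<subseteq> F" and residue: "\<And>a. a \<in> V \<inter> L \<Longrightarrow> \<exists>c\<in>k. a - c \<in> maximal_ideal_of V"
    and v: "v \<in> V" "algebraic_over L v"
  shows "\<exists>c\<in>k. v - c \<in> maximal_ideal_of V"
proof -
  note VR = valuation_ring_is_subring[OF F V]
  obtain p where p: "p \<noteq> 0" "poly_over L p" "poly p v = 0"
    using v(2) by (auto simp: algebraic_over_def)
  have "\<exists>a\<in>coeff p ` {i. i \<le> degree p \<and> coeff p i \<noteq> 0}.
      \<forall>b\<in>coeff p ` {i. i \<le> degree p \<and> coeff p i \<noteq> 0}. b / a \<in> V"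
    using p(1,2) L(2) by (intro valuation_ring_max[OF F V]) (auto simp: poly_over_def)
  then obtain i where i: "coeff p i \<noteq> 0" "i \<le> degree p"
    "\<And>j. j \<le> degree p \<Longrightarrow> coeff p j \<noteq> 0 \<Longrightarrow> coeff p j / coeff p i \<in> V"
    by auto
  define b where "b j = coeff p j / coeff p i" for j
  have b: "b j \<in> V \<inter> L" for j
  proof -
    have "b j \<in> V"
      using i(3)[of j] subring_0[OF VR] by (cases "coeff p j = 0") (auto simp: b_def intro: le_degree)
    moreover have "b j \<in> L"
      using p(2) by (auto simp: b_def poly_over_def intro: subfield_intros[OF L(1)])
    ultimately show ?thesis
      by blast
  qed
  obtain c where c: "\<And>j. c j \<in> k" "\<And>j. b j - c j \<in> maximal_ideal_of V"
    using residue[OF b] by metis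
  define q where "q = (\<Sum>j\<le>degree p. monom (c j) j)"
  have co: "coeff q j = (if j \<le> degree p then c j else 0)" for j
    by (simp add: q_def coeff_sum)
  have "b i = 1"
    using i by (simp add: b_def)
  then have "c i \<noteq> 0"
    using c(2)[of i] maximal_ideal_1[OF F V] by auto
  then have "q \<noteq> 0"
    using co[of i] i(2) by auto
  moreover have "poly_over k q"
    using c(1) subfield_intros(1)[OF k(1)] by (simp add: poly_over_def co)
  moreover have "poly q v \<in> maximal_ideal_of V"
  proof -
    have "(\<Sum>j\<le>degree p. b j * v ^ j) = poly p v / coeff p i"
      by (simp add: b_def poly_altdef sum_divide_distrib)
    then have "poly q v = (\<Sum>j\<le>degree p. - ((b j - c j) * v ^ j))"
      using p(3) by (simp add: q_def poly_sum poly_monom left_diff_distrib sum_subtractf sum_negf)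
    also have "\<dots> \<in> maximal_ideal_of V"
      using c(2) v(1) subring_power[OF VR]
      by (intro maximal_ideal_sum[OF F V] maximal_ideal_uminus[OF F V] maximal_ideal_mult[OF F V]) auto
    finally show ?thesis .
  qed
  ultimately show ?thesis
    using residue_of_root[OF F V k closed _ _ _ v(1)] by blast
qed


section \<open>Extending homomorphisms to finitely generated algebras\<close>

lemma Domain_adjoin:
  assumes "partial_hom G"
  shows "Domain {(poly p z, poly q w) | p q. poly_pair G p q} = adjoin_ring (Domain G) z"
proof -
  have "poly_over (Domain G) p" if "poly_pair G p q" for p q
    using that by (auto simp: poly_over_def poly_pair_def)
  moreover have "\<exists>q. poly_pair G p q" if "poly_over (Domain G) p" for p
    using poly_pair_lift'[OF assms that] .
  ultimately show ?thesis
    unfolding adjoin_ring_def by (intro set_eqI) (simp add: Domain_iff, blast)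
qed

lemma partial_hom_restrict:
  assumes "partial_hom G" "is_subring A"
  shows "partial_hom (G \<inter> A \<times> UNIV)"
  unfolding partial_hom_def
proof (intro conjI allI impI)
  show "(1, 1) \<in> G \<inter> A \<times> UNIV"
    using partial_hom_1[OF assms(1)] subring_1[OF assms(2)] by simp
  show "b = 0" if "(0, b) \<in> G \<inter> A \<times> UNIV" for b
    using partial_hom_zero[OF assms(1)] that by simp
  fix a b c d assume "(a, b) \<in> G \<inter> A \<times> UNIV" "(c, d) \<in> G \<inter> A \<times> UNIV"
  then show "(a - c, b - d) \<in> G \<inter> A \<times> UNIV" "(a * c, b * d) \<in> G \<inter> A \<times> UNIV"
    using partial_hom_diff[OF assms(1)] partial_hom_mult[OF assms(1)]
      subring_diff[OF assms(2)] subring_mult[OF assms(2)] by auto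
qed

text \<open>A nonconstant \<open>q\<close> takes the value 1 at a root of
  \<open>q - 1\<close>.\<close>

lemma poly_nonvanishing:
  fixes q :: "'b::alg_closed_field poly"
  assumes "q \<noteq> 0"
  shows "\<exists>w. poly q w \<noteq> 0"
proof (rule ccontr)
  assume *: "\<not> ?thesis"
  have "degree (q - 1) > 0"
  proof (rule ccontr)
    assume "\<not> degree (q - 1) > 0"
    then obtain d where "q - 1 = [:d:]"
      by (metis degree_eq_zeroE neq0_conv)
    then have "q = [:d + 1:]"
      by (simp add: diff_eq_eq one_pCons)
    then show False
      using * assms by auto
  qed
  then obtain w where "poly (q - 1) w = 0"
    using alg_closed_imp_poly_has_root by blast
  then show False
    using * by simp
qed

text \<open>Dividing \<open>p\<close> by a shorter \<open>q\<close> leaves a nonzero remainder whose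
  value at \<open>z\<close> is a multiple of that of \<open>q\<close>. The degree drops until a
  constant is reached.\<close>

lemma adjoin_ring_inverse_up_to_base:
  fixes A :: "'a::field set"
  assumes A: "is_subring A" and p: "p \<noteq> 0" "poly_over A p" "poly p z = 0"
    and min: "\<And>q. q \<noteq> 0 \<Longrightarrow> poly_over A q \<Longrightarrow> poly q z = 0 \<Longrightarrow> degree p \<le> degree q"
    and q: "poly_over A q" "poly q z \<noteq> 0"
  shows "\<exists>r b. poly_over A r \<and> b \<in> A \<and> b \<noteq> 0 \<and> poly r z * poly q z = b"
proof -
  have small: "\<exists>r b. poly_over A r \<and> b \<in> A \<and> b \<noteq> 0 \<and> poly r z * poly q z = b"
    if "poly_over A q" "q \<noteq> 0" "degree q < degree p" for q
    using that
  proof (induction "degree q" arbitrary: q rule: less_induct)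
    case less
    show ?case
    proof (cases "degree q = 0")
      case True
      then obtain d where d: "q = [:d:]"
        by (metis degree_eq_zeroE)
      then have "d \<in> A" "d \<noteq> 0"
        using less.prems by (auto simp: poly_over_def dest: spec[of _ 0])
      then show ?thesis
        using d poly_over_1[OF A] by (intro exI[of _ 1] exI[of _ d]) auto
    next
      case False
      obtain c s t where *: "c \<in> A" "c \<noteq> 0" "poly_over A s" "poly_over A t"
        "smult c p = q * s + t" "t = 0 \<or> degree t < degree q"
        using pseudo_division[OF A less.prems(2,1) p(2)] by blast
      have eval: "poly q z * poly s z + poly t z = 0"
        using arg_cong[OF *(5), of "\<lambda>p. poly p z"] p(3) by simp
      have t0: "t \<noteq> 0"
      proof
        assume "t = 0"
        then have qs: "smult c p = q * s"
          using *(5) by simp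
        then have "s \<noteq> 0"
          using *(2) p(1) by auto
        have "degree p = degree (q * s)"
          using *(2) by (simp flip: qs)
        also have "\<dots> = degree q + degree s"
          using less.prems(2) \<open>s \<noteq> 0\<close> by (rule degree_mult_eq)
        finally have "degree s < degree p"
          using False by simp
        moreover have "poly q z \<noteq> 0"
          using min[OF less.prems(2,1)] less.prems(3) by auto
        then have "poly s z = 0"
          using eval \<open>t = 0\<close> by simp
        ultimately show False
          using min[OF \<open>s \<noteq> 0\<close> *(3)] by simp
      qed
      then obtain r b where r: "poly_over A r" "b \<in> A" "b \<noteq> 0" "poly r z * poly t z = b"
        using less.hyps[of t] *(4,6) less.prems(3) by auto
      have "poly t z = - (poly q z * poly s z)"
        using eval by (simp add: eq_neg_iff_add_eq_0 add.commute)
      then have "poly (0 - r * s) z * poly q z = b"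
        using r(4) by (simp add: algebra_simps)
      moreover have "poly_over A (0 - r * s)"
        by (intro poly_over_diff poly_over_mult poly_over_0 A r *)
      ultimately show ?thesis
        using r by blast
    qed
  qed
  obtain c s t where *: "c \<in> A" "c \<noteq> 0" "poly_over A s" "poly_over A t"
    "smult c q = p * s + t" "t = 0 \<or> degree t < degree p"
    using pseudo_division[OF A p(1,2) q(1)] by blast
  have t: "poly t z = c * poly q z"
    using arg_cong[OF *(5), of "\<lambda>p. poly p z"] p(3) by simp
  then have "t \<noteq> 0"
    using *(2) q(2) by auto
  then obtain r b where r: "poly_over A r" "b \<in> A" "b \<noteq> 0" "poly r z * poly t z = b"
    using small[of t] * by auto
  then show ?thesis
    using t poly_over_smult[OF A *(1) r(1)] by (intro exI[of _ "smult c r"] exI[of _ b]) (auto simp: mult_ac)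
qed

text \<open>For transcendental \<open>z\<close>, \<open>a\<close> is the leading coefficient of
  \<open>u\<close> as a polynomial in \<open>z\<close>: its image polynomial is then nonzero, and
  \<open>z\<close> is sent to a point where it does not vanish. For algebraic \<open>z\<close>,
  \<open>a\<close> has two factors: the leading coefficient of an equation, whose survival makes
  \<open>z\<close> integral, and a multiple \<open>b\<close> of \<open>u\<close> in
  \<open>A\<close>, whose survival keeps \<open>u\<close> from going to 0.\<close>

lemma partial_hom_extension_step:
  fixes A :: "'a::field set"
  assumes A: "is_subring A" and u: "u \<in> adjoin_ring A z" "u \<noteq> 0"
  shows "\<exists>a\<in>A. a \<noteq> 0 \<and> (\<forall>G :: ('a \<times> 'b::alg_closed_field) set.
    partial_hom G \<longrightarrow> Domain G = A \<longrightarrow> (a, 0) \<notin> G \<longrightarrow>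
    (\<exists>H. partial_hom H \<and> G \<subseteq> H \<and> Domain H = adjoin_ring A z \<and> (u, 0) \<notin> H))"
proof -
  obtain q where q: "poly_over A q" "u = poly q z"
    using u(1) by (auto simp: adjoin_ring_def)
  have q0: "q \<noteq> 0"
    using q u(2) by auto
  show ?thesis
  proof (cases "algebraic_over A z")
    case False
    show ?thesis
    proof (intro bexI[of _ "lead_coeff q"] conjI allI impI)
      show "lead_coeff q \<noteq> 0" "lead_coeff q \<in> A"
        using q0 q by (auto simp: poly_over_def)
      fix G :: "('a \<times> 'b) set"
      assume G: "partial_hom G" "Domain G = A" "(lead_coeff q, 0) \<notin> G"
      obtain q' where q': "poly_pair G q q'"
        using poly_pair_lift'[OF G(1)] G(2) q(1) by blast
      then have "q' \<noteq> 0"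
        using G(3) by (auto simp: poly_pair_def)
      then obtain w where w: "poly q' w \<noteq> 0"
        using poly_nonvanishing by blast
      have root: "poly p' w = 0" if "poly_pair G p p'" "poly p z = 0" for p p'
      proof -
        have "poly_over A p"
          using that(1) G(2) by (auto simp: poly_over_def poly_pair_def)
        then have "p = 0"
          using False that(2) by (auto simp: algebraic_over_def)
        then have "p' = 0"
          using that(1) partial_hom_zero[OF G(1)] by (auto simp: poly_pair_def poly_eq_iff)
        then show ?thesis
          by simp
      qed
      define H where "H = {(poly p z, poly q w) | p q. poly_pair G p q}"
      have H: "partial_hom H" "G \<subseteq> H"
        unfolding H_def by (rule partial_hom_adjoin[OF G(1) root]; assumption)+
      moreover have "Domain H = adjoin_ring A z"
        unfolding H_def Domain_adjoin[OF G(1)] G(2) ..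
      moreover have "(u, poly q' w) \<in> H"
        using q' q(2) by (auto simp: H_def)
      then have "(u, 0) \<notin> H"
        using partial_hom_unique[OF H(1)] w by blast
      ultimately show "\<exists>H. partial_hom H \<and> G \<subseteq> H \<and> Domain H = adjoin_ring A z \<and> (u, 0) \<notin> H"
        by blast
    qed
  next
    case True
    then obtain p0 where "p0 \<noteq> 0 \<and> poly_over A p0 \<and> poly p0 z = 0"
      by (auto simp: algebraic_over_def)
    from ex_has_least_nat[of "\<lambda>p. p \<noteq> 0 \<and> poly_over A p \<and> poly p z = 0", OF this, of degree]
    obtain p where p: "p \<noteq> 0" "poly_over A p" "poly p z = 0"
      and min: "\<And>q. q \<noteq> 0 \<Longrightarrow> poly_over A q \<Longrightarrow> poly q z = 0 \<Longrightarrow> degree p \<le> degree q"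
      by blast
    have "poly q z \<noteq> 0"
      using q u by simp
    then obtain r b where r: "poly_over A r" "b \<in> A" "b \<noteq> 0" "poly r z * poly q z = b"
      using adjoin_ring_inverse_up_to_base[OF A p min q(1)] by blast
    have lead: "lead_coeff p \<in> A"
      using p by (simp add: poly_over_def)
    show ?thesis
    proof (intro bexI[of _ "lead_coeff p * b"] conjI allI impI)
      show "lead_coeff p * b \<noteq> 0" "lead_coeff p * b \<in> A"
        using p r lead by (auto intro: subring_mult[OF A])
      fix G :: "('a \<times> 'b) set"
      assume G: "partial_hom G" "Domain G = A" "(lead_coeff p * b, 0) \<notin> G"
      obtain l b' where lb: "(lead_coeff p, l) \<in> G" "(b, b') \<in> G"
        using lead r(2) G(2) by blast
      then have nz: "l \<noteq> 0" "b' \<noteq> 0"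
        using partial_hom_mult[OF G(1) lb] G(3) by auto
      obtain M where M: "maximal_hom M" "G \<subseteq> M"
        using maximal_hom_exists[OF G(1)] by blast
      have MP: "partial_hom M"
        using M(1) by (simp add: maximal_hom_def)
      have AM: "A \<subseteq> Domain M"
        using M(2) G(2) by blast
      have z: "z \<in> Domain M"
      proof (rule maximal_hom_integral[OF M(1) _ p(3)])
        show "poly_over (Domain M) p"
          using poly_over_mono[OF p(2) AM] .
        show "(lead_coeff p, 0) \<notin> M"
          using lb(1) M(2) nz(1) partial_hom_unique[OF MP] by blast
      qed
      have sub: "adjoin_ring A z \<subseteq> Domain M"
        unfolding adjoin_ring_def
        using poly_in_subring[OF is_subring_Domain[OF MP] poly_over_mono[OF _ AM] z] by blast
      have "(u, 0) \<notin> M"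
      proof
        assume "(u, 0) \<in> M"
        moreover obtain r' where "(poly r z, r') \<in> M"
          using sub r(1) by (auto simp: adjoin_ring_def)
        ultimately have "(poly r z * u, r' * 0) \<in> M"
          using partial_hom_mult[OF MP] by blast
        then have "(b, 0) \<in> M"
          using r(4) q(2) by simp
        then show False
          using lb(2) M(2) nz(2) partial_hom_unique[OF MP] by blast
      qed
      \<comment> \<open>The domain of the maximal extension is cut back to exactly
        \<open>adjoin_ring A z\<close>, as the next adjunction expects.\<close>
      moreover have "Domain (M \<inter> adjoin_ring A z \<times> UNIV) = adjoin_ring A z"
        using sub by blast
      moreover have "G \<subseteq> M \<inter> adjoin_ring A z \<times> UNIV"
      proof
        fix g assume g: "g \<in> G"
        then have "fst g \<in> A"
          using G(2) by (cases g) auto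
        then show "g \<in> M \<inter> adjoin_ring A z \<times> UNIV"
          using g M(2) adjoin_ring_superset[OF A, of z] by (cases g) auto
      qed
      ultimately show "\<exists>H. partial_hom H \<and> G \<subseteq> H \<and> Domain H = adjoin_ring A z \<and> (u, 0) \<notin> H"
        using partial_hom_restrict[OF MP adjoin_ring_is_subring[OF A, of z]] by blast
    qed
  qed
qed

text \<open>The elements of \<open>Y\<close> are adjoined one at a time, and the condition
  \<open>u\<close> for the remaining ones over the larger ring is pulled back to a condition
  \<open>a\<close> over \<open>A\<close>.\<close>

lemma partial_hom_extension:
  fixes A :: "'a::field set"
  assumes "is_subring A" "finite Y"
  shows "\<exists>a\<in>A. a \<noteq> 0 \<and> (\<forall>G :: ('a \<times> 'b::alg_closed_field) set.
    partial_hom G \<longrightarrow> Domain G = A \<longrightarrow> (a, 0) \<notin> G \<longrightarrow> (\<exists>H. partial_hom H \<and> G \<subseteq> H \<and> Y \<subseteq> Domain H))"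
  using assms(2,1)
proof (induction Y arbitrary: A rule: finite_induct)
  case empty
  then show ?case
    using subring_1 by (intro bexI[of _ 1]) auto
next
  case (insert z Y)
  obtain u where u: "u \<in> adjoin_ring A z" "u \<noteq> 0"
    "\<And>G :: ('a \<times> 'b) set. partial_hom G \<Longrightarrow> Domain G = adjoin_ring A z \<Longrightarrow> (u, 0) \<notin> G \<Longrightarrow>
      (\<exists>H. partial_hom H \<and> G \<subseteq> H \<and> Y \<subseteq> Domain H)"
    using insert.IH[OF adjoin_ring_is_subring[OF insert.prems, of z]] by blast
  obtain a where a: "a \<in> A" "a \<noteq> 0"
    "\<And>G :: ('a \<times> 'b) set. partial_hom G \<Longrightarrow> Domain G = A \<Longrightarrow> (a, 0) \<notin> G \<Longrightarrow>
      (\<exists>H. partial_hom H \<and> G \<subseteq> H \<and> Domain H = adjoin_ring A z \<and> (u, 0) \<notin> H)"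
    using partial_hom_extension_step[OF insert.prems u(1,2), where 'b = 'b] by blast
  have "\<exists>H. partial_hom H \<and> G \<subseteq> H \<and> insert z Y \<subseteq> Domain H"
    if G: "partial_hom G" "Domain G = A" "(a, 0) \<notin> G" for G :: "('a \<times> 'b) set"
  proof -
    obtain H where H: "partial_hom H" "G \<subseteq> H" "Domain H = adjoin_ring A z" "(u, 0) \<notin> H"
      using a(3)[OF G] by blast
    obtain H' where H': "partial_hom H'" "H \<subseteq> H'" "Y \<subseteq> Domain H'"
      using u(3)[OF H(1,3,4)] by blast
    have "z \<in> Domain H"
      using H(3) adjoin_ring_superset[OF insert.prems] by blast
    then show ?thesis
      using H' H(2) by (intro exI[of _ H']) blast
  qed
  then show ?case
    using a(1,2) by blast
qed

lemma infinite_alg_closed_field: "infinite (UNIV :: 'b::alg_closed_field set)"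
proof
  assume fin: "finite (UNIV :: 'b set)"
  define q :: "'b poly" where "q = (\<Prod>a\<in>UNIV. [:- a, 1:])"
  have "q \<noteq> 0" "poly q w = 0" for w
    using fin by (auto simp: q_def poly_prod)
  then show False
    using poly_nonvanishing by blast
qed


section \<open>Homogeneous polynomials and generic points\<close>

lemma field_embedding_id: "field_embedding id"
  by (simp add: field_embedding_def)

lemma field_embedding_simps:
  assumes "field_embedding \<iota>"
  shows "\<iota> 1 = 1" "\<iota> 0 = 0" "\<iota> (x + y) = \<iota> x + \<iota> y" "\<iota> (x * y) = \<iota> x * \<iota> y"
    "\<iota> (- x) = - \<iota> x" "\<iota> (x - y) = \<iota> x - \<iota> y" "\<iota> (inverse x) = inverse (\<iota> x)" "\<iota> x = \<iota> y \<longleftrightarrow> x = y"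
proof -
  have *: "\<iota> 1 = 1" "\<And>x y. \<iota> (x + y) = \<iota> x + \<iota> y" "\<And>x y. \<iota> (x * y) = \<iota> x * \<iota> y"
    using assms by (auto simp: field_embedding_def)
  show 1: "\<iota> 1 = 1" "\<iota> (x + y) = \<iota> x + \<iota> y" "\<iota> (x * y) = \<iota> x * \<iota> y"
    by (rule *)+
  show 0: "\<iota> 0 = 0"
    using *(2)[of 0 0] by (metis add_0 add_left_cancel add.right_neutral)
  have neg: "\<iota> (- x) = - \<iota> x" for x
    using *(2)[of "- x" x] 0 by (simp add: eq_neg_iff_add_eq_0)
  then have diff: "\<iota> (x - y) = \<iota> x - \<iota> y" for x y
    using *(2)[of x "- y"] by simp
  have inv: "\<iota> x * \<iota> (inverse x) = 1" if "x \<noteq> 0" for x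
    using *(3)[of x "inverse x"] 1(1) that by simp
  show "\<iota> (- x) = - \<iota> x" "\<iota> (x - y) = \<iota> x - \<iota> y"
    by (rule neg diff)+
  show "\<iota> (inverse x) = inverse (\<iota> x)"
    using inv[of x] 0 by (cases "x = 0") (auto dest: inverse_unique)
  have "\<iota> (x - y) \<noteq> 0" if "x \<noteq> y"
    using inv[of "x - y"] that by auto
  then show "\<iota> x = \<iota> y \<longleftrightarrow> x = y"
    using diff by auto
qed

lemma range_embedding_is_subfield:
  assumes "field_embedding \<iota>"
  shows "is_subfield (range \<iota>)"
  unfolding is_subfield_def
proof (intro conjI ballI)
  note simps = field_embedding_simps[OF assms]
  show "1 \<in> range \<iota>"
    using rangeI[of \<iota> 1] simps(1) by simp
  fix a b assume "a \<in> range \<iota>" "b \<in> range \<iota>"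
  then obtain c d where "a = \<iota> c" "b = \<iota> d"
    by blast
  then show "a - b \<in> range \<iota>" "a * b \<in> range \<iota>"
    by (simp_all flip: simps(4,6))
next
  fix a assume "a \<in> range \<iota>"
  then show "inverse a \<in> range \<iota>"
    by (auto simp flip: field_embedding_simps(7)[OF assms])
qed

text \<open>The inverse of \<open>\<iota>\<close> on its image; it carries polynomials over the
  image back to the algebraically closed type.\<close>

definition embedding_graph :: "('k::field \<Rightarrow> 'a::field) \<Rightarrow> ('a \<times> 'k) set" where
  "embedding_graph \<iota> = {(a, c). a = \<iota> c}"

lemma embedding_graph_partial_hom:
  assumes "field_embedding \<iota>"
  shows "partial_hom (embedding_graph \<iota>)"
  unfolding partial_hom_def embedding_graph_def
  using field_embedding_simps[OF assms] by (auto, metis)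

lemma range_embedding_closed:
  fixes \<iota> :: "'k::alg_closed_field \<Rightarrow> 'a::field"
  assumes \<iota>: "field_embedding \<iota>" and p: "poly_over (range \<iota>) p" "degree p > 0"
  shows "\<exists>c\<in>range \<iota>. poly p c = 0"
proof -
  note G = embedding_graph_partial_hom[OF \<iota>]
  have "Domain (embedding_graph \<iota>) = range \<iota>"
    by (auto simp: embedding_graph_def Domain_iff)
  then obtain q where q: "poly_pair (embedding_graph \<iota>) p q"
    using poly_pair_lift'[OF G] p(1) by metis
  then have co: "coeff p i = \<iota> (coeff q i)" for i
    by (auto simp: poly_pair_def embedding_graph_def)
  have "coeff q (degree p) \<noteq> 0"
    using p(2) co[of "degree p"] field_embedding_simps(2)[OF \<iota>] by auto
  then have "degree q > 0"
    using p(2) le_degree[of q "degree p"] by simp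
  then obtain c where c: "poly q c = 0"
    using alg_closed_imp_poly_has_root by blast
  have "(poly p (\<iota> c), poly q c) \<in> embedding_graph \<iota>"
    by (rule poly_pair_eval[OF G q]) (auto simp: embedding_graph_def)
  then have "poly p (\<iota> c) = \<iota> 0"
    using c by (auto simp: embedding_graph_def)
  then show ?thesis
    using field_embedding_simps(2)[OF \<iota>] by auto
qed

lemma eval_at_pair:
  assumes G: "partial_hom G" and c: "\<And>c. (\<iota> c, \<iota>' c) \<in> G" and x: "\<And>i. (x $ i, y $ i) \<in> G"
  shows "(eval_at \<iota> f x, eval_at \<iota>' f y) \<in> G"
  unfolding eval_at_def by (intro partial_hom_intros[OF G] c x)

context
  fixes \<iota> :: "'k::field \<Rightarrow> 'a::field" and x :: "'a ^ 'n::finite"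
  assumes \<iota>: "field_embedding \<iota>"
begin

lemma eval_at_superset:
  assumes "finite S" "Poly_Mapping.keys f \<subseteq> S"
  shows "eval_at \<iota> f x = (\<Sum>m\<in>S. \<iota> (Poly_Mapping.lookup f m) * (\<Prod>i\<in>UNIV. (x $ i) ^ Poly_Mapping.lookup m i))"
  unfolding eval_at_def using assms
  by (intro sum.mono_neutral_left) (auto simp: in_keys_iff field_embedding_simps[OF \<iota>])

lemma eval_at_add: "eval_at \<iota> (f + g) x = eval_at \<iota> f x + eval_at \<iota> g x"
proof -
  define S where "S = Poly_Mapping.keys f \<union> Poly_Mapping.keys g"
  have "finite S" "Poly_Mapping.keys f \<subseteq> S" "Poly_Mapping.keys g \<subseteq> S" "Poly_Mapping.keys (f + g) \<subseteq> S"
    using keys_add[of f g] by (auto simp: S_def)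
  then show ?thesis
    by (simp add: eval_at_superset lookup_add field_embedding_simps[OF \<iota>] distrib_right sum.distrib)
qed

lemma eval_at_diff: "eval_at \<iota> (f - g) x = eval_at \<iota> f x - eval_at \<iota> g x"
  using eval_at_add[of "f - g" g] by simp

lemma eval_at_sum: "eval_at \<iota> (sum f I) x = (\<Sum>i\<in>I. eval_at \<iota> (f i) x)"
  by (induction I rule: infinite_finite_induct) (simp_all add: eval_at_add, simp_all add: eval_at_def)

lemma eval_at_single:
  "eval_at \<iota> (Poly_Mapping.single m c) x = \<iota> c * (\<Prod>i\<in>UNIV. (x $ i) ^ Poly_Mapping.lookup m i)"
  by (subst eval_at_superset[of "{m}"]) auto

lemma eval_at_mult: "eval_at \<iota> (f * g) x = eval_at \<iota> f x * eval_at \<iota> g x"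
proof -
  have sum_single: "h = (\<Sum>m\<in>Poly_Mapping.keys h. Poly_Mapping.single m (Poly_Mapping.lookup h m))"
    for h :: "('n, 'k) mpoly"
    by (rule poly_mapping_eqI) (simp add: lookup_sum lookup_single when_def in_keys_iff)
  define M where "M m = (\<Prod>i\<in>UNIV. (x $ i) ^ Poly_Mapping.lookup m i)" for m :: "'n \<Rightarrow>\<^sub>0 nat"
  have M: "M (m + n) = M m * M n" for m n
    by (simp add: M_def lookup_add power_add prod.distrib)
  have "f * g = (\<Sum>m\<in>Poly_Mapping.keys f. \<Sum>n\<in>Poly_Mapping.keys g.
      Poly_Mapping.single (m + n) (Poly_Mapping.lookup f m * Poly_Mapping.lookup g n))"
    by (subst (1) sum_single[of f], subst (1) sum_single[of g]) (simp add: sum_product mult_single)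
  then have "eval_at \<iota> (f * g) x = (\<Sum>m\<in>Poly_Mapping.keys f. \<Sum>n\<in>Poly_Mapping.keys g.
      (\<iota> (Poly_Mapping.lookup f m) * M m) * (\<iota> (Poly_Mapping.lookup g n) * M n))"
    by (simp add: eval_at_sum eval_at_single field_embedding_simps[OF \<iota>] M mult_ac flip: M_def)
  also have "\<dots> = eval_at \<iota> f x * eval_at \<iota> g x"
    by (simp add: sum_product eval_at_def M_def)
  finally show ?thesis .
qed

lemma eval_at_scale:
  assumes "homogeneous d f"
  shows "eval_at \<iota> f (c *s x) = c ^ d * eval_at \<iota> f x"
  unfolding eval_at_def sum_distrib_left
proof (intro sum.cong refl)
  fix m assume "m \<in> Poly_Mapping.keys f"
  then have "(\<Sum>i\<in>UNIV. Poly_Mapping.lookup m i) = d"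
    using assms by (auto simp: homogeneous_def)
  then show "\<iota> (Poly_Mapping.lookup f m) * (\<Prod>i\<in>UNIV. ((c *s x) $ i) ^ Poly_Mapping.lookup m i) =
      c ^ d * (\<iota> (Poly_Mapping.lookup f m) * (\<Prod>i\<in>UNIV. (x $ i) ^ Poly_Mapping.lookup m i))"
    by (simp add: power_mult_distrib prod.distrib mult_ac flip: power_sum)
qed

end

lemma homogeneous_mult:
  assumes "homogeneous d f" "homogeneous e g"
  shows "homogeneous (d + e) (f * g)"
  unfolding homogeneous_def
proof
  fix m assume "m \<in> Poly_Mapping.keys (f * g)"
  then obtain a b where "a \<in> Poly_Mapping.keys f" "b \<in> Poly_Mapping.keys g" "m = a + b"
    using keys_mult[of f g] by blast
  then show "(\<Sum>i\<in>UNIV. Poly_Mapping.lookup m i) = d + e"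
    using assms by (simp add: homogeneous_def lookup_add sum.distrib)
qed

lemma homogeneous_diff:
  assumes "homogeneous d f" "homogeneous d g"
  shows "homogeneous d (f - g :: ('n::finite, 'k::ab_group_add) mpoly)"
  using assms keys_diff[of f g] unfolding homogeneous_def by blast

lemma homogeneous_const: "homogeneous 0 (Poly_Mapping.single 0 c)"
  by (auto simp: homogeneous_def split: if_splits)

text \<open>With \<open>a = v $ j\<close> and \<open>b = v $ i\<close> these linear forms vanish at
  \<open>v\<close>, and together they cut out the line through \<open>v\<close>.\<close>

definition two_term_form :: "'k::field \<Rightarrow> 'n \<Rightarrow> 'k \<Rightarrow> 'n \<Rightarrow> ('n::finite, 'k) mpoly" where
  "two_term_form a i b j =
     Poly_Mapping.single (Poly_Mapping.single i 1) a - Poly_Mapping.single (Poly_Mapping.single j 1) b"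

lemma homogeneous_variable: "homogeneous 1 (Poly_Mapping.single (Poly_Mapping.single i 1) a)"
  by (auto simp: homogeneous_def lookup_single when_def split: if_splits)

lemma homogeneous_two_term_form: "homogeneous 1 (two_term_form a i b j)"
  unfolding two_term_form_def by (intro homogeneous_diff homogeneous_variable)

lemma eval_at_variable:
  assumes "field_embedding \<iota>"
  shows "eval_at \<iota> (Poly_Mapping.single (Poly_Mapping.single i 1) a) x = \<iota> a * x $ i"
proof -
  have "(\<Prod>l\<in>UNIV. (x $ l) ^ Poly_Mapping.lookup (Poly_Mapping.single i 1) l) = (\<Prod>l\<in>UNIV. if l = i then x $ i else 1)"
    by (intro prod.cong) (auto simp: lookup_single when_def)
  then show ?thesis
    by (simp add: eval_at_single[OF assms])
qed

lemma eval_at_two_term_form: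
  assumes "field_embedding \<iota>"
  shows "eval_at \<iota> (two_term_form a i b j) x = \<iota> a * x $ i - \<iota> b * x $ j"
  by (simp only: two_term_form_def eval_at_diff[OF assms] eval_at_variable[OF assms])

lemma eval_at_const:
  assumes "field_embedding \<iota>"
  shows "eval_at \<iota> (Poly_Mapping.single 0 a) x = \<iota> a"
  by (simp add: eval_at_single[OF assms])


subsection \<open>Points of projective space\<close>

abbreviation line :: "'k::field ^ 'n::finite \<Rightarrow> ('k ^ 'n) set" where
  "line v \<equiv> range (\<lambda>c. c *s v)"

lemma proj_space_iff: "t \<in> proj_space \<longleftrightarrow> (\<exists>v. v \<noteq> 0 \<and> t = line v)"
  by (auto simp: proj_space_def vec.span_singleton)

lemma vanishes_on_line_iff:
  fixes f :: "('n::finite, 'k::field) mpoly"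
  assumes "homogeneous d f" "t = line v"
  shows "(\<forall>z\<in>t. eval_at id f z = 0) \<longleftrightarrow> eval_at id f v = 0"
proof
  assume *: "\<forall>z\<in>t. eval_at id f z = 0"
  have "1 *s v \<in> t"
    using assms(2) by blast
  then show "eval_at id f v = 0"
    using * by simp
next
  assume "eval_at id f v = 0"
  then show "\<forall>z\<in>t. eval_at id f z = 0"
    using assms(2) eval_at_scale[OF field_embedding_id assms(1)] by auto
qed

lemma proportional_imp_same_line:
  fixes v w :: "'k::field ^ 'n::finite"
  assumes v: "v \<noteq> 0" and w: "w \<noteq> 0" and proportional: "\<And>i j. v $ j * w $ i = v $ i * w $ j"
  shows "line v = line w"
proof -
  obtain j where j: "v $ j \<noteq> 0"
    using v by (metis vec_eq_iff zero_index)
  define a where "a = w $ j / v $ j"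
  have wa: "w = a *s v"
    using proportional[where j = j] j by (auto simp: vec_eq_iff a_def field_simps)
  then have "a \<noteq> 0"
    using w by auto
  then have 1: "c *s v = (c / a) *s w" for c
    by (simp add: wa vec_eq_iff)
  have 2: "c *s w = (c * a) *s v" for c
    by (simp add: wa vec_eq_iff)
  show ?thesis
  proof (intro equalityI subsetI)
    fix z assume "z \<in> line v"
    then obtain c where "z = c *s v"
      by (rule rangeE)
    then show "z \<in> line w"
      unfolding 1 by (rule range_eqI)
  next
    fix z assume "z \<in> line w"
    then obtain c where "z = c *s w"
      by (rule rangeE)
    then show "z \<in> line v"
      unfolding 2 by (rule range_eqI)
  qed
qed

lemma line_generator_scale:
  assumes "line v = line w" "v \<noteq> 0"
  shows "\<exists>a. a \<noteq> 0 \<and> (v :: 'k::field ^ 'n::finite) = a *s w"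
proof -
  have "1 *s v \<in> line w"
    using assms(1) by blast
  then obtain a where "v = a *s w"
    by auto
  then show ?thesis
    using assms(2) by (intro exI[of _ a]) auto
qed

lemma separating_form:
  fixes v w :: "'k::field ^ 'n::finite"
  assumes "v \<noteq> 0" "w \<noteq> 0" "line v \<noteq> line w"
  shows "\<exists>i j. eval_at id (two_term_form (v $ j) i (v $ i) j) w \<noteq> 0"
  using proportional_imp_same_line[OF assms(1,2)] assms(3)
  by (auto simp: eval_at_two_term_form[OF field_embedding_id])

text \<open>A product of one linear form per point. The degree depends only on
  \<open>card X\<close>, so quotients of such forms are functions.\<close>

lemma form_separating_from_finite_set:
  fixes w :: "'k::field ^ 'n::finite"
  assumes "finite X" "X \<subseteq> proj_space" "w \<noteq> 0" "line w \<notin> X"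
  shows "\<exists>f. homogeneous (card X) f \<and> eval_at (id :: 'k \<Rightarrow> 'k) f w \<noteq> 0 \<and>
    (\<forall>t\<in>X. \<forall>z\<in>t. eval_at (id :: 'k \<Rightarrow> 'k) f z = 0)"
  using assms
proof (induction X rule: finite_induct)
  case empty
  show ?case
  proof (intro exI conjI)
    show "homogeneous (card {}) (Poly_Mapping.single 0 1)"
      by (simp only: card.empty homogeneous_const)
    show "eval_at id (Poly_Mapping.single 0 1) w \<noteq> 0"
      by (simp only: eval_at_const[OF field_embedding_id]) simp
  qed simp
next
  case (insert t X)
  obtain f where f: "homogeneous (card X) f" "eval_at id f w \<noteq> 0" "\<forall>t\<in>X. \<forall>z\<in>t. eval_at id f z = 0"
    using insert.IH insert.prems by blast
  obtain v where v: "v \<noteq> 0" "t = line v"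
    using insert.prems by (auto simp: proj_space_iff)
  obtain i j where ij: "eval_at id (two_term_form (v $ j) i (v $ i) j) w \<noteq> 0"
    using separating_form[of v w] v insert.prems by auto
  define g where "g = two_term_form (v $ j) i (v $ i) j"
  have g: "homogeneous 1 g" "eval_at id g w \<noteq> 0"
    using homogeneous_two_term_form ij by (simp_all add: g_def)
  have "eval_at id g v = 0"
    by (simp add: g_def eval_at_two_term_form[OF field_embedding_id])
  then have "\<forall>z\<in>t. eval_at id g z = 0"
    using vanishes_on_line_iff[OF g(1) v(2)] by simp
  then have "\<forall>t'\<in>insert t X. \<forall>z\<in>t'. eval_at id (f * g) z = 0"
    unfolding eval_at_mult[OF field_embedding_id] using f(3) by auto
  moreover have "eval_at id (f * g) w \<noteq> 0"
    unfolding eval_at_mult[OF field_embedding_id] using f(2) g(2) by simp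
  moreover have "homogeneous (card (insert t X)) (f * g)"
    using homogeneous_mult[OF f(1) g(1)] insert.hyps by simp
  ultimately show ?case
    by blast
qed

lemma line_closed:
  assumes "v \<noteq> 0"
  shows "zariski_closed {line v}"
proof -
  define T where "T = {two_term_form (v $ j) i (v $ i) j | i j. True}"
  have "{line v} = {t \<in> proj_space. \<forall>f\<in>T. \<forall>z\<in>t. eval_at id f z = 0}"
  proof (intro set_eqI iffI)
    fix t assume t: "t \<in> {line v}"
    have "\<forall>z\<in>t. eval_at id f z = 0" if f_T: "f \<in> T" for f
    proof -
      obtain i j where f: "f = two_term_form (v $ j) i (v $ i) j"
        using f_T unfolding T_def by blast
      have "eval_at id f v = 0"
        by (simp add: f eval_at_two_term_form[OF field_embedding_id])
      moreover have "homogeneous 1 f"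
        unfolding f by (rule homogeneous_two_term_form)
      ultimately show ?thesis
        using vanishes_on_line_iff[of 1 f t v] t by blast
    qed
    then show "t \<in> {t \<in> proj_space. \<forall>f\<in>T. \<forall>z\<in>t. eval_at id f z = 0}"
      using t assms proj_space_iff by blast
  next
    fix t assume t: "t \<in> {t \<in> proj_space. \<forall>f\<in>T. \<forall>z\<in>t. eval_at id f z = 0}"
    then obtain w where w: "w \<noteq> 0" "t = line w"
      by (auto simp: proj_space_iff)
    then have "w \<in> t"
      by (metis rangeI vector_smult_lid)
    then have "eval_at id (two_term_form (v $ j) i (v $ i) j) w = 0" for i j
      using t by (auto simp: T_def)
    then show "t \<in> {line v}"
      using separating_form[OF assms w(1)] w(2) by blast
  qed
  moreover have "\<forall>f\<in>T. \<exists>d. homogeneous d f"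
    using homogeneous_two_term_form unfolding T_def by blast
  ultimately show ?thesis
    unfolding zariski_closed_def by blast
qed

lemma line_irreducible:
  assumes "v \<noteq> 0"
  shows "zariski_irreducible {line v}"
  using line_closed[OF assms] by (auto simp: zariski_irreducible_def)


subsection \<open>Generic points and local rings\<close>

locale generic_curve =
  fixes \<iota> :: "'k::alg_closed_field \<Rightarrow> 'a::alg_closed_field"
    and B :: "('k ^ 'n::finite) set set" and \<xi> :: "'a ^ 'n"
  assumes embedding: "field_embedding \<iota>" and generic: "generic_point \<iota> B \<xi>"
    and B_subset: "B \<subseteq> proj_space" and B_nonempty: "B \<noteq> {}"
begin

lemmas \<iota>_simps = field_embedding_simps[OF embedding]

abbreviation "K \<equiv> range \<iota>"

lemma K_subfield: "is_subfield K"
  by (rule range_embedding_is_subfield[OF embedding])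

lemma generic_zero_iff: "homogeneous d f \<Longrightarrow> eval_at \<iota> f \<xi> = 0 \<longleftrightarrow> (\<forall>t\<in>B. \<forall>z\<in>t. eval_at id f z = 0)"
  using generic by (auto simp: generic_point_def vanishing_ideal_def)

lemma generic_nonzero: "homogeneous d f \<Longrightarrow> t \<in> B \<Longrightarrow> z \<in> t \<Longrightarrow> eval_at id f z \<noteq> 0 \<Longrightarrow> eval_at \<iota> f \<xi> \<noteq> 0"
  using generic_zero_iff by blast

lemma generic_coordinate_nonzero: "\<exists>j. \<xi> $ j \<noteq> 0"
proof -
  obtain t v where v: "t \<in> B" "v \<noteq> 0" "t = line v"
    using B_nonempty B_subset proj_space_iff by blast
  obtain j where j: "v $ j \<noteq> 0"
    using v(2) by (metis vec_eq_iff zero_index)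
  have "v \<in> t"
    using v(3) by (metis rangeI vector_smult_lid)
  then have "eval_at \<iota> (Poly_Mapping.single (Poly_Mapping.single j 1) 1) \<xi> \<noteq> 0"
    using generic_nonzero[OF homogeneous_variable v(1)] j
    by (simp add: eval_at_variable[OF field_embedding_id] del: One_nat_def)
  then show ?thesis
    by (auto simp: eval_at_variable[OF embedding] simp del: One_nat_def)
qed

abbreviation "L \<equiv> function_field \<iota> \<xi>"

lemma L_subfield: "is_subfield L"
  unfolding is_subfield_def
proof (intro conjI ballI)
  have "eval_at \<iota> (Poly_Mapping.single 0 1) \<xi> = 1"
    by (simp add: eval_at_const[OF embedding] \<iota>_simps del: single_one)
  then show "1 \<in> L"
    unfolding function_field_def using homogeneous_const[of 1]
    by (intro CollectI exI[of _ "Poly_Mapping.single 0 1"]) (auto simp del: single_one)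
  fix a assume "a \<in> L"
  then obtain f g d where a: "a = eval_at \<iota> f \<xi> / eval_at \<iota> g \<xi>" "homogeneous d f" "homogeneous d g"
    "eval_at \<iota> g \<xi> \<noteq> 0"
    by (auto simp: function_field_def)
  show "inverse a \<in> L"
  proof (cases "eval_at \<iota> f \<xi> = 0")
    case True
    then have "inverse a = a"
      using a(1) by simp
    then show ?thesis
      using \<open>a \<in> L\<close> by simp
  next
    case False
    then show ?thesis
      unfolding function_field_def using a by (intro CollectI exI[of _ g] exI[of _ f]) auto
  qed
  fix b assume "b \<in> L"
  then obtain f' g' e where b: "b = eval_at \<iota> f' \<xi> / eval_at \<iota> g' \<xi>" "homogeneous e f'" "homogeneous e g'"
    "eval_at \<iota> g' \<xi> \<noteq> 0"
    by (auto simp: function_field_def)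
  note ev = eval_at_mult[OF embedding] eval_at_diff[OF embedding]
  have gg: "homogeneous (d + e) (g * g')" "eval_at \<iota> (g * g') \<xi> \<noteq> 0"
    using a b homogeneous_mult by (auto simp: ev)
  have "a * b = eval_at \<iota> (f * f') \<xi> / eval_at \<iota> (g * g') \<xi>"
    by (simp add: a b ev)
  then show "a * b \<in> L"
    unfolding function_field_def using gg homogeneous_mult[OF a(2) b(2)] by blast
  have "a - b = eval_at \<iota> (f * g' - g * f') \<xi> / eval_at \<iota> (g * g') \<xi>"
    unfolding a(1) b(1) ev using a(4) b(4) by (simp add: field_simps)
  then show "a - b \<in> L"
    unfolding function_field_def
    using gg homogeneous_diff[OF homogeneous_mult[OF a(2) b(3)] homogeneous_mult[OF a(3) b(2)]] by blast
qed

lemma K_subset_L: "K \<subseteq> L"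
proof
  fix a assume "a \<in> K"
  then obtain c where "a = \<iota> c"
    by blast
  then have "a = eval_at \<iota> (Poly_Mapping.single 0 c) \<xi> / eval_at \<iota> (Poly_Mapping.single 0 1) \<xi>"
    "eval_at \<iota> (Poly_Mapping.single 0 1) \<xi> \<noteq> 0"
    by (simp_all add: eval_at_const[OF embedding] \<iota>_simps del: single_one)
  then show "a \<in> L"
    unfolding function_field_def using homogeneous_const by blast
qed

lemma coordinate_ratio_in_L:
  assumes "\<xi> $ j \<noteq> 0"
  shows "\<xi> $ i / \<xi> $ j \<in> L"
proof -
  define X where "X l = (Poly_Mapping.single (Poly_Mapping.single l 1) (1 :: 'k) :: ('n, 'k) mpoly)" for l
  have "eval_at \<iota> (X l) \<xi> = \<xi> $ l" for l
    unfolding X_def eval_at_variable[OF embedding] by (simp add: \<iota>_simps)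
  moreover have "homogeneous 1 (X l)" for l
    unfolding X_def by (rule homogeneous_variable)
  ultimately show ?thesis
    unfolding function_field_def using assms
    by (intro CollectI exI[of _ "X i"] exI[of _ "X j"]) auto
qed

text \<open>Quotients of forms of equal degree do not change when the coordinates are scaled, so
  \<open>\<xi>\<close> may be replaced by its multiple with coordinate \<open>j\<close> equal to
  1.\<close>

lemma L_least:
  assumes j: "\<xi> $ j \<noteq> 0" and M: "is_subfield M" "K \<subseteq> M" "\<And>i. \<xi> $ i / \<xi> $ j \<in> M"
  shows "L \<subseteq> M"
proof
  fix a assume "a \<in> L"
  then obtain f g d where a: "a = eval_at \<iota> f \<xi> / eval_at \<iota> g \<xi>" "homogeneous d f" "homogeneous d g"
    "eval_at \<iota> g \<xi> \<noteq> 0"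
    by (auto simp: function_field_def)
  define y where "y = inverse (\<xi> $ j) *s \<xi>"
  have \<xi>: "\<xi> = \<xi> $ j *s y"
    using j by (simp add: y_def vec_eq_iff)
  have ev: "eval_at \<iota> h \<xi> = (\<xi> $ j) ^ d * eval_at \<iota> h y" if "homogeneous d h" for h
    using eval_at_scale[OF embedding that, of "\<xi> $ j" y] \<xi> by metis
  have "a = eval_at \<iota> f y / eval_at \<iota> g y"
    using j by (simp add: a(1) ev[OF a(2)] ev[OF a(3)])
  moreover have "y $ i \<in> M" for i
    using M(3)[of i] by (simp add: y_def field_simps)
  then have "eval_at \<iota> h y \<in> M" for h :: "('n, 'k) mpoly"
    unfolding eval_at_def using M(2) by (intro subfield_intros[OF M(1)]) auto
  then have "eval_at \<iota> f y / eval_at \<iota> g y \<in> M"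
    by (intro subfield_intros[OF M(1)])
  ultimately show "a \<in> M"
    by simp
qed

text \<open>The graph of the evaluation of functions at the point \<open>t\<close>.\<close>

definition local_graph :: "('k ^ 'n) set \<Rightarrow> ('a \<times> 'k) set" where
  "local_graph t = {(eval_at \<iota> f \<xi> / eval_at \<iota> g \<xi>, eval_at id f v / eval_at id g v) | f g v.
     (\<exists>d. homogeneous d f \<and> homogeneous d g) \<and> t = line v \<and> eval_at id g v \<noteq> 0}"

text \<open>Another representative of \<open>t\<close> multiplies numerator and denominator by the
  same factor, so one fixed \<open>v\<close> serves all elements of the graph.\<close>

lemma local_graph_iff:
  assumes "v \<noteq> 0" "t = line v"
  shows "(a, b) \<in> local_graph t \<longleftrightarrow> (\<exists>f g d. homogeneous d f \<and> homogeneous d g \<and> eval_at id g v \<noteq> 0 \<and>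
    a = eval_at \<iota> f \<xi> / eval_at \<iota> g \<xi> \<and> b = eval_at id f v / eval_at id g v)"
proof
  assume "(a, b) \<in> local_graph t"
  then obtain f g w d where *: "homogeneous d f" "homogeneous d g" "t = line w"
    "eval_at id g w \<noteq> 0" "a = eval_at \<iota> f \<xi> / eval_at \<iota> g \<xi>" "b = eval_at id f w / eval_at id g w"
    by (auto simp: local_graph_def)
  obtain c where c: "c \<noteq> 0" "v = c *s w"
    using line_generator_scale[of v w] assms *(3) by auto
  have "eval_at id h v = c ^ d * eval_at id h w" if "homogeneous d h" for h
    unfolding c(2) by (rule eval_at_scale[OF field_embedding_id that])
  then show "\<exists>f g d. homogeneous d f \<and> homogeneous d g \<and> eval_at id g v \<noteq> 0 \<and>
    a = eval_at \<iota> f \<xi> / eval_at \<iota> g \<xi> \<and> b = eval_at id f v / eval_at id g v"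
    using * c(1) by (intro exI[of _ f] exI[of _ g] exI[of _ d]) auto
next
  assume "\<exists>f g d. homogeneous d f \<and> homogeneous d g \<and> eval_at id g v \<noteq> 0 \<and>
    a = eval_at \<iota> f \<xi> / eval_at \<iota> g \<xi> \<and> b = eval_at id f v / eval_at id g v"
  then show "(a, b) \<in> local_graph t"
    unfolding local_graph_def using assms(2) by blast
qed

text \<open>Evaluation is well defined because a form that vanishes at the generic point vanishes on
  all of \<open>B\<close>.\<close>

lemma local_graph_partial_hom:
  assumes t: "t \<in> B"
  shows "partial_hom (local_graph t)"
proof -
  obtain v where v: "v \<noteq> 0" "t = line v"
    using t B_subset proj_space_iff by blast
  note iff = local_graph_iff[OF v]
  have vt: "v \<in> t"
    using v(2) by (metis rangeI vector_smult_lid)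
  have nz: "eval_at \<iota> g \<xi> \<noteq> 0" if "homogeneous d g" "eval_at id g v \<noteq> 0" for d g
    using generic_nonzero[OF that(1) t vt that(2)] .
  show ?thesis
    unfolding partial_hom_def
  proof (intro conjI allI impI)
    show "(1, 1) \<in> local_graph t"
      unfolding iff
      by (rule exI[of _ "Poly_Mapping.single 0 1"], rule exI[of _ "Poly_Mapping.single 0 1"], rule exI[of _ 0])
         (simp add: homogeneous_const eval_at_const[OF embedding] eval_at_const[OF field_embedding_id] \<iota>_simps
           del: single_one)
  next
    fix b assume "(0, b) \<in> local_graph t"
    then obtain f g d where *: "homogeneous d f" "homogeneous d g" "eval_at id g v \<noteq> 0"
      "0 = eval_at \<iota> f \<xi> / eval_at \<iota> g \<xi>" "b = eval_at id f v / eval_at id g v"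
      unfolding iff by blast
    then have "eval_at \<iota> f \<xi> = 0"
      using nz by auto
    then have "eval_at id f v = 0"
      using generic_zero_iff[OF *(1)] t vt by blast
    then show "b = 0"
      using *(5) by simp
  next
    fix a b a' b' assume "(a, b) \<in> local_graph t" "(a', b') \<in> local_graph t"
    then obtain f g d f' g' d' where fr: "homogeneous d f" "homogeneous d g" "eval_at id g v \<noteq> 0"
      "a = eval_at \<iota> f \<xi> / eval_at \<iota> g \<xi>" "b = eval_at id f v / eval_at id g v"
      and fr': "homogeneous d' f'" "homogeneous d' g'" "eval_at id g' v \<noteq> 0"
      "a' = eval_at \<iota> f' \<xi> / eval_at \<iota> g' \<xi>" "b' = eval_at id f' v / eval_at id g' v"
      unfolding iff by blast
    note ev = eval_at_mult[OF embedding] eval_at_diff[OF embedding]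
      eval_at_mult[OF field_embedding_id] eval_at_diff[OF field_embedding_id]
    note nz' = nz[OF fr(2,3)] nz[OF fr'(2,3)]
    have gg: "homogeneous (d + d') (g * g')" "eval_at id (g * g') v \<noteq> 0"
      using homogeneous_mult[OF fr(2) fr'(2)] fr(3) fr'(3) by (auto simp: ev)
    have "a * a' = eval_at \<iota> (f * f') \<xi> / eval_at \<iota> (g * g') \<xi>"
      "b * b' = eval_at id (f * f') v / eval_at id (g * g') v"
      by (simp_all add: fr(4,5) fr'(4,5) ev)
    then show "(a * a', b * b') \<in> local_graph t"
      unfolding iff using gg homogeneous_mult[OF fr(1) fr'(1)] by blast
    have "a - a' = eval_at \<iota> (f * g' - g * f') \<xi> / eval_at \<iota> (g * g') \<xi>"
      unfolding fr(4) fr'(4) ev using nz' by (simp add: field_simps)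
    moreover have "b - b' = eval_at id (f * g' - g * f') v / eval_at id (g * g') v"
      unfolding fr(5) fr'(5) ev using fr(3) fr'(3) by (simp add: field_simps)
    ultimately show "(a - a', b - b') \<in> local_graph t"
      unfolding iff
      using gg homogeneous_diff[OF homogeneous_mult[OF fr(1) fr'(2)] homogeneous_mult[OF fr(2) fr'(1)]] by blast
  qed
qed

lemma Domain_local_graph:
  assumes t: "t \<in> B"
  shows "Domain (local_graph t) = local_ring \<iota> \<xi> t"
proof -
  obtain v where v: "v \<noteq> 0" "t = line v"
    using t B_subset proj_space_iff by blast
  have "(\<exists>z\<in>t. eval_at id g z \<noteq> 0) \<longleftrightarrow> eval_at id g v \<noteq> 0" if "homogeneous d g" for d g
    using vanishes_on_line_iff[OF that v(2)] by blast
  then show ?thesis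
    unfolding set_eq_iff Domain_iff local_graph_iff[OF v] local_ring_def mem_Collect_eq by blast
qed

lemma local_graph_const:
  assumes t: "t \<in> B"
  shows "(\<iota> c, c) \<in> local_graph t"
proof -
  obtain v where v: "v \<noteq> 0" "t = line v"
    using t B_subset proj_space_iff by blast
  show ?thesis
    unfolding local_graph_iff[OF v]
    by (rule exI[of _ "Poly_Mapping.single 0 c"], rule exI[of _ "Poly_Mapping.single 0 1"], rule exI[of _ 0])
       (simp only: homogeneous_const eval_at_const[OF embedding] eval_at_const[OF field_embedding_id]
          \<iota>_simps(1) id_apply, simp)
qed

lemma local_graph_inverse:
  assumes t: "t \<in> B" and ab: "(a, b) \<in> local_graph t" "b \<noteq> 0"
  shows "(inverse a, inverse b) \<in> local_graph t"
proof -
  obtain v where v: "v \<noteq> 0" "t = line v"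
    using t B_subset proj_space_iff by blast
  obtain f g d where *: "homogeneous d f" "homogeneous d g" "eval_at id g v \<noteq> 0"
    "a = eval_at \<iota> f \<xi> / eval_at \<iota> g \<xi>" "b = eval_at id f v / eval_at id g v"
    using ab(1) unfolding local_graph_iff[OF v] by blast
  have "eval_at id f v \<noteq> 0"
    using *(5) ab(2) by auto
  note * = * this
  show ?thesis
    unfolding local_graph_iff[OF v]
    by (rule exI[of _ g], rule exI[of _ f], rule exI[of _ d]) (use * in auto)
qed

end


subsection \<open>Zeros of a function\<close>

lemma generated_by_one_fraction:
  fixes k :: "'a::field set"
  assumes k: "is_subfield k" and a: "a \<in> generated_subfield (insert w k)"
  shows "\<exists>p q. poly_over k p \<and> poly_over k q \<and> poly q w \<noteq> 0 \<and> a = poly p w / poly q w"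
proof -
  note R = is_subfield_imp_subring[OF k]
  define S where "S = {poly p w / poly q w | p q. poly_over k p \<and> poly_over k q \<and> poly q w \<noteq> 0}"
  have "is_subfield S"
    unfolding is_subfield_def
  proof (intro conjI ballI)
    show "1 \<in> S"
      unfolding S_def using poly_over_1[OF R] by (intro CollectI exI[of _ 1]) simp
    fix a assume a: "a \<in> S"
    then obtain p q where pq: "a = poly p w / poly q w" "poly_over k p" "poly_over k q" "poly q w \<noteq> 0"
      by (auto simp: S_def)
    have "inverse a = poly q w / poly p w"
      by (simp add: pq(1))
    then show "inverse a \<in> S"
      using a pq by (cases "poly p w = 0") (auto simp: S_def)
    fix b assume "b \<in> S"
    then obtain p' q' where pq': "b = poly p' w / poly q' w" "poly_over k p'" "poly_over k q'" "poly q' w \<noteq> 0"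
      by (auto simp: S_def)
    have den: "poly_over k (q * q')" "poly (q * q') w \<noteq> 0"
      using pq pq' poly_over_mult[OF R] by auto
    have "a * b = poly (p * p') w / poly (q * q') w"
      by (simp add: pq pq')
    then show "a * b \<in> S"
      unfolding S_def using den poly_over_mult[OF R pq(2) pq'(2)] by blast
    have "a - b = poly (p * q' - q * p') w / poly (q * q') w"
      unfolding pq(1) pq'(1) using pq(4) pq'(4) by (simp add: field_simps)
    then show "a - b \<in> S"
      unfolding S_def
      using den poly_over_diff[OF R poly_over_mult[OF R pq(2) pq'(3)] poly_over_mult[OF R pq(3) pq'(2)]] by blast
  qed
  moreover have "insert w k \<subseteq> S"
  proof
    fix a assume "a \<in> insert w k"
    then obtain p where "poly_over k p" "a = poly p w"
      using adjoin_ring_superset[OF R, of w] by (auto simp: adjoin_ring_def)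
    then show "a \<in> S"
      unfolding S_def using poly_over_1[OF R] by (intro CollectI exI[of _ p] exI[of _ 1]) simp
  qed
  ultimately have "a \<in> S"
    using generated_subfield_least a by blast
  then show ?thesis
    by (auto simp: S_def)
qed

text \<open>Clearing denominators and cancelling the common power of \<open>w\<close> in a linear relation.\<close>

lemma polynomial_relation:
  fixes k :: "'a::field set"
  assumes k: "is_subfield k" and w: "w \<noteq> 0" and T: "finite T"
    and c: "\<And>t. t \<in> T \<Longrightarrow> c t \<in> generated_subfield (insert w k)" "\<exists>t\<in>T. c t \<noteq> 0"
    and rel: "(\<Sum>t\<in>T. c t * v t) = 0"
  shows "\<exists>P. (\<forall>t\<in>T. poly_over k (P t)) \<and> (\<exists>t\<in>T. coeff (P t) 0 \<noteq> 0) \<and> (\<Sum>t\<in>T. poly (P t) w * v t) = 0"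
proof -
  note R = is_subfield_imp_subring[OF k]
  have "\<forall>t\<in>T. \<exists>p q. poly_over k p \<and> poly_over k q \<and> poly q w \<noteq> 0 \<and> c t = poly p w / poly q w"
    using generated_by_one_fraction[OF k c(1)] by blast
  then obtain p q where pq: "\<And>t. t \<in> T \<Longrightarrow> poly_over k (p t)" "\<And>t. t \<in> T \<Longrightarrow> poly_over k (q t)"
    "\<And>t. t \<in> T \<Longrightarrow> poly (q t) w \<noteq> 0" "\<And>t. t \<in> T \<Longrightarrow> c t = poly (p t) w / poly (q t) w"
    by metis
  define D where "D = (\<Prod>t\<in>T. poly (q t) w)"
  define P where "P t = p t * (\<Prod>u\<in>T - {t}. q u)" for t
  have prod_over: "poly_over k (\<Prod>u\<in>U. q u)" if "U \<subseteq> T" for U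
    using that by (induction U rule: infinite_finite_induct) (auto intro!: poly_over_1[OF R] poly_over_mult[OF R] pq(2))
  have P: "poly_over k (P t)" "poly (P t) w = c t * D" if "t \<in> T" for t
  proof -
    show "poly_over k (P t)"
      unfolding P_def using that by (intro poly_over_mult[OF R] pq(1) prod_over) auto
    have "D = poly (q t) w * (\<Prod>u\<in>T - {t}. poly (q u) w)"
      unfolding D_def using T that by (rule prod.remove)
    then show "poly (P t) w = c t * D"
      using pq(3)[OF that] by (simp add: P_def poly_prod pq(4)[OF that])
  qed
  have D: "D \<noteq> 0"
    using T pq(3) by (auto simp: D_def)
  have rel': "(\<Sum>t\<in>T. poly (P t) w * v t) = 0"
  proof -
    have "(\<Sum>t\<in>T. poly (P t) w * v t) = (\<Sum>t\<in>T. c t * v t) * D"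
      unfolding sum_distrib_right by (intro sum.cong refl) (simp add: P(2) mult_ac)
    then show ?thesis
      using rel by simp
  qed
  obtain t0 where t0: "t0 \<in> T" "poly (P t0) w \<noteq> 0"
    using c(2) P(2) D by fastforce
  then have "P t0 \<noteq> 0"
    by auto
  then have ex: "\<exists>e. \<exists>t\<in>T. coeff (P t) e \<noteq> 0"
    using t0(1) by (metis leading_coeff_0_iff)
  define e where "e = (LEAST e. \<exists>t\<in>T. coeff (P t) e \<noteq> 0)"
  have e: "\<exists>t\<in>T. coeff (P t) e \<noteq> 0"
    unfolding e_def by (rule LeastI_ex[OF ex])
  have below: "coeff (P t) i = 0" if "t \<in> T" "i < e" for t i
    using not_less_Least[of i "\<lambda>e. \<exists>t\<in>T. coeff (P t) e \<noteq> 0"] that unfolding e_def by blast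
  define Q where "Q t = poly_shift e (P t)" for t
  have PQ: "P t = monom 1 e * Q t" if "t \<in> T" for t
    using below[OF that] by (intro poly_eqI) (auto simp: coeff_monom_mult Q_def coeff_poly_shift)
  have "(\<Sum>t\<in>T. poly (P t) w * v t) = w ^ e * (\<Sum>t\<in>T. poly (Q t) w * v t)"
    unfolding sum_distrib_left by (intro sum.cong refl) (simp add: PQ poly_monom mult_ac)
  then have "(\<Sum>t\<in>T. poly (Q t) w * v t) = 0"
    using rel' w by simp
  moreover have "\<forall>t\<in>T. poly_over k (Q t)"
    using P(1) by (auto simp: poly_over_def Q_def coeff_poly_shift)
  moreover have "\<exists>t\<in>T. coeff (Q t) 0 \<noteq> 0"
    using e by (simp add: Q_def coeff_poly_shift)
  ultimately show ?thesis
    by blast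
qed

context generic_curve
begin

text \<open>Given more than \<open>card S\<close> zeros, take for each a form that is nonzero there
  and zero at the others. The ratios of these forms satisfy a relation whose coefficients are
  polynomials in \<open>w\<close>, not all with constant term 0. Evaluation at a zero whose constant
  term is nonzero kills \<open>w\<close> and all other ratios, which is absurd.\<close>

lemma finite_zeros:
  assumes w: "w \<noteq> 0" and fin: "finite_dim (generated_subfield (insert w K)) L"
  shows "finite {t \<in> B. (w, 0) \<in> local_graph t}"
proof (rule ccontr)
  assume inf: "infinite {t \<in> B. (w, 0) \<in> local_graph t}"
  define E where "E = generated_subfield (insert w K)"
  have E: "is_subfield E"
    by (simp add: E_def generated_subfield_is_subfield)
  obtain S where S: "finite S" "L \<subseteq> span_over E S"
    using fin by (auto simp: finite_dim_def E_def)
  obtain T where T: "finite T" "card T = Suc (card S)" "T \<subseteq> {t \<in> B. (w, 0) \<in> local_graph t}"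
    using infinite_arbitrarily_large[OF inf] by blast
  have TB: "t \<in> B" "(w, 0) \<in> local_graph t" if "t \<in> T" for t
    using T(3) that by auto
  have "\<forall>t\<in>T. \<exists>v. v \<noteq> 0 \<and> t = line v"
    using TB(1) B_subset proj_space_iff by blast
  then obtain \<tau> where \<tau>: "\<And>t. t \<in> T \<Longrightarrow> \<tau> t \<noteq> 0" "\<And>t. t \<in> T \<Longrightarrow> t = line (\<tau> t)"
    by metis
  have "\<exists>f. homogeneous (card S) f \<and> eval_at id f (\<tau> t) \<noteq> 0 \<and> (\<forall>u\<in>T - {t}. \<forall>z\<in>u. eval_at id f z = 0)"
    if t: "t \<in> T" for t
  proof -
    have "card (T - {t}) = card S"
      using t T(1,2) by simp
    moreover have "line (\<tau> t) \<notin> T - {t}"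
      using \<tau>(2)[OF t] by auto
    moreover have "T - {t} \<subseteq> proj_space"
      using TB(1) B_subset by auto
    ultimately show ?thesis
      using form_separating_from_finite_set[of "T - {t}" "\<tau> t"] T(1) \<tau>(1)[OF t] by auto
  qed
  then obtain f where f: "\<And>t. t \<in> T \<Longrightarrow> homogeneous (card S) (f t)"
    "\<And>t. t \<in> T \<Longrightarrow> eval_at id (f t) (\<tau> t) \<noteq> 0"
    "\<And>t u z. t \<in> T \<Longrightarrow> u \<in> T - {t} \<Longrightarrow> z \<in> u \<Longrightarrow> eval_at id (f t) z = 0"
    by metis
  have \<tau>t: "\<tau> t \<in> t" if "t \<in> T" for t
    using \<tau>(2)[OF that] by (metis rangeI vector_smult_lid)
  have nz: "eval_at \<iota> (f t) \<xi> \<noteq> 0" if "t \<in> T" for t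
    using generic_nonzero[OF f(1)[OF that] TB(1)[OF that] \<tau>t[OF that] f(2)[OF that]] .
  obtain t0 where t0: "t0 \<in> T"
    using T(2) by fastforce
  define y where "y t = eval_at \<iota> (f t) \<xi> / eval_at \<iota> (f t0) \<xi>" for t
  have "y t \<in> L" if "t \<in> T" for t
    unfolding function_field_def y_def using f(1)[OF that] f(1)[OF t0] nz[OF t0] by blast
  then have "\<exists>c. (\<forall>t\<in>T. c t \<in> E) \<and> (\<exists>t\<in>T. c t \<noteq> 0) \<and> (\<Sum>t\<in>T. c t * y t) = 0"
    using S T by (intro span_over_dependent[OF E S(1)]) auto
  then obtain c where c: "\<And>t. t \<in> T \<Longrightarrow> c t \<in> E" "\<exists>t\<in>T. c t \<noteq> 0" "(\<Sum>t\<in>T. c t * y t) = 0"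
    by blast
  obtain P where P: "\<And>t. t \<in> T \<Longrightarrow> poly_over K (P t)" "\<exists>t\<in>T. coeff (P t) 0 \<noteq> 0"
    "(\<Sum>t\<in>T. poly (P t) w * y t) = 0"
    using polynomial_relation[OF K_subfield w T(1) c(1)[unfolded E_def] c(2,3)] by blast
  obtain s where s: "s \<in> T" "coeff (P s) 0 \<noteq> 0"
    using P(2) by blast
  define G where "G = local_graph s"
  have G: "partial_hom G"
    unfolding G_def by (rule local_graph_partial_hom[OF TB(1)[OF s(1)]])
  have ratio: "(eval_at \<iota> (f t) \<xi> / eval_at \<iota> (f s) \<xi>, if t = s then 1 else 0) \<in> G" if t: "t \<in> T" for t
  proof -
    have "eval_at id (f t) (\<tau> s) / eval_at id (f s) (\<tau> s) = (if t = s then 1 else 0)"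
      using f(2)[OF s(1)] f(3)[OF t, of s "\<tau> s"] \<tau>t[OF s(1)] s(1) by auto
    then show ?thesis
      unfolding G_def local_graph_iff[OF \<tau>(1)[OF s(1)] \<tau>(2)[OF s(1)]]
      using f(1)[OF t] f(1)[OF s(1)] f(2)[OF s(1)] by metis
  qed
  have "\<exists>d. (poly (P t) w, d) \<in> G \<and> \<iota> d = coeff (P t) 0" if t: "t \<in> T" for t
  proof -
    have "K \<subseteq> Domain G"
      using local_graph_const[OF TB(1)[OF s(1)]] by (auto simp: G_def)
    then obtain q where q: "poly_pair G (P t) q"
      using poly_pair_lift'[OF G] poly_over_mono[OF P(1)[OF t]] by blast
    have "(poly (P t) w, poly q 0) \<in> G"
      using poly_pair_eval[OF G q] TB(2)[OF s(1)] by (simp add: G_def)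
    moreover obtain d where d: "coeff (P t) 0 = \<iota> d"
      using P(1)[OF t] by (auto simp: poly_over_def)
    then have "(coeff (P t) 0, d) \<in> G"
      using local_graph_const[OF TB(1)[OF s(1)]] by (simp add: G_def)
    then have "coeff q 0 = d"
      using q partial_hom_unique[OF G] by (auto simp: poly_pair_def)
    ultimately show ?thesis
      using d by (auto simp: poly_0_coeff_0)
  qed
  then obtain d where d: "\<And>t. t \<in> T \<Longrightarrow> (poly (P t) w, d t) \<in> G" "\<And>t. t \<in> T \<Longrightarrow> \<iota> (d t) = coeff (P t) 0"
    by metis
  \<comment> \<open>The ratios are renormalised by \<open>f s\<close>, since \<open>f t0\<close> may
    vanish at \<open>s\<close>.\<close>
  define r where "r t = eval_at \<iota> (f t) \<xi> / eval_at \<iota> (f s) \<xi>" for t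
  have "(\<Sum>t\<in>T. poly (P t) w * r t, \<Sum>t\<in>T. d t * (if t = s then 1 else 0)) \<in> G"
    using d(1) ratio unfolding r_def by (intro partial_hom_sum[OF G] partial_hom_mult[OF G]) auto
  moreover have "(\<Sum>t\<in>T. poly (P t) w * r t) = (\<Sum>t\<in>T. poly (P t) w * y t) * (eval_at \<iota> (f t0) \<xi> / eval_at \<iota> (f s) \<xi>)"
    unfolding sum_distrib_right using nz[OF t0] by (intro sum.cong refl) (simp add: y_def r_def)
  moreover have "(\<Sum>t\<in>T. d t * (if t = s then 1 else 0)) = d s"
    using T(1) s(1) by (simp add: if_distrib[of "\<lambda>z. d _ * z"] cong: if_cong)
  ultimately have "(0, d s) \<in> G"
    using P(3) by simp
  then have "d s = 0"
    using partial_hom_zero[OF G] by blast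
  then show False
    using d(2)[OF s(1)] s(2) \<iota>_simps(2) by simp
qed


subsection \<open>The function field of a curve\<close>

text \<open>The specialisations with coordinates in the base field of a point \<open>\<eta>\<close>
  over the ambient field.\<close>

definition point_closure :: "'a ^ 'n \<Rightarrow> ('k ^ 'n) set set" where
  "point_closure \<eta> = {t \<in> proj_space. \<forall>f d. homogeneous d f \<longrightarrow> eval_at \<iota> f \<eta> = 0 \<longrightarrow> (\<forall>z\<in>t. eval_at id f z = 0)}"

lemma point_closure_closed: "zariski_closed (point_closure \<eta>)"
proof -
  define T :: "('n, 'k) mpoly set" where "T = {f. \<exists>d. homogeneous d f \<and> eval_at \<iota> f \<eta> = 0}"
  have "point_closure \<eta> = {t \<in> proj_space. \<forall>f\<in>T. \<forall>z\<in>t. eval_at id f z = 0}"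
    by (auto simp: point_closure_def T_def)
  moreover have "\<forall>f\<in>T. \<exists>d. homogeneous d f"
    by (auto simp: T_def)
  ultimately show ?thesis
    unfolding zariski_closed_def by blast
qed

text \<open>A form of the Nullstellensatz.\<close>

lemma point_closure_specialisation:
  assumes \<eta>: "\<eta> $ j = 1" and U: "finite U" "0 \<notin> U"
  shows "\<exists>v G. v $ j = 1 \<and> line v \<in> point_closure \<eta> \<and> partial_hom G \<and>
    (\<forall>c. (\<iota> c, c) \<in> G) \<and> (\<forall>i. (\<eta> $ i, v $ i) \<in> G) \<and> (\<forall>u\<in>U. (u, 0) \<notin> G)"
proof -
  \<comment> \<open>With the inverses of \<open>U\<close> in the domain, no element of
    \<open>U\<close> can be sent to 0.\<close>
  define Y where "Y = range (($) \<eta>) \<union> inverse ` U"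
  have "finite Y"
    using U(1) by (auto simp: Y_def)
  have dom: "Domain (embedding_graph \<iota>) = K"
    by (auto simp: embedding_graph_def Domain_iff)
  obtain a where a: "a \<in> K" "a \<noteq> 0"
    "\<And>G :: ('a \<times> 'k) set. partial_hom G \<Longrightarrow> Domain G = K \<Longrightarrow> (a, 0) \<notin> G \<Longrightarrow>
      (\<exists>H. partial_hom H \<and> G \<subseteq> H \<and> Y \<subseteq> Domain H)"
    using partial_hom_extension[OF is_subfield_imp_subring[OF K_subfield] \<open>finite Y\<close>, where 'b = 'k] by blast
  have "(a, 0) \<notin> embedding_graph \<iota>"
    using a(2) \<iota>_simps(2) by (simp add: embedding_graph_def)
  then obtain H :: "('a \<times> 'k) set" where H: "partial_hom H" "embedding_graph \<iota> \<subseteq> H" "Y \<subseteq> Domain H"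
    using a(3)[OF embedding_graph_partial_hom[OF embedding] dom] by blast
  have const: "(\<iota> c, c) \<in> H" for c
    using H(2) by (auto simp: embedding_graph_def)
  have "\<forall>i. \<exists>b. (\<eta> $ i, b) \<in> H"
    using H(3) rangeI[of "($) \<eta>"] unfolding Y_def Domain_iff subset_iff by blast
  then obtain b where b: "\<And>i. (\<eta> $ i, b i) \<in> H"
    by metis
  define v where "v = (\<chi> i. b i)"
  have v: "(\<eta> $ i, v $ i) \<in> H" for i
    using b by (simp add: v_def)
  have vj: "v $ j = 1"
    using v[of j] \<eta> partial_hom_unique[OF H(1) _ partial_hom_1[OF H(1)]] by simp
  have "line v \<in> point_closure \<eta>"
    unfolding point_closure_def
  proof (intro CollectI conjI allI impI)
    show "line v \<in> proj_space"
      using vj proj_space_iff by (metis zero_index zero_neq_one)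
    fix f :: "('n, 'k) mpoly" and d assume f: "homogeneous d f" "eval_at \<iota> f \<eta> = 0"
    have "(eval_at \<iota> f \<eta>, eval_at id f v) \<in> H"
      by (rule eval_at_pair[OF H(1)]) (use const v in simp_all)
    then have "eval_at id f v = 0"
      using f(2) partial_hom_zero[OF H(1)] by simp
    then show "\<forall>z\<in>line v. eval_at id f z = 0"
      using vanishes_on_line_iff[OF f(1) refl] by blast
  qed
  moreover have "(u, 0) \<notin> H" if u_U: "u \<in> U" for u
  proof
    assume u: "(u, 0) \<in> H"
    obtain e where "(inverse u, e) \<in> H"
      using H(3) u_U unfolding Y_def by blast
    then have "(u * inverse u, 0 * e) \<in> H"
      using u partial_hom_mult[OF H(1)] by blast
    moreover have "u \<noteq> 0"
      using U(2) u_U by auto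
    ultimately have "(1, 0) \<in> H"
      by simp
    then show False
      using partial_hom_unique[OF H(1) _ partial_hom_1[OF H(1)]] by fastforce
  qed
  ultimately show ?thesis
    using vj H(1) const v by blast
qed

text \<open>If neither \<open>Y\<close> nor \<open>Z\<close> contains the closure, some form
  vanishing on \<open>Y\<close> and some form vanishing on \<open>Z\<close> are nonzero at
  \<open>\<eta>\<close>. Both stay nonzero at one common specialisation, which then lies in neither
  set.\<close>

lemma point_closure_irreducible:
  assumes \<eta>: "\<eta> $ j = 1"
  shows "zariski_irreducible (point_closure \<eta>)"
proof -
  have "point_closure \<eta> \<noteq> {}"
    using point_closure_specialisation[OF \<eta>, of "{}"] by auto
  moreover have "point_closure \<eta> \<subseteq> Y \<or> point_closure \<eta> \<subseteq> Z"
    if YZ: "zariski_closed Y" "zariski_closed Z" "point_closure \<eta> \<subseteq> Y \<union> Z" for Y Z :: "('k ^ 'n) set set"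
  proof (rule ccontr)
    assume neg: "\<not> ?thesis"
    have form: "\<exists>f d. homogeneous d f \<and> eval_at \<iota> f \<eta> \<noteq> 0 \<and> (\<forall>t\<in>Y. \<forall>z\<in>t. eval_at id f z = 0)"
      if Y: "zariski_closed Y" "\<not> point_closure \<eta> \<subseteq> Y" for Y :: "('k ^ 'n) set set"
    proof -
      obtain T where T: "\<forall>f\<in>T. \<exists>d. homogeneous d f" "Y = {t \<in> proj_space. \<forall>f\<in>T. \<forall>z\<in>t. eval_at id f z = 0}"
        using Y(1) unfolding zariski_closed_def by blast
      obtain t where t: "t \<in> point_closure \<eta>" "t \<notin> Y"
        using Y(2) by blast
      then obtain f z where f: "f \<in> T" "z \<in> t" "eval_at id f z \<noteq> 0"
        using T(2) by (auto simp: point_closure_def)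
      then obtain d where d: "homogeneous d f"
        using T(1) by blast
      have "eval_at \<iota> f \<eta> \<noteq> 0"
        using t(1) f d by (auto simp: point_closure_def)
      then show ?thesis
        using d f(1) T(2) by blast
    qed
    obtain f d where f: "homogeneous d f" "eval_at \<iota> f \<eta> \<noteq> 0" "\<forall>t\<in>Y. \<forall>z\<in>t. eval_at id f z = 0"
      using form[OF YZ(1)] neg by blast
    obtain g e where g: "homogeneous e g" "eval_at \<iota> g \<eta> \<noteq> 0" "\<forall>t\<in>Z. \<forall>z\<in>t. eval_at id g z = 0"
      using form[OF YZ(2)] neg by blast
    obtain v G where v: "line v \<in> point_closure \<eta>" "partial_hom G" "\<forall>c. (\<iota> c, c) \<in> G"
      "\<forall>i. (\<eta> $ i, v $ i) \<in> G" "\<forall>u\<in>{eval_at \<iota> f \<eta>, eval_at \<iota> g \<eta>}. (u, 0) \<notin> G"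
      using point_closure_specialisation[OF \<eta>, of "{eval_at \<iota> f \<eta>, eval_at \<iota> g \<eta>}"] f(2) g(2) by auto
    have "(eval_at \<iota> h \<eta>, eval_at id h v) \<in> G" for h
      by (rule eval_at_pair[OF v(2)]) (use v(3,4) in simp_all)
    then have "eval_at id f v \<noteq> 0" "eval_at id g v \<noteq> 0"
      using v(5) by (metis insertI1, metis insertI1 insertI2)
    moreover have "v \<in> line v"
      by (metis rangeI vector_smult_lid)
    moreover have "line v \<in> Y \<or> line v \<in> Z"
      using v(1) YZ(3) by auto
    ultimately show False
      using f(3) g(3) by metis
  qed
  ultimately show ?thesis
    using point_closure_closed unfolding zariski_irreducible_def by blast
qed

text \<open>The chain consists of a point, the closure of \<open>\<eta>\<close>, and
  \<open>B\<close>. The nonconstant coordinate of \<open>\<eta>\<close> makes the first inclusion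
  strict, an equation of \<open>\<eta>\<close> that fails at \<open>\<xi>\<close> the
  second.\<close>

lemma specialisation_gives_chain:
  assumes B: "zariski_irreducible B" and \<eta>: "\<eta> $ j = 1" "\<eta> $ i \<notin> K"
    and special: "\<And>f d. homogeneous d f \<Longrightarrow> eval_at \<iota> f \<xi> = 0 \<Longrightarrow> eval_at \<iota> f \<eta> = 0"
    and proper: "\<exists>f d. homogeneous d f \<and> eval_at \<iota> f \<eta> = 0 \<and> eval_at \<iota> f \<xi> \<noteq> 0"
  shows "has_irreducible_chain B 2"
proof -
  obtain v where v: "v $ j = 1" "line v \<in> point_closure \<eta>"
    using point_closure_specialisation[OF \<eta>(1), of "{}"] by auto
  have "\<eta> $ i - \<iota> (v $ i) \<noteq> 0"
    using \<eta>(2) by auto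
  then obtain v' G where v': "v' $ j = 1" "line v' \<in> point_closure \<eta>" "partial_hom G"
    "\<forall>c. (\<iota> c, c) \<in> G" "\<forall>i. (\<eta> $ i, v' $ i) \<in> G" "(\<eta> $ i - \<iota> (v $ i), 0) \<notin> G"
    using point_closure_specialisation[OF \<eta>(1), of "{\<eta> $ i - \<iota> (v $ i)}"] by auto
  have "(\<eta> $ i - \<iota> (v $ i), v' $ i - v $ i) \<in> G"
    using v'(3-5) partial_hom_diff by blast
  then have ne: "v' $ i \<noteq> v $ i"
    using v'(6) by auto
  have lines: "line v \<noteq> line v'"
  proof
    assume "line v = line v'"
    moreover have "v \<noteq> 0"
      using v(1) by auto
    ultimately obtain a where "v = a *s v'"
      using line_generator_scale[of v v'] by blast
    moreover from this have "a = 1"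
      using v(1) v'(1) by auto
    ultimately show False
      using ne by simp
  qed
  have "v \<noteq> 0"
    using v(1) by auto
  have 1: "zariski_irreducible {line v}"
    by (rule line_irreducible[OF \<open>v \<noteq> 0\<close>])
  have 2: "zariski_irreducible (point_closure \<eta>)"
    by (rule point_closure_irreducible[OF \<eta>(1)])
  have 3: "{line v} \<subset> point_closure \<eta>"
    using v(2) v'(2) lines by (intro psubsetI) (simp, metis singletonD)
  have "point_closure \<eta> \<subseteq> B"
  proof
    fix t assume t: "t \<in> point_closure \<eta>"
    obtain T where T: "\<forall>f\<in>T. \<exists>d. homogeneous d f" "B = {t \<in> proj_space. \<forall>f\<in>T. \<forall>z\<in>t. eval_at id f z = 0}"
      using B unfolding zariski_irreducible_def zariski_closed_def by blast
    have "\<forall>z\<in>t. eval_at id f z = 0" if f_T: "f \<in> T" for f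
    proof -
      obtain d where d: "homogeneous d f"
        using T(1) f_T by blast
      have "\<forall>t\<in>B. \<forall>z\<in>t. eval_at id f z = 0"
        using f_T by (subst T(2)) blast
      then have "eval_at \<iota> f \<xi> = 0"
        using generic_zero_iff[OF d] by blast
      then show ?thesis
        using special[OF d] t d unfolding point_closure_def by blast
    qed
    then show "t \<in> B"
      using t T(2) unfolding point_closure_def by blast
  qed
  moreover have "\<not> B \<subseteq> point_closure \<eta>"
  proof
    assume sub: "B \<subseteq> point_closure \<eta>"
    obtain f d where f: "homogeneous d f" "eval_at \<iota> f \<eta> = 0" "eval_at \<iota> f \<xi> \<noteq> 0"
      using proper by blast
    then have "\<forall>t\<in>B. \<forall>z\<in>t. eval_at id f z = 0"
      using sub unfolding point_closure_def by blast
    then show False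
      using generic_zero_iff[OF f(1)] f(3) by blast
  qed
  ultimately have 4: "point_closure \<eta> \<subset> B"
    by blast
  define Z where "Z n = (if n = 0 then {line v} else if n = 1 then point_closure \<eta> else B)" for n :: nat
  have "\<forall>n\<le>2. zariski_irreducible (Z n) \<and> Z n \<subseteq> B"
    using 1 2 3 4 B by (auto simp: Z_def)
  moreover have "\<forall>n<2. Z n \<subset> Z (Suc n)"
  proof (intro allI impI)
    fix n :: nat assume "n < 2"
    then consider "n = 0" | "n = 1"
      by linarith
    then show "Z n \<subset> Z (Suc n)"
      using 3 4 by cases (simp_all add: Z_def)
  qed
  ultimately show ?thesis
    unfolding has_irreducible_chain_def by blast
qed

text \<open>If one coordinate is transcendental over the field of another, it can be specialised to
  a constant \<open>c\<close> while the other stays as it is. The resulting \<open>\<eta>\<close> is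
  no longer generic on \<open>B\<close> but not yet a constant point.\<close>

lemma transcendental_pair_gives_chain:
  assumes B: "zariski_irreducible B" and j: "\<xi> $ j \<noteq> 0" and x: "\<xi> $ i / \<xi> $ j \<notin> K"
    and y: "\<not> algebraic_over (generated_subfield (insert (\<xi> $ i / \<xi> $ j) K)) (\<xi> $ l / \<xi> $ j)"
  shows "has_irreducible_chain B 2"
proof -
  define y where "y = inverse (\<xi> $ j) *s \<xi>"
  have yc: "y $ m = \<xi> $ m / \<xi> $ j" for m
    by (simp add: y_def field_simps)
  have \<xi>: "\<xi> = \<xi> $ j *s y"
    using j by (simp add: y_def vec_eq_iff)
  define E where "E = generated_subfield (insert (y $ i) K)"
  have E: "is_subring E" "insert (y $ i) K \<subseteq> E"
    unfolding E_def
    by (rule is_subfield_imp_subring[OF generated_subfield_is_subfield], rule generated_subfield_superset)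
  have trans: "p = 0" if "poly_over E p" "poly p (y $ l) = 0" for p
    using assms(4) that unfolding algebraic_over_def yc[symmetric] E_def[symmetric] by blast
  define A where "A = adjoin_ring E (y $ l)"
  have A: "is_subring A"
    unfolding A_def by (rule adjoin_ring_is_subring[OF E(1)])
  obtain a where a: "a \<in> A" "a \<noteq> 0"
    "\<And>G :: ('a \<times> 'a) set. partial_hom G \<Longrightarrow> Domain G = A \<Longrightarrow> (a, 0) \<notin> G \<Longrightarrow>
      (\<exists>H. partial_hom H \<and> G \<subseteq> H \<and> range (($) y) \<subseteq> Domain H)"
    using partial_hom_extension[OF A, of "range (($) y)", where 'b = 'a] by auto
  obtain p where p: "poly_over E p" "a = poly p (y $ l)"
    using a(1) by (auto simp: A_def adjoin_ring_def)
  have "finite {z. poly p z = 0}"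
    using a(2) p(2) by (intro poly_roots_finite) auto
  then have "finite (\<iota> -` {z. poly p z = 0})"
    by (rule finite_vimageI) (simp add: inj_def \<iota>_simps)
  \<comment> \<open>Infinitely many constants are available and only finitely many are roots of
    \<open>p\<close>; this choice keeps \<open>a\<close> from being sent to 0.\<close>
  then obtain c where c: "poly p (\<iota> c) \<noteq> 0"
    using infinite_alg_closed_field[where 'b = 'k] by (metis (mono_tags, lifting) UNIV_I finite_subset mem_Collect_eq subsetI vimageI)
  define D where "D = {(e, e) | e. e \<in> E}"
  have D: "partial_hom D"
    using E(1) by (auto simp: partial_hom_def D_def is_subring_def)
  have DE: "Domain D = E"
    by (auto simp: D_def)
  have pair: "p = q \<and> poly_over E p" if "poly_pair D p q" for p q
    using that by (auto simp: poly_pair_def D_def poly_over_def poly_eq_iff)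
  have root: "poly q (\<iota> c) = 0" if "poly_pair D p q" "poly p (y $ l) = 0" for p q
    using pair[OF that(1)] trans[OF _ that(2)] by auto
  define G where "G = {(poly p (y $ l), poly q (\<iota> c)) | p q. poly_pair D p q}"
  have G: "partial_hom G" "D \<subseteq> G" "(y $ l, \<iota> c) \<in> G"
    unfolding G_def by (rule partial_hom_adjoin[OF D root]; assumption)+
  have dom: "Domain G = A"
    unfolding G_def A_def Domain_adjoin[OF D] DE ..
  have "poly_pair D p p"
    using p(1) by (auto simp: poly_pair_def D_def poly_over_def)
  then have "(a, poly p (\<iota> c)) \<in> G"
    unfolding p(2) G_def by blast
  then have "(a, 0) \<notin> G"
    using partial_hom_unique[OF G(1)] c by blast
  then obtain H :: "('a \<times> 'a) set" where H: "partial_hom H" "G \<subseteq> H" "range (($) y) \<subseteq> Domain H"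
    using a(3)[OF G(1) dom] by blast
  have DH: "(e, e) \<in> H" if "e \<in> E" for e
    using G(2) H(2) that by (auto simp: D_def)
  have "\<forall>m. \<exists>b. (y $ m, b) \<in> H"
    using H(3) rangeI[of "($) y"] unfolding Domain_iff subset_iff by blast
  then obtain b where b: "\<And>m. (y $ m, b m) \<in> H"
    by metis
  define \<eta> where "\<eta> = (\<chi> m. b m)"
  have \<eta>: "(y $ m, \<eta> $ m) \<in> H" for m
    using b by (simp add: \<eta>_def)
  have uniq: "\<eta> $ m = e" if "(y $ m, e) \<in> H" for m e
    using partial_hom_unique[OF H(1) \<eta> that] .
  have "y $ j = 1"
    using j by (simp add: yc)
  then have \<eta>j: "\<eta> $ j = 1"
    using partial_hom_1[OF H(1)] by (intro uniq) simp
  have \<eta>i: "\<eta> $ i = y $ i"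
    using DH E(2) by (intro uniq) auto
  have \<eta>l: "\<eta> $ l = \<iota> c"
    using G(3) H(2) by (intro uniq) auto
  show ?thesis
  proof (rule specialisation_gives_chain[OF B \<eta>j])
    show "\<eta> $ i \<notin> K"
      using x by (simp add: \<eta>i yc)
    fix f :: "('n, 'k) mpoly" and d assume f: "homogeneous d f" "eval_at \<iota> f \<xi> = 0"
    have "eval_at \<iota> f \<xi> = (\<xi> $ j) ^ d * eval_at \<iota> f y"
      using eval_at_scale[OF embedding f(1), of "\<xi> $ j" y] \<xi> by metis
    then have "eval_at \<iota> f y = 0"
      using f(2) j by simp
    moreover have "(eval_at \<iota> f y, eval_at \<iota> f \<eta>) \<in> H"
    proof (rule eval_at_pair[OF H(1)])
      show "(\<iota> c, \<iota> c) \<in> H" for c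
        using E(2) by (intro DH) blast
      show "(y $ m, \<eta> $ m) \<in> H" for m
        by (rule \<eta>)
    qed
    ultimately show "eval_at \<iota> f \<eta> = 0"
      using partial_hom_zero[OF H(1)] by simp
  next
    define F where "F = two_term_form 1 l c j"
    have "homogeneous 1 F"
      unfolding F_def by (rule homogeneous_two_term_form)
    moreover have "eval_at \<iota> F \<eta> = 0"
      by (simp add: F_def eval_at_two_term_form[OF embedding] \<eta>l \<eta>j \<iota>_simps)
    moreover have "eval_at \<iota> F \<xi> \<noteq> 0"
    proof
      assume "eval_at \<iota> F \<xi> = 0"
      then have "y $ l = \<iota> c"
        using j by (simp add: F_def eval_at_two_term_form[OF embedding] \<iota>_simps yc field_simps)
      moreover have "\<iota> c \<in> E"
        using E(2) by blast
      then have "poly_over E [:- \<iota> c, 1:]"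
        using subring_uminus[OF E(1)] subring_1[OF E(1)] by (simp add: poly_over_pCons[OF E(1)] poly_over_0[OF E(1)])
      ultimately show False
        using trans[of "[:- \<iota> c, 1:]"] by simp
    qed
    ultimately show "\<exists>f d. homogeneous d f \<and> eval_at \<iota> f \<eta> = 0 \<and> eval_at \<iota> f \<xi> \<noteq> 0"
      by blast
  qed
qed

text \<open>With constant coordinates only, \<open>B\<close> would be a single point and could not
  contain a chain of length 1.\<close>

lemma nonconstant_coordinate:
  assumes chain: "has_irreducible_chain B 1" and j: "\<xi> $ j \<noteq> 0"
  shows "\<exists>i. \<xi> $ i / \<xi> $ j \<notin> K"
proof (rule ccontr)
  assume "\<not> ?thesis"
  then have "\<forall>i. \<exists>c. \<xi> $ i / \<xi> $ j = \<iota> c"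
    by auto
  then obtain c where c: "\<And>i. \<xi> $ i / \<xi> $ j = \<iota> (c i)"
    by metis
  define v where "v = (\<chi> i. c i)"
  have \<xi>: "\<xi> $ i = \<xi> $ j * \<iota> (v $ i)" for i
    using c[of i] j by (simp add: v_def field_simps)
  have v0: "v \<noteq> 0"
    using \<xi>[of j] j \<iota>_simps(2) by auto
  have "t = line v" if t: "t \<in> B" for t
  proof -
    obtain w where w: "w \<noteq> 0" "t = line w"
      using t B_subset proj_space_iff by blast
    have "w \<in> t"
      using w(2) by (metis rangeI vector_smult_lid)
    have "eval_at id (two_term_form (v $ m) l (v $ l) m) w = 0" for l m
    proof -
      have "eval_at \<iota> (two_term_form (v $ m) l (v $ l) m) \<xi> = 0"
        unfolding eval_at_two_term_form[OF embedding] by (subst (1 2) \<xi>) (simp add: mult_ac)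
      then show ?thesis
        using generic_zero_iff[OF homogeneous_two_term_form] t \<open>w \<in> t\<close> by blast
    qed
    then show ?thesis
      using separating_form[OF v0 w(1)] w(2) by blast
  qed
  then have sing: "B \<subseteq> {line v}"
    by blast
  obtain Z where Z: "\<forall>i\<le>1. zariski_irreducible (Z i) \<and> Z i \<subseteq> B" "\<forall>i<1. Z i \<subset> Z (Suc i)"
    using chain unfolding has_irreducible_chain_def by blast
  have "Z 0 \<noteq> {}" "Z 0 \<subset> Z 1" "Z 1 \<subseteq> B"
    using Z by (auto simp: zariski_irreducible_def)
  then show False
    using sing by blast
qed

lemma function_field_finite_dim:
  assumes j: "\<xi> $ j \<noteq> 0" and E: "is_subfield E" "K \<subseteq> E"
    and alg: "\<And>i. algebraic_over E (\<xi> $ i / \<xi> $ j)"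
  shows "finite_dim E L"
proof -
  have "\<exists>N. is_subfield N \<and> E \<union> range (\<lambda>i. \<xi> $ i / \<xi> $ j) \<subseteq> N \<and> finite_dim E N"
    using alg by (intro finite_dim_adjoin[OF E(1)]) auto
  then obtain N where N: "is_subfield N" "E \<union> range (\<lambda>i. \<xi> $ i / \<xi> $ j) \<subseteq> N" "finite_dim E N"
    by blast
  have "\<xi> $ i / \<xi> $ j \<in> N" for i
    using N(2) rangeI[of "\<lambda>i. \<xi> $ i / \<xi> $ j" i] by blast
  then have "L \<subseteq> N"
    using N(1,2) E(2) by (intro L_least[OF j]) auto
  then show ?thesis
    using N(3) by (auto simp: finite_dim_def)
qed

lemma curve_function_field:
  assumes "zariski_irreducible B" "zariski_dim_eq B 1"
  shows "\<exists>x\<in>L. x \<notin> K \<and> finite_dim (generated_subfield (insert x K)) L"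
proof -
  obtain j where j: "\<xi> $ j \<noteq> 0"
    using generic_coordinate_nonzero by blast
  obtain i where i: "\<xi> $ i / \<xi> $ j \<notin> K"
    using nonconstant_coordinate[OF _ j] assms(2) by (auto simp: zariski_dim_eq_def)
  have "\<not> has_irreducible_chain B 2"
    using assms(2) by (simp add: zariski_dim_eq_def numeral_2_eq_2)
  then have "algebraic_over (generated_subfield (insert (\<xi> $ i / \<xi> $ j) K)) (\<xi> $ l / \<xi> $ j)" for l
    using transcendental_pair_gives_chain[OF assms(1) j i] by blast
  then have "finite_dim (generated_subfield (insert (\<xi> $ i / \<xi> $ j) K)) L"
    using generated_subfield_superset[of "insert (\<xi> $ i / \<xi> $ j) K"]
    by (intro function_field_finite_dim[OF j generated_subfield_is_subfield]) auto
  then show ?thesis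
    using i coordinate_ratio_in_L[OF j] by blast
qed

lemma projective_line_function_field:
  assumes "CARD('n) = 2" "B = proj_space"
  shows "\<exists>x\<in>L. x \<notin> K \<and> finite_dim (generated_subfield (insert x K)) L"
proof -
  obtain j where j: "\<xi> $ j \<noteq> 0"
    using generic_coordinate_nonzero by blast
  obtain a b :: 'n where ab: "UNIV = {a, b}" "a \<noteq> b"
    using assms(1) unfolding card_2_iff by blast
  obtain i where i: "i \<noteq> j" "UNIV = {i, j}"
  proof (cases "j = a")
    case True
    then show ?thesis
      using that[of b] ab by auto
  next
    case False
    moreover have "j \<in> {a, b}"
      unfolding ab(1)[symmetric] by simp
    ultimately show ?thesis
      using that[of a] ab by auto
  qed
  define x where "x = \<xi> $ i / \<xi> $ j"
  have "x \<notin> K"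
  proof
    assume "x \<in> K"
    then obtain c where c: "x = \<iota> c"
      by blast
    \<comment> \<open>Coordinate \<open>i\<close> is chosen so that the form
      \<open>X\<^sub>i - c * X\<^sub>j\<close> has the value 1 at \<open>v\<close>.\<close>
    define v :: "'k ^ 'n" where "v = (\<chi> m. if m = j then 1 else c + 1)"
    have "v $ j = 1" "v $ i = c + 1"
      using i(1) by (simp_all add: v_def)
    then have "v \<noteq> 0"
      by auto
    then have vB: "line v \<in> B"
      using assms(2) proj_space_iff by blast
    have "eval_at \<iota> (two_term_form 1 i c j) \<xi> = 0"
      using c j by (simp add: eval_at_two_term_form[OF embedding] x_def \<iota>_simps field_simps)
    then have "eval_at id (two_term_form 1 i c j) v = 0"
      using generic_zero_iff[OF homogeneous_two_term_form] vB by (metis rangeI vector_smult_lid)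
    then show False
      using \<open>v $ j = 1\<close> \<open>v $ i = c + 1\<close> unfolding eval_at_two_term_form[OF field_embedding_id] by simp
  qed
  moreover have "finite_dim (generated_subfield (insert x K)) L"
  proof (rule function_field_finite_dim[OF j generated_subfield_is_subfield])
    show "K \<subseteq> generated_subfield (insert x K)"
      using generated_subfield_superset[of "insert x K"] by simp
    fix l
    let ?E = "generated_subfield (insert x K)"
    note E = generated_subfield_is_subfield[of "insert x K"]
    note R = is_subfield_imp_subring[OF E]
    have "l \<in> {i, j}"
      unfolding i(2)[symmetric] by simp
    then have "l = i \<or> l = j"
      by simp
    then have z: "\<xi> $ l / \<xi> $ j \<in> ?E"
      using generated_subfield_superset[of "insert x K"] subfield_intros(2)[OF E] j by (auto simp: x_def)
    show "algebraic_over ?E (\<xi> $ l / \<xi> $ j)"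
      unfolding algebraic_over_def
      using z subfield_intros[OF E]
      by (intro exI[of _ "[:- (\<xi> $ l / \<xi> $ j), 1:]"])
         (simp add: poly_over_pCons[OF R] poly_over_0[OF R])
  qed
  ultimately show ?thesis
    using coordinate_ratio_in_L[OF j] unfolding x_def by blast
qed

end


section \<open>Places above the points of a curve\<close>

context generic_curve
begin

text \<open>The trace of \<open>V\<close> on \<open>L\<close> carries the evaluation at
  \<open>t\<close>. A function with value 0 has no inverse in the local ring, one with a nonzero
  value does, so the kernel of the evaluation is the trace of the maximal ideal.\<close>

lemma place_residue:
  assumes t: "t \<in> B" and V: "valuation_ring F V" "V \<inter> L = local_ring \<iota> \<xi> t"
  shows "K \<subseteq> V" and "\<And>a. a \<in> V \<inter> L \<Longrightarrow> \<exists>c\<in>K. a - c \<in> maximal_ideal_of V"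
    and "\<And>w. w \<in> L \<Longrightarrow> w \<noteq> 0 \<Longrightarrow> w \<in> maximal_ideal_of V \<Longrightarrow> (w, 0) \<in> local_graph t"
proof -
  note G = local_graph_partial_hom[OF t]
  have dom: "Domain (local_graph t) = V \<inter> L"
    using Domain_local_graph[OF t] V(2) by simp
  show KV: "K \<subseteq> V"
  proof
    fix c assume "c \<in> K"
    then have "c \<in> Domain (local_graph t)"
      using local_graph_const[OF t] by (auto simp: Domain_iff)
    then show "c \<in> V"
      using dom by blast
  qed
  show "\<exists>c\<in>K. a - c \<in> maximal_ideal_of V" if a: "a \<in> V \<inter> L" for a
  proof -
    obtain c where c: "(a, c) \<in> local_graph t"
      using a dom by blast
    have 0: "(a - \<iota> c, 0) \<in> local_graph t"
      using partial_hom_diff[OF G c local_graph_const[OF t, of c]] by simp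
    then have mem: "a - \<iota> c \<in> V \<inter> L"
      using dom by blast
    have "inverse (a - \<iota> c) \<notin> V" if "a - \<iota> c \<noteq> 0"
    proof
      assume "inverse (a - \<iota> c) \<in> V"
      then have "inverse (a - \<iota> c) \<in> Domain (local_graph t)"
        using dom mem subfield_inverse[OF L_subfield] by blast
      then obtain e where "(inverse (a - \<iota> c), e) \<in> local_graph t"
        by blast
      from partial_hom_mult[OF G 0 this] have "(1, 0) \<in> local_graph t"
        using that by simp
      then show False
        using partial_hom_unique[OF G _ partial_hom_1[OF G]] by fastforce
    qed
    then have "a - \<iota> c \<in> maximal_ideal_of V"
      using mem by (auto simp: maximal_ideal_of_def)
    then show ?thesis
      by blast
  qed
  show "(w, 0) \<in> local_graph t" if w: "w \<in> L" "w \<noteq> 0" "w \<in> maximal_ideal_of V" for w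
  proof -
    have "w \<in> V \<inter> L"
      using w by (auto simp: maximal_ideal_of_def)
    then obtain d where d: "(w, d) \<in> local_graph t"
      using dom by blast
    have "d = 0"
    proof (rule ccontr)
      assume "d \<noteq> 0"
      then have "inverse w \<in> Domain (local_graph t)"
        using local_graph_inverse[OF t d] by blast
      then have "inverse w \<in> V"
        using dom by blast
      then show False
        using w by (simp add: maximal_ideal_of_def)
    qed
    then show ?thesis
      using d by simp
  qed
qed

lemma generated_subfield_insert_eq:
  assumes "w \<in> generated_subfield (insert x K)" "x \<in> generated_subfield (insert w K)"
  shows "generated_subfield (insert w K) = generated_subfield (insert x K)"
  using assms generated_subfield_superset[of "insert x K"] generated_subfield_superset[of "insert w K"]
  by (intro equalityI generated_subfield_least generated_subfield_is_subfield) auto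

lemma tower_exists:
  assumes x: "x \<in> L" "x \<notin> K" and fin: "finite_dim (generated_subfield (insert x K)) L"
    and alg: "\<forall>z. algebraic_over L z"
  shows "\<exists>F. galois_extension L F \<and> \<not> finite_extension L F \<and> local_degrees_uniformly_bounded \<iota> B \<xi> F \<and>
    (\<forall>d\<ge>1. \<not> F \<subseteq> bounded_degree_compositum L d) \<and> finite (branch_points \<iota> B \<xi> F)"
proof -
  \<comment> \<open>The numbers 3 and 4 differ by 1, so in every characteristic one of them is
    nonzero.\<close>
  have "degree [:1, 3, 4 :: 'k:] > 0"
  proof (rule ccontr)
    assume "\<not> ?thesis"
    then have *: "(3 :: 'k) = 0" "(4 :: 'k) = 0"
      by (auto split: if_splits)
    have "(1 :: 'k) = 4 - 3"
      by simp
    then show False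
      unfolding * by simp
  qed
  then obtain \<kappa>0 :: 'k where "poly [:1, 3, 4:] \<kappa>0 = 0"
    using alg_closed_imp_poly_has_root by blast
  then have \<kappa>0: "4 * \<kappa>0\<^sup>2 + 3 * \<kappa>0 + 1 = 0"
    by (simp add: power2_eq_square algebra_simps)
  define \<kappa> where "\<kappa> = \<iota> \<kappa>0"
  have num: "\<iota> (of_nat n) = of_nat n" for n
    by (induction n) (simp_all add: \<iota>_simps)
  have "\<iota> (4 * \<kappa>0\<^sup>2 + 3 * \<kappa>0 + 1) = 4 * \<kappa>\<^sup>2 + 3 * \<kappa> + 1"
    using num[of 3] num[of 4] by (simp add: \<iota>_simps \<kappa>_def power2_eq_square)
  then have \<kappa>: "\<kappa> \<in> K" "4 * \<kappa>\<^sup>2 + 3 * \<kappa> + 1 = 0"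
    unfolding \<kappa>0 \<kappa>_def by (simp_all add: \<iota>_simps)
  have xx: "x * (x - 1) \<noteq> 0"
    using x(2) subfield_intros(1,2)[OF K_subfield] by auto
  define h where "h = \<kappa>\<^sup>2 / (x * (x - 1))"
  obtain s where "poly [:- h, -1, 1:] s = 0"
    using alg_closed_imp_poly_has_root[of "[:- h, -1, 1:]"] by auto
  then have "s * (s - 1) = h"
    by (simp add: algebra_simps eq_neg_iff_add_eq_0)
  then have s: "x * (x - 1) * (s * (s - 1)) = \<kappa>\<^sup>2"
    using xx by (simp add: h_def)
  interpret isogeny_tower K L \<kappa> x s
    using K_subfield L_subfield K_subset_L range_embedding_closed[OF embedding] \<kappa> x s alg fin
    by unfold_locales blast+
  note F = tower_field_is_subfield
  have place: "K \<subseteq> V \<and> (\<forall>v\<in>V. \<exists>c\<in>K. v - c \<in> maximal_ideal_of V) \<and>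
      (\<forall>w\<in>L. w \<noteq> 0 \<longrightarrow> w \<in> maximal_ideal_of V \<longrightarrow> (w, 0) \<in> local_graph t)"
    if t: "t \<in> B" and V: "valuation_ring tower_field V" "V \<inter> L = local_ring \<iota> \<xi> t" for t V
    using place_residue[OF t V]
      residue_of_algebraic[OF F V(1) K_subfield _ k_closed L_subfield L_subset_tower_field _ _ algebraic]
    by blast
  have "local_degrees_uniformly_bounded \<iota> B \<xi> tower_field"
    unfolding local_degrees_uniformly_bounded_def
  proof (intro exI[of _ 2] ballI)
    fix t V assume t: "t \<in> B" "V \<in> places_above L tower_field (local_ring \<iota> \<xi> t)"
    then have V: "valuation_ring tower_field V" "V \<inter> L = local_ring \<iota> \<xi> t"
      by (auto simp: places_above_def)
    show "finite (decomposition_group L tower_field V) \<and> card (decomposition_group L tower_field V) \<le> 2"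
      using decomposition_group_card[OF V(1)] place[OF t(1) V] by blast
  qed
  moreover have "finite (branch_points \<iota> B \<xi> tower_field)"
  proof -
    \<comment> \<open>The zeros of these functions include all points where \<open>x\<close> has a
      pole or takes a branch value. Each of them generates the same field over \<open>K\<close> as
      \<open>x\<close>, so \<open>finite_zeros\<close> applies.\<close>
    define W where "W = insert (inverse x) ((\<lambda>c. x - c) ` branch_values)"
    have "finite {t \<in> B. (w, 0) \<in> local_graph t}" if w: "w \<in> W" for w
    proof (rule finite_zeros)
      show "w \<noteq> 0"
        using w x(2) subfield_intros(1)[OF K_subfield] by (auto simp: W_def branch_values_def)
      have "w \<in> generated_subfield (insert x K) \<and> x \<in> generated_subfield (insert w K)"
      proof -
        have sup: "x \<in> generated_subfield (insert x K)" "w \<in> generated_subfield (insert w K)"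
          "K \<subseteq> generated_subfield (insert x K)" "K \<subseteq> generated_subfield (insert w K)"
          using generated_subfield_superset[of "insert x K"] generated_subfield_superset[of "insert w K"] by auto
        note sub = generated_subfield_is_subfield
        consider "w = inverse x" | c where "c \<in> K" "w = x - c"
          using w by (auto simp: W_def branch_values_def)
        then show ?thesis
        proof cases
          case 1
          then have "x = inverse w"
            by simp
          then show ?thesis
            using 1 sup subfield_inverse[OF sub] by metis
        next
          case 2
          then have "x = w + c"
            by simp
          moreover have "w + c \<in> generated_subfield (insert w K)" "x - c \<in> generated_subfield (insert x K)"
            using 2(1) sup by (auto intro!: subfield_intros(3,6)[OF sub])
          ultimately show ?thesis
            using 2(2) by simp
        qed
      qed
      then show "finite_dim (generated_subfield (insert w K)) L"
        using generated_subfield_insert_eq fin by metis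
    qed
    moreover have "finite W"
      using finite_branch_values by (simp add: W_def)
    moreover have "branch_points \<iota> B \<xi> tower_field \<subseteq> (\<Union>w\<in>W. {t \<in> B. (w, 0) \<in> local_graph t})"
    proof
      fix t assume "t \<in> branch_points \<iota> B \<xi> tower_field"
      then obtain V \<sigma> where t: "t \<in> B" and V: "valuation_ring tower_field V" "V \<inter> L = local_ring \<iota> \<xi> t"
        and \<sigma>: "\<sigma> \<in> decomposition_group L tower_field V" "\<exists>z\<in>tower_field. \<sigma> z \<noteq> z"
        by (auto simp: branch_points_def places_above_def inertia_group_def)
      note p = place[OF t V]
      have "inverse x \<in> maximal_ideal_of V \<or> (\<exists>c\<in>branch_values. x - c \<in> maximal_ideal_of V)"
        using inertia_branch_value[OF V(1) _ _ \<sigma>] p by blast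
      then obtain w where w: "w \<in> W" "w \<in> maximal_ideal_of V"
        by (auto simp: W_def)
      have "w \<in> L"
        using w(1) x(1) K_subset_L subfield_intros(3,11)[OF L_subfield] by (auto simp: W_def branch_values_def)
      moreover have "w \<noteq> 0"
        using w(1) x(2) subfield_intros(1)[OF K_subfield] by (auto simp: W_def branch_values_def)
      ultimately show "t \<in> (\<Union>w\<in>W. {t \<in> B. (w, 0) \<in> local_graph t})"
        using p w t by blast
    qed
    ultimately show ?thesis
      by (meson finite_UN_I finite_subset)
  qed
  \<comment> \<open>A finite extension would lie in the compositum for its own degree.\<close>
  moreover have "\<not> finite_extension L tower_field"
    using finite_extension_subset_compositum tower_field_not_in_compositum by blast
  ultimately show ?thesis
    using tower_field_galois tower_field_not_in_compositum by blast
qed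

end

theorem theorem5p4:
  fixes \<iota> :: "'k::alg_closed_field \<Rightarrow> 'a::alg_closed_field"
    and B :: "('k ^ 'n::finite) set set"
    and \<xi> :: "'a ^ 'n"
  assumes "field_embedding \<iota>"
    and "generic_point \<iota> B \<xi>"
    and "\<forall>z. algebraic_over (function_field \<iota> \<xi>) z"
    and "(CHAR('k) > 0 \<and> smooth_projective_curve B \<and> (\<exists>g\<ge>1. genus_eq \<iota> B \<xi> g)) \<or>
         (CHAR('k) = 0 \<and> CARD('n) = 2 \<and> B = proj_space)"
  shows "\<exists>F. galois_extension (function_field \<iota> \<xi>) F \<and>
             \<not> finite_extension (function_field \<iota> \<xi>) F \<and>
             local_degrees_uniformly_bounded \<iota> B \<xi> F \<and>
             (\<forall>d\<ge>1. \<not> F \<subseteq> bounded_degree_compositum (function_field \<iota> \<xi>) d) \<and>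
             finite (branch_points \<iota> B \<xi> F)"
proof -
  have curve: "B = proj_space \<and> CARD('n) = 2 \<or> zariski_irreducible B \<and> zariski_dim_eq B 1"
    using assms(4) by (auto simp: smooth_projective_curve_def)
  have "B \<subseteq> proj_space"
    using curve by (auto simp: zariski_irreducible_def zariski_closed_def)
  moreover have "B \<noteq> {}"
  proof -
    have "line (1 :: 'k ^ 'n) \<in> proj_space"
      unfolding proj_space_iff by (intro exI[of _ 1]) simp
    then show ?thesis
      using curve by (auto simp: zariski_irreducible_def)
  qed
  ultimately interpret generic_curve \<iota> B \<xi>
    using assms(1,2) by unfold_locales
  have "\<exists>x\<in>L. x \<notin> K \<and> finite_dim (generated_subfield (insert x K)) L"
    using curve curve_function_field projective_line_function_field by blast
  then show ?thesis
    using tower_exists assms(3) by blast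
qed

end
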